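(* Let $\kappa$ be a regular uncountable cardinal such that $\kappa^{<\kappa} = \kappa$ and $2^\kappa = \kappa^+$. Assume that $\boxtimes^*_\kappa(\mathrm{NS}^+ \restriction (\kappa^+ \cap \mathrm{cof}(\kappa)))$ holds. Then there exists a family of $2^{(\kappa^+)}$ many normal $\kappa$-complete $\mathbb{R}_\kappa$-embeddable $\kappa^+$-Aronszajn trees which is pairwise far, i.e. any two distinct trees in the family are far.
   Context: Trees: for a tree $T$ and $x \in T$, $\mathrm{ht}_T(x)$ is the height of $x$; $T(\delta)$ is level $\delta$; for a set $A$ of ordinals, $T \restriction A = \{x \in T : \mathrm{ht}_T(x) \in A\}$. A $\kappa^+$-tree is a tree of height $\kappa^+$ all of whose levels have size $<\kappa^+$; it is Aronszajn if it has no cofinal branch. A tree is $\kappa$-complete if every chain of order type $<\kappa$ has an upper bound. A $\lambda$-tree $T$ is normal if (i) for every $x \in T$ and every $\gamma<\lambda$ above $\mathrm{ht}_T(x)$ there is $y >_T x$ of height $\gamma$; (ii) distinct nodes of the same limit height have distinct sets of predecessors; (iii) every node has two incomparable nodes above it. $\mathbb{Q}_\kappa$ is the set of functions $f:\kappa\to 2$ such that $\{\alpha<\kappa : f(\alpha)=1\}$ is nonempty and of size $<\kappa$, ordered lexicographically; $\mathbb{R}_\kappa$ is the Dedekind completion of $\mathbb{Q}_\kappa$. A tree $T$ is $L$-embeddable (for a linear order $L$) if there is $f:T\to L$ with $x<_T y \Rightarrow f(x)<_L f(y)$. Two $\lambda$-trees $T,U$ are club isomorphic if there is a club $C\subseteq\lambda$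 and an isomorphism (order-preserving and reflecting bijection) $T\restriction C \to U \restriction C$. A subset $X\subseteq T$ is downward closed if it contains all predecessors of its elements. $T$ and $U$ are near if there exist downward closed subtrees of $T$ and $U$ (with inherited order) which are club isomorphic; otherwise they are far. For a regular uncountable $\kappa$ and a family $\mathcal S$ of stationary subsets of $\kappa^+\cap\mathrm{cof}(\kappa)$, $\boxtimes^*_\kappa(\mathcal S)$ asserts the existence of a sequence $\langle C_\delta : \delta<\kappa^+\rangle$, each $C_\delta$ a club subset of $\delta$ of order type $\le\kappa$, such that for every unbounded $X\subseteq\kappa^+$ and every $S\in\mathcal S$ there are stationarily many $\delta\in S$ for which $(C_\delta\cap X)\setminus \lim(C_\delta)$ is cofinal in $\delta$. $\mathrm{NS}^+\restriction T$ denotes the collection of all stationary subsets of $T$. *)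

theory Defs
  imports Main "HOL-Library.FuncSet"
begin

unbundle cardinal_syntax

text \<open>
  An ordinal is represented by a well-order relation \<open>r\<close>: the elements of \<open>Field r\<close> are the
  ordinals below it, and \<open>a \<in> Field r\<close> is itself identified with the order \<open>seg r a\<close> on its
  predecessors.  Order types are compared with \<open>=o\<close>, \<open>\<le>o\<close>, \<open><o\<close>.  A cardinal \<open>\<kappa>\<close> is a
  \<open>Card_order\<close> relation and \<open>\<kappa>\<^sup>+\<close> is \<open>cardSuc \<kappa>\<close>.  Orders (also trees) are reflexive, so that
  the carrier is the field of the relation and \<open>Restr r X\<close> has field \<open>X\<close> for \<open>X \<subseteq> Field r\<close>.
\<close>

definition seg :: "'a rel \<Rightarrow> 'a \<Rightarrow> 'a rel" where
  "seg r a = Restr r (underS r a)"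


subsection \<open>Clubs, stationary sets, cofinality\<close>

text \<open>
  Library \<^const>\<open>cofinal\<close> is strict, hence never satisfied in a successor ordinal; the following
  one is non-strict, so that every ordinal has a club subset.  Both agree on limit ordinals.
\<close>

definition unbounded_in :: "'a rel \<Rightarrow> 'a set \<Rightarrow> bool" where
  "unbounded_in r X \<longleftrightarrow> X \<subseteq> Field r \<and> (\<forall>a\<in>Field r. \<exists>b\<in>X. (a, b) \<in> r)"

text \<open>By strictness of \<^const>\<open>cofinal\<close>, elements of \<open>lim_points r X\<close> are (nonzero) limit ordinals.\<close>

definition lim_points :: "'a rel \<Rightarrow> 'a set \<Rightarrow> 'a set" where
  "lim_points r X = {a \<in> Field r. underS r a \<noteq> {} \<and> cofinal (X \<inter> underS r a) (seg r a)}"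

definition limit_ordinal :: "'a rel \<Rightarrow> 'a \<Rightarrow> bool" where
  "limit_ordinal r a \<longleftrightarrow>
     a \<in> Field r \<and> underS r a \<noteq> {} \<and> (\<forall>b\<in>underS r a. \<exists>c\<in>underS r a. b \<in> underS r c)"

definition club :: "'a rel \<Rightarrow> 'a set \<Rightarrow> bool" where
  "club r C \<longleftrightarrow> unbounded_in r C \<and> lim_points r C \<subseteq> C"

definition stationary :: "'a rel \<Rightarrow> 'a set \<Rightarrow> bool" where
  "stationary r S \<longleftrightarrow> S \<subseteq> Field r \<and> (\<forall>C. club r C \<longrightarrow> S \<inter> C \<noteq> {})"

definition has_cofinality :: "'a rel \<Rightarrow> 'b rel \<Rightarrow> bool" where
  "has_cofinality r k \<longleftrightarrow>
     (\<exists>X. unbounded_in r X \<and> (Restr r X) =o k) \<and> (\<forall>X. unbounded_in r X \<longrightarrow> k \<le>o (Restr r X))"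

definition cof_set :: "'a rel \<Rightarrow> 'b rel \<Rightarrow> 'a set" where
  "cof_set r k = {a \<in> Field r. has_cofinality (seg r a) k}"

definition NS_plus_restr :: "'a rel \<Rightarrow> 'a set \<Rightarrow> 'a set set" where
  "NS_plus_restr r A = {S. S \<subseteq> A \<and> stationary r S}"

definition boxtimes_star :: "'a rel \<Rightarrow> 'a set set set \<Rightarrow> bool" where
  "boxtimes_star \<kappa> \<S> \<longleftrightarrow>
     (\<exists>C :: 'a set \<Rightarrow> 'a set set.
        (\<forall>\<delta>\<in>Field (cardSuc \<kappa>). club (seg (cardSuc \<kappa>) \<delta>) (C \<delta>) \<and> (Restr (cardSuc \<kappa>) (C \<delta>)) \<le>o \<kappa>) \<and>
        (\<forall>X S. unbounded_in (cardSuc \<kappa>) X \<and> S \<in> \<S> \<longrightarrow>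
           stationary (cardSuc \<kappa>)
             {\<delta>\<in>S. unbounded_in (seg (cardSuc \<kappa>) \<delta>) ((C \<delta> \<inter> X) - lim_points (cardSuc \<kappa>) (C \<delta>))}))"

text \<open>\<open>\<kappa>\<^sup><\<^sup>\<kappa>\<close>: the cardinality of the disjoint union over \<open>\<alpha> < \<kappa>\<close> of the sets of functions
  from \<open>\<alpha>\<close> to \<open>\<kappa>\<close>.\<close>

definition weak_power :: "'a rel \<Rightarrow> ('a \<times> ('a \<Rightarrow> 'a)) rel" where
  "weak_power \<kappa> = |SIGMA \<alpha>:Field \<kappa>. underS \<kappa> \<alpha> \<rightarrow>\<^sub>E Field \<kappa>|"


subsection \<open>Trees\<close>

definition tree :: "'t rel \<Rightarrow> bool" where
  "tree T \<longleftrightarrow> Partial_order T \<and> (\<forall>x\<in>Field T. Well_order (seg T x))"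

text \<open>Height as an element of the ambient ordinal \<open>l\<close>; meaningful if \<open>seg T x <o l\<close>.\<close>

definition ht :: "'l rel \<Rightarrow> 't rel \<Rightarrow> 't \<Rightarrow> 'l" where
  "ht l T x = (THE a. a \<in> Field l \<and> seg T x =o seg l a)"

definition tree_restr :: "'l rel \<Rightarrow> 't rel \<Rightarrow> 'l set \<Rightarrow> 't rel" where
  "tree_restr l T A = Restr T {x \<in> Field T. ht l T x \<in> A}"

definition level :: "'l rel \<Rightarrow> 't rel \<Rightarrow> 'l \<Rightarrow> 't set" where
  "level l T a = {x \<in> Field T. ht l T x = a}"

definition card_tree :: "'l rel \<Rightarrow> 't rel \<Rightarrow> bool" where
  "card_tree l T \<longleftrightarrow> tree T \<and> (\<forall>x\<in>Field T. seg T x <o l) \<and>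
     (\<forall>a\<in>Field l. level l T a \<noteq> {} \<and> |level l T a| <o l)"

definition branch :: "'t rel \<Rightarrow> 't set \<Rightarrow> bool" where
  "branch T b \<longleftrightarrow> b \<in> Chains T \<and> (\<forall>c\<in>Chains T. b \<subseteq> c \<longrightarrow> c = b)"

definition aronszajn :: "'l rel \<Rightarrow> 't rel \<Rightarrow> bool" where
  "aronszajn l T \<longleftrightarrow> card_tree l T \<and> \<not> (\<exists>b. branch T b \<and> (\<forall>a\<in>Field l. b \<inter> level l T a \<noteq> {}))"

definition complete_tree :: "'k rel \<Rightarrow> 't rel \<Rightarrow> bool" where
  "complete_tree \<kappa> T \<longleftrightarrow>
     (\<forall>c\<in>Chains T. (Restr T c) <o \<kappa> \<longrightarrow> (\<exists>u\<in>Field T. \<forall>x\<in>c. (x, u) \<in> T))"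

definition normal_tree :: "'l rel \<Rightarrow> 't rel \<Rightarrow> bool" where
  "normal_tree l T \<longleftrightarrow>
     (\<forall>x\<in>Field T. \<forall>c\<in>Field l. ht l T x \<in> underS l c \<longrightarrow> (\<exists>y\<in>level l T c. x \<in> underS T y)) \<and>
     (\<forall>x\<in>Field T. \<forall>y\<in>Field T. x \<noteq> y \<and> ht l T x = ht l T y \<and> limit_ordinal l (ht l T x) \<longrightarrow>
        underS T x \<noteq> underS T y) \<and>
     (\<forall>x\<in>Field T. \<exists>y z. x \<in> underS T y \<and> x \<in> underS T z \<and> (y, z) \<notin> T \<and> (z, y) \<notin> T)"

definition embeddable_tree :: "'t rel \<Rightarrow> 'b rel \<Rightarrow> bool" where
  "embeddable_tree T L \<longleftrightarrow>
     (\<exists>f. f ` Field T \<subseteq> Field L \<and> (\<forall>x y. x \<in> underS T y \<longrightarrow> f x \<in> underS L (f y)))"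

definition order_isomorphic :: "'t rel \<Rightarrow> 'u rel \<Rightarrow> bool" where
  "order_isomorphic T U \<longleftrightarrow>
     (\<exists>f. bij_betw f (Field T) (Field U) \<and>
          (\<forall>x\<in>Field T. \<forall>y\<in>Field T. (x, y) \<in> T \<longleftrightarrow> (f x, f y) \<in> U))"

definition club_isomorphic :: "'l rel \<Rightarrow> 't rel \<Rightarrow> 'u rel \<Rightarrow> bool" where
  "club_isomorphic l T U \<longleftrightarrow>
     (\<exists>C. club l C \<and> order_isomorphic (tree_restr l T C) (tree_restr l U C))"

definition downward_closed :: "'t rel \<Rightarrow> 't set \<Rightarrow> bool" where
  "downward_closed T X \<longleftrightarrow> X \<subseteq> Field T \<and> (\<forall>x\<in>X. underS T x \<subseteq> X)"

text \<open>Club isomorphism is a relation between \<open>l\<close>-trees, so the two subtrees must themselves be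
  \<open>l\<close>-trees (otherwise the empty subtree would make any two trees near).\<close>

definition near :: "'l rel \<Rightarrow> 't rel \<Rightarrow> 'u rel \<Rightarrow> bool" where
  "near l T U \<longleftrightarrow>
     (\<exists>X Y. downward_closed T X \<and> downward_closed U Y \<and>
            card_tree l (Restr T X) \<and> card_tree l (Restr U Y) \<and>
            club_isomorphic l (Restr T X) (Restr U Y))"

abbreviation far :: "'l rel \<Rightarrow> 't rel \<Rightarrow> 'u rel \<Rightarrow> bool" where
  "far l T U \<equiv> \<not> near l T U"


subsection \<open>The linear orders \<open>\<rat>\<^sub>\<kappa>\<close> and \<open>\<real>\<^sub>\<kappa>\<close>\<close>

definition Q_set :: "'k rel \<Rightarrow> ('k \<Rightarrow> nat) set" where
  "Q_set \<kappa> = {f \<in> Field \<kappa> \<rightarrow>\<^sub>E {0, 1}.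
     {\<alpha> \<in> Field \<kappa>. f \<alpha> = 1} \<noteq> {} \<and> |{\<alpha> \<in> Field \<kappa>. f \<alpha> = 1}| <o \<kappa>}"

definition Q_order :: "'k rel \<Rightarrow> ('k \<Rightarrow> nat) rel" where
  "Q_order \<kappa> = {(f, g). f \<in> Q_set \<kappa> \<and> g \<in> Q_set \<kappa> \<and>
     (f = g \<or> (\<exists>\<alpha>\<in>Field \<kappa>. f \<alpha> < g \<alpha> \<and> (\<forall>\<beta>\<in>underS \<kappa> \<alpha>. f \<beta> = g \<beta>)))}"

text \<open>Dedekind completion of a dense linear order without endpoints: as in the construction of the
  reals, cuts are given by their lower part, which is chosen without a greatest element, and
  no endpoints are added.\<close>

definition dedekind_cuts :: "'b rel \<Rightarrow> 'b set set" where
  "dedekind_cuts L = {A. A \<subseteq> Field L \<and> A \<noteq> {} \<and> A \<noteq> Field L \<and>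
     (\<forall>a\<in>A. underS L a \<subseteq> A) \<and> (\<forall>a\<in>A. \<exists>b\<in>A. a \<in> underS L b)}"

definition dedekind_completion :: "'b rel \<Rightarrow> 'b set rel" where
  "dedekind_completion L = {(A, B). A \<in> dedekind_cuts L \<and> B \<in> dedekind_cuts L \<and> A \<subseteq> B}"

definition R_order :: "'k rel \<Rightarrow> ('k \<Rightarrow> nat) set rel" where
  "R_order \<kappa> = dedekind_completion (Q_order \<kappa>)"

end

theory Submission
  imports Defs
begin

text \<open>
  Nodes are sequences \<open>s\<close> of elements of \<open>\<rat>\<^sub>\<kappa>\<close> such that each \<open>s x\<close> lies strictly above some rational
  bound of the earlier values; the supremum of the values embeds the tree into \<open>\<real>\<^sub>\<kappa>\<close>.  A level of
  cofinality other than \<open>\<kappa>\<close> takes all bounded branches.  At a level \<open>\<delta>\<close> of cofinality \<open>\<kappa>\<close> only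
  branches built step by step along \<open>C\<^sub>\<delta>\<close> are admitted, and there are two ways of making the step from
  \<open>c \<in> C\<^sub>\<delta>\<close> to its successor \<open>b \<in> C\<^sub>\<delta>\<close>: either take the canonical extension, or use a guess at \<open>b\<close> of
  an isomorphism into another tree and take an extension whose image is \<^emph>\<open>not\<close> canonical.

  Since \<open>\<kappa>\<^sup><\<^sup>\<kappa> = \<kappa>\<close> and \<open>2\<^sup>\<kappa> = \<kappa>\<^sup>+\<close>, at points of cofinality \<open>\<omega>\<close> every object of size \<open>\<kappa>\<^sup>+\<close> is
  guessed on a club by one of \<open>\<kappa>\<close> many candidates, and one index \<open>i < \<kappa>\<close> is right unboundedly often.
  The principle \<open>\<boxtimes>\<^sup>*\<close> then yields \<open>\<delta>\<close> in any prescribed stationary set such that the \<open>i\<close>-th guess is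
  right at cofinally many successor points of \<open>C\<^sub>\<delta>\<close>.  If one tree makes canonical steps at \<open>\<delta>\<close> and the other
  diverts the \<open>i\<close>-th guess, an isomorphism would send a branch of the second to a branch of the first
  which is both eventually canonical and not canonical at such a point.  Coding subsets of \<open>\<kappa>\<^sup>+\<close> by the
  choices made on disjoint stationary sets gives \<open>2\<^bsup>\<kappa>\<^sup>+\<^esup>\<close> many pairwise far trees.
\<close>

section \<open>Linear and well-orders as relations\<close>

text \<open>The shape of the levels is dictated by their size. Away from cofinality \<kappa>, a node
  is fixed by fewer than \<kappa> of its restrictions and values, so keeping all bounded branches
  costs only \<kappa> nodes and yields \<kappa>-completeness. At cofinality \<kappa> this count
  fails and branches must be selected; that selection carries all the freedom. A selected branch
  must stay bounded through \<kappa> steps, so each step receives its own interval of rationals in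
  advance. Guesses are produced at points of cofinality omega, branches are selected at cofinality
  \<kappa>, and the clubs connect the two. The next level of the other tree must also be readable
  from a guess that contains only its lower part; this is possible exactly where all bounded
  branches are kept. Diverting succeeds because a canonical extension is a function of the node it
  extends. Two extensions that agree up to a club level above \<open>c\<close> have images with the
  same restriction to \<open>under \<Omega> c\<close>; were both images canonical they would
  coincide. The principle accepts one unbounded set at a time, and the correct index depends on the
  isomorphism. Every index therefore gets stationary sets of its own.\<close>

locale lin =
  fixes r :: "'a rel"
  assumes lin: "Linear_order r"
begin

abbreviation le where "le x y \<equiv> (x, y) \<in> r"
abbreviation lt where "lt x y \<equiv> x \<in> underS r y"

lemma lt_iff: "lt x y \<longleftrightarrow> le x y \<and> x \<noteq> y"
  by (auto simp: underS_def)

lemma le_fieldL: "le x y \<Longrightarrow> x \<in> Field r" and le_fieldR: "le x y \<Longrightarrow> y \<in> Field r"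
  by (auto simp: Field_def)

lemma lt_fieldL: "lt x y \<Longrightarrow> x \<in> Field r" and lt_fieldR: "lt x y \<Longrightarrow> y \<in> Field r"
  by (auto simp: lt_iff le_fieldL le_fieldR)

lemma le_refl: "x \<in> Field r \<Longrightarrow> le x x"
  using lin by (auto simp: order_on_defs refl_on_def)

lemma le_trans: "le x y \<Longrightarrow> le y z \<Longrightarrow> le x z"
  using lin unfolding order_on_defs by (meson transD)

lemma le_antisym: "le x y \<Longrightarrow> le y x \<Longrightarrow> x = y"
  using lin unfolding order_on_defs by (meson antisymD)

lemma lt_imp_le: "lt x y \<Longrightarrow> le x y"
  by (simp add: lt_iff)

lemma lt_irrefl: "\<not> lt x x"
  by (simp add: lt_iff)

lemma lt_le_trans: "lt x y \<Longrightarrow> le y z \<Longrightarrow> lt x z"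
  unfolding lt_iff by (metis le_antisym le_trans)

lemma le_lt_trans: "le x y \<Longrightarrow> lt y z \<Longrightarrow> lt x z"
  unfolding lt_iff by (metis le_antisym le_trans)

lemma lt_trans: "lt x y \<Longrightarrow> lt y z \<Longrightarrow> lt x z"
  by (metis lt_le_trans lt_imp_le)

lemma lt_asym: "lt x y \<Longrightarrow> \<not> lt y x"
  using lt_trans lt_irrefl by blast

lemma lt_not_le: "lt x y \<Longrightarrow> \<not> le y x"
  using lt_le_trans lt_irrefl by blast

lemma linear: "x \<in> Field r \<Longrightarrow> y \<in> Field r \<Longrightarrow> le x y \<or> lt y x"
  using lin le_refl unfolding order_on_defs total_on_def lt_iff by metis

lemma not_lt: "x \<in> Field r \<Longrightarrow> y \<in> Field r \<Longrightarrow> \<not> lt x y \<longleftrightarrow> le y x"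
  using linear lt_not_le by blast

lemma le_iff: "le x y \<longleftrightarrow> lt x y \<or> (x = y \<and> x \<in> Field r)"
  using le_refl le_fieldL unfolding lt_iff by blast

lemma le_maxE:
  assumes "x \<in> Field r" "y \<in> Field r"
  obtains z where "z = x \<or> z = y" "le x z" "le y z"
  using assms linear le_refl lt_imp_le by metis

lemma underS_mono: "le x y \<Longrightarrow> underS r x \<subseteq> underS r y"
  using lt_le_trans by blast

lemma underS_inj: "x \<in> Field r \<Longrightarrow> y \<in> Field r \<Longrightarrow> underS r x = underS r y \<Longrightarrow> x = y"
  by (metis linear le_iff lt_irrefl)

end

locale wo =
  fixes r :: "'a rel"
  assumes wo: "Well_order r"

sublocale wo \<subseteq> lin r
  using wo by unfold_locales (simp add: well_order_on_def)

context wo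
begin

lemma wf_lt: "wf (r - Id)"
  using wo by (simp add: well_order_on_def)

lemma lt_induct [consumes 0, case_names less]:
  assumes "\<And>x. (\<And>y. lt y x \<Longrightarrow> P y) \<Longrightarrow> P x"
  shows "P x"
  using wf_lt by (induction x rule: wf_induct_rule) (rule assms, auto simp: lt_iff)

lemma ex_least:
  assumes "A \<subseteq> Field r" "A \<noteq> {}"
  obtains m where "m \<in> A" "\<And>a. a \<in> A \<Longrightarrow> le m a"
proof -
  from assms(2) obtain m where m: "m \<in> A" "\<And>y. (y, m) \<in> r - Id \<Longrightarrow> y \<notin> A"
    using wf_lt by (metis ex_in_conv wfE_min)
  have "le m a" if "a \<in> A" for a
    using m that assms(1) linear[of m a] by (auto simp: lt_iff)
  with m that show ?thesis by blast
qed

lemma Field_seg: "Field (seg r a) = underS r a"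
proof -
  have "b \<in> Field (seg r a)" if "lt b a" for b
    using that le_refl[OF lt_fieldL[OF that]] by (auto simp: seg_def Field_def)
  then show ?thesis by (auto simp: seg_def Field_def)
qed

lemma seg_iff: "(b, c) \<in> seg r a \<longleftrightarrow> le b c \<and> lt c a"
  by (auto simp: seg_def intro: le_lt_trans)

lemma Well_order_seg: "Well_order (seg r a)"
  unfolding seg_def using wo by (rule Well_order_Restr)

lemma unbounded_in_seg:
  "unbounded_in (seg r a) X \<longleftrightarrow> X \<subseteq> underS r a \<and> (\<forall>b. lt b a \<longrightarrow> (\<exists>c\<in>X. le b c))"
  unfolding unbounded_in_def Field_seg seg_iff by blast

lemma lim_points_iff:
  "a \<in> lim_points r X \<longleftrightarrow> underS r a \<noteq> {} \<and> (\<forall>b. lt b a \<longrightarrow> (\<exists>c\<in>X. lt b c \<and> lt c a))"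
proof -
  have "cofinal (X \<inter> underS r a) (seg r a) \<longleftrightarrow> (\<forall>b. lt b a \<longrightarrow> (\<exists>c\<in>X. lt b c \<and> lt c a))"
    unfolding cofinal_def Field_seg seg_iff lt_iff[of _ "_::'a"] by (metis IntD1 IntD2 IntI lt_iff)
  then show ?thesis
    unfolding lim_points_def using lt_fieldR by blast
qed

lemma underS_seg: "lt a d \<Longrightarrow> underS (seg r d) a = underS r a"
  by (auto simp: underS_def seg_iff)

lemma lim_points_seg: "lim_points (seg r d) X = lim_points r X \<inter> underS r d"
proof -
  interpret s: wo "seg r d" by unfold_locales (rule Well_order_seg)
  have "a \<in> lim_points (seg r d) X \<longleftrightarrow> a \<in> lim_points r X" if a: "lt a d" for a
  proof -
    have "s.lt c a \<longleftrightarrow> lt c a" for c using underS_seg[OF a] by simp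
    moreover have "s.lt b c \<longleftrightarrow> lt b c" if "lt c a" for b c
      using underS_seg[OF lt_trans[OF that a]] by simp
    ultimately have "(\<exists>c\<in>X. s.lt b c \<and> s.lt c a) \<longleftrightarrow> (\<exists>c\<in>X. lt b c \<and> lt c a)" for b by blast
    then show ?thesis unfolding s.lim_points_iff lim_points_iff using underS_seg[OF a] by simp
  qed
  moreover have "a \<in> lim_points (seg r d) X \<Longrightarrow> lt a d" for a
    by (simp add: lim_points_def Field_seg)
  ultimately show ?thesis by blast
qed

definition lim :: "'a \<Rightarrow> bool" where
  "lim a \<longleftrightarrow> a \<in> Field r \<and> underS r a \<noteq> {} \<and> (\<forall>b. lt b a \<longrightarrow> (\<exists>c. lt b c \<and> lt c a))"

lemma club_seg_iff:
  "club (seg r d) C \<longleftrightarrow> C \<subseteq> underS r d \<and> (\<forall>b. lt b d \<longrightarrow> (\<exists>c\<in>C. le b c)) \<and>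
     (\<forall>a. lt a d \<longrightarrow> underS r a \<noteq> {} \<longrightarrow> (\<forall>b. lt b a \<longrightarrow> (\<exists>c\<in>C. lt b c \<and> lt c a)) \<longrightarrow> a \<in> C)"
  unfolding club_def unbounded_in_seg lim_points_seg lim_points_iff subset_iff Int_iff by blast

lemma club_seg_strict:
  assumes "club (seg r d) C" "lim d" "lt b d"
  shows "\<exists>c\<in>C. lt b c \<and> lt c d"
proof -
  obtain b' where "lt b b'" "lt b' d" using assms unfolding lim_def by blast
  then show ?thesis using assms(1) unfolding club_seg_iff by (metis lt_le_trans subsetD)
qed

text \<open>The least upper bound \<open>m\<close> of the elements of \<open>C\<close> up to
  \<open>e\<close> belongs to \<open>C\<close>: otherwise all these elements lie strictly below
  \<open>m\<close>, which makes \<open>m\<close> a limit point of \<open>C\<close> below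
  \<open>d\<close>. The element \<open>g\<close> ensures that something lies below
  \<open>m\<close>.\<close>

lemma club_greatest_le:
  assumes C: "club (seg r d) C" and g: "g \<in> C" "le g e" and e: "lt e d"
  obtains c where "c \<in> C" "le c e" "\<And>c'. c' \<in> C \<Longrightarrow> le c' e \<Longrightarrow> le c' c"
proof -
  let ?B = "{m \<in> Field r. \<forall>c'\<in>C. le c' e \<longrightarrow> le c' m}"
  have "e \<in> ?B" using e lt_fieldL by auto
  then obtain m where m: "m \<in> ?B" and least: "\<And>a. a \<in> ?B \<Longrightarrow> le m a"
    using ex_least[of ?B] by blast
  have me: "le m e" using least \<open>e \<in> ?B\<close> by blast
  have "m \<in> C"
  proof (rule ccontr)
    assume nm: "m \<notin> C"
    have ub: "lt c' m" if "c' \<in> C" "le c' e" for c'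
      using m that nm by (auto simp: lt_iff)
    have "\<exists>c\<in>C. lt b c \<and> lt c m" if b: "lt b m" for b
    proof (rule ccontr)
      assume no: "\<not> ?thesis"
      have "le c' b" if "c' \<in> C" "le c' e" for c'
        using no ub[OF that] linear[of c' b] that le_fieldL[OF that(2)] lt_fieldL[OF b] by blast
      then have "b \<in> ?B" using lt_fieldL[OF b] by blast
      then show False using least lt_not_le b by blast
    qed
    moreover have "lt g m" using ub g by blast
    ultimately show False using nm C me e le_lt_trans unfolding club_seg_iff by blast
  qed
  with m me that show ?thesis by blast
qed

lemma wfrec_lt_cut:
  fixes F :: "('a \<Rightarrow> 'b) \<Rightarrow> 'a \<Rightarrow> 'b"
  shows "wfrec (r - Id) F a = F (cut (wfrec (r - Id) F) (r - Id) a) a"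
  using wf_lt by (rule wfrec)

lemma cut_lt: "lt b a \<Longrightarrow> cut f (r - Id) a b = f b"
  by (auto simp: cut_def lt_iff)

end

section \<open>Cardinal arithmetic for \<open>\<kappa>\<close> and its successor\<close>

lemma regular_bound:
  assumes "Card_order r" "regularCard r" "\<not> finite (Field r)" "A \<subseteq> Field r" "|A| <o r"
  shows "\<exists>d\<in>Field r. \<forall>a\<in>A. a \<in> underS r d"
proof (rule ccontr)
  assume no: "\<not> ?thesis"
  interpret wo r using assms(1) by unfold_locales (simp add: card_order_on_def)
  have "\<exists>a\<in>A. d \<noteq> a \<and> (d, a) \<in> r" if d: "d \<in> Field r" for d
  proof -
    obtain e where e: "lt d e"
      using infinite_Card_order_limit[OF assms(1,3) d] by (auto simp: lt_iff)
    then obtain a where "a \<in> A" "\<not> lt a e"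
      using no lt_fieldR by blast
    then have "lt d a" using e not_lt[of a e] assms(4) lt_fieldR[OF e] lt_le_trans by blast
    with \<open>a \<in> A\<close> show ?thesis by (auto simp: lt_iff)
  qed
  then have "|A| =o r"
    using assms(2,4) unfolding regularCard_def cofinal_def by blast
  then show False using assms(5) not_ordLess_ordIso by blast
qed

locale kappa =
  fixes \<kappa> :: "'a rel"
  assumes card: "Card_order \<kappa>" and reg: "regularCard \<kappa>" and unc: "natLeq <o \<kappa>"
begin

abbreviation \<Omega> where "\<Omega> \<equiv> cardSuc \<kappa>"
abbreviation On where "On \<equiv> Field (cardSuc \<kappa>)"
abbreviation U where "U \<equiv> underS (cardSuc \<kappa>)"

lemma cinf: "Cinfinite \<kappa>"
proof
  show "cinfinite \<kappa>"
    using cinfinite_mono[OF ordLess_imp_ordLeq[OF unc] natLeq_cinfinite] .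
qed (rule card)

lemma inf: "\<not> finite (Field \<kappa>)"
  using cinf by (simp add: cinfinite_def)

lemma cinf_\<Omega>: "Cinfinite \<Omega>"
  using cinf by (rule Cinfinite_cardSuc)

lemma inf_\<Omega>: "\<not> finite On"
  using cinf_\<Omega> by (simp add: cinfinite_def)

lemma card_\<Omega>: "Card_order \<Omega>"
  using cinf_\<Omega> by simp

lemma reg_\<Omega>: "regularCard \<Omega>"
  using cinf by (rule regularCard_cardSuc)

lemma lt_\<Omega>_iff: "|A| <o \<Omega> \<longleftrightarrow> |A| \<le>o \<kappa>"
  using card by (rule cardSuc_ordLeq_ordLess) (rule card_of_Card_order)

end

sublocale kappa \<subseteq> k: wo \<kappa>
  using card by unfold_locales (simp add: card_order_on_def)

sublocale kappa \<subseteq> o: wo "cardSuc \<kappa>"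
  using card_\<Omega> by unfold_locales (simp add: card_order_on_def)

context kappa
begin

abbreviation olt (infix "\<prec>" 50) where "x \<prec> y \<equiv> x \<in> underS (cardSuc \<kappa>) y"
abbreviation ole (infix "\<preceq>" 50) where "x \<preceq> y \<equiv> (x, y) \<in> cardSuc \<kappa>"

lemma \<kappa>_lt_\<Omega>: "\<kappa> <o \<Omega>"
  using card by (rule cardSuc_greater)

lemma card_U: "|U d| \<le>o \<kappa>"
proof (cases "d \<in> On")
  case True
  then show ?thesis using card_of_underS[OF card_\<Omega> True] by (simp add: lt_\<Omega>_iff)
next
  case False
  then have "U d = {}" using o.lt_fieldR by blast
  then show ?thesis using card by (simp add: card_of_empty1 card_order_on_well_order_on)
qed

lemma card_underS_\<kappa>: "a \<in> Field \<kappa> \<Longrightarrow> |underS \<kappa> a| <o \<kappa>"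
  using card by (rule card_of_underS)

lemma finite_lt: "finite A \<Longrightarrow> |A| <o \<kappa>"
  by (rule Cfinite_ordLess_Cinfinite[OF _ cinf])
    (use card_of_Card_order in \<open>auto simp: cfinite_def Field_card_of\<close>)

lemma Un_lt: "|A| <o \<kappa> \<Longrightarrow> |B| <o \<kappa> \<Longrightarrow> |A \<union> B| <o \<kappa>"
  using Un_Cinfinite_bound_strict[OF _ _ cinf] .

lemma UN_le: "|I| \<le>o \<kappa> \<Longrightarrow> (\<And>i. i \<in> I \<Longrightarrow> |A i| \<le>o \<kappa>) \<Longrightarrow> |\<Union>i\<in>I. A i| \<le>o \<kappa>"
  by (rule UNION_Cinfinite_bound[OF _ _ cinf]) simp_all

lemma UN_lt: "|I| <o \<kappa> \<Longrightarrow> (\<And>i. i \<in> I \<Longrightarrow> |A i| <o \<kappa>) \<Longrightarrow> |\<Union>i\<in>I. A i| <o \<kappa>"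
  by (rule card_of_UNION_ordLess_infinite_Field_regularCard[OF reg cinf]) simp_all

lemma Times_le: "|A| \<le>o \<kappa> \<Longrightarrow> |B| \<le>o \<kappa> \<Longrightarrow> |A \<times> B| \<le>o \<kappa>"
  by (rule card_of_Times_ordLeq_infinite_Field[OF inf _ _ card])

lemma Times_le_\<Omega>: "|A| \<le>o \<Omega> \<Longrightarrow> |B| \<le>o \<Omega> \<Longrightarrow> |A \<times> B| \<le>o \<Omega>"
  by (rule card_of_Times_ordLeq_infinite_Field[OF inf_\<Omega> _ _ card_\<Omega>])

lemma subset_le: "A \<subseteq> B \<Longrightarrow> |B| \<le>o p \<Longrightarrow> |A| \<le>o p"
  by (rule ordLeq_transitive[OF card_of_mono1])

lemma subset_lt: "A \<subseteq> B \<Longrightarrow> |B| <o p \<Longrightarrow> |A| <o p"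
  by (rule ordLeq_ordLess_trans[OF card_of_mono1])

lemma image_le: "|B| \<le>o p \<Longrightarrow> |f ` B| \<le>o p"
  by (rule ordLeq_transitive[OF card_of_image])

lemma image_lt: "|B| <o p \<Longrightarrow> |f ` B| <o p"
  by (rule ordLeq_ordLess_trans[OF card_of_image])

lemma inj_le: "inj_on f A \<Longrightarrow> f ` A \<subseteq> B \<Longrightarrow> |B| \<le>o p \<Longrightarrow> |A| \<le>o p"
  by (metis card_of_ordLeq ordLeq_transitive)

lemma finite_le: "finite A \<Longrightarrow> |A| \<le>o \<kappa>"
  by (rule ordLess_imp_ordLeq[OF finite_lt])

lemma card_Field: "|Field \<kappa>| \<le>o \<kappa>"
  by (rule ordIso_imp_ordLeq[OF card_of_Field_ordIso[OF card]])

lemma card_On: "|On| \<le>o \<Omega>"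
  by (rule ordIso_imp_ordLeq[OF card_of_Field_ordIso[OF card_\<Omega>]])

lemma le_imp_le_\<Omega>: "p \<le>o \<kappa> \<Longrightarrow> p \<le>o \<Omega>"
  by (rule ordLeq_transitive[OF _ ordLess_imp_ordLeq[OF \<kappa>_lt_\<Omega>]])

lemma not_le_\<kappa>: "\<Omega> \<le>o p \<Longrightarrow> \<not> p \<le>o \<kappa>"
  by (metis \<kappa>_lt_\<Omega> ordLeq_transitive not_ordLess_ordLeq)

lemma not_lt_iff: "\<not> |A| <o \<kappa> \<longleftrightarrow> \<kappa> \<le>o |A|"
  by (rule not_ordLess_iff_ordLeq[OF k.wo card_of_Well_order])

lemma not_le_iff: "\<not> |A| \<le>o \<kappa> \<longleftrightarrow> \<Omega> \<le>o |A|"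
  unfolding lt_\<Omega>_iff[symmetric]
  by (rule not_ordLess_iff_ordLeq[OF o.wo card_of_Well_order])

lemma surj_from:
  assumes "|A| \<le>o p" "Card_order p" "A \<noteq> {}"
  obtains f where "f ` Field p = A"
proof -
  have "|A| \<le>o |Field p|"
    by (rule ordLeq_ordIso_trans[OF assms(1) ordIso_symmetric[OF card_of_Field_ordIso[OF assms(2)]]])
  then show ?thesis using card_of_ordLeq2[OF assms(3), of "Field p"] that by metis
qed

lemma inj_into:
  assumes "|A| \<le>o p" "Card_order p"
  obtains f where "inj_on f A" "f ` A \<subseteq> Field p"
proof -
  have "|A| \<le>o |Field p|"
    by (rule ordLeq_ordIso_trans[OF assms(1) ordIso_symmetric[OF card_of_Field_ordIso[OF assms(2)]]])
  then show ?thesis using card_of_ordLeq[of A "Field p"] that by metis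
qed

lemma \<kappa>_bound: "A \<subseteq> Field \<kappa> \<Longrightarrow> |A| <o \<kappa> \<Longrightarrow> \<exists>d\<in>Field \<kappa>. \<forall>a\<in>A. a \<in> underS \<kappa> d"
  using regular_bound[OF card reg inf] .

lemma On_bound: "A \<subseteq> On \<Longrightarrow> |A| \<le>o \<kappa> \<Longrightarrow> \<exists>d\<in>On. \<forall>a\<in>A. a \<prec> d"
  by (rule regular_bound[OF card_\<Omega> reg_\<Omega> inf_\<Omega>]) (simp_all add: lt_\<Omega>_iff)

lemma On_bound_image:
  assumes "|I| \<le>o \<kappa>" "\<And>i. i \<in> I \<Longrightarrow> f i \<in> On"
  obtains d where "d \<in> On" "\<And>i. i \<in> I \<Longrightarrow> f i \<prec> d"
  using On_bound[OF image_subsetI image_le[OF assms(1)], of f] assms(2) by blast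

lemma \<kappa>_limit: "a \<in> Field \<kappa> \<Longrightarrow> \<exists>b\<in>Field \<kappa>. a \<in> underS \<kappa> b"
  using infinite_Card_order_limit[OF card inf, of a] unfolding k.lt_iff by blast

lemma On_limit: "a \<in> On \<Longrightarrow> \<exists>b\<in>On. a \<prec> b"
  using infinite_Card_order_limit[OF card_\<Omega> inf_\<Omega>, of a] unfolding o.lt_iff by blast

lemma under_iff: "under \<Omega> d = insert d (U d)" if "d \<in> On"
  using that o.le_iff by (auto simp: under_def)

lemma ex_suc:
  assumes "d \<in> On"
  obtains s where "s \<in> On" "U s = under \<Omega> d"
proof -
  let ?A = "{b \<in> On. d \<prec> b}"
  obtain s where s: "s \<in> ?A" "\<And>a. a \<in> ?A \<Longrightarrow> s \<preceq> a"
    using o.ex_least[of ?A] On_limit[OF assms] by auto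
  have "x \<prec> s \<longleftrightarrow> x \<preceq> d" for x
  proof
    assume x: "x \<prec> s"
    show "x \<preceq> d"
      using s(2)[of x] o.lt_not_le[OF x] o.linear[of x d] assms o.lt_fieldL[OF x] by blast
  qed (use s(1) o.le_lt_trans in blast)
  with s(1) that show ?thesis by (auto simp: under_def)
qed

end

locale kappa_exp = kappa +
  assumes wp: "weak_power \<kappa> =o \<kappa>" and pow: "ctwo ^c \<kappa> =o cardSuc \<kappa>"
begin

text \<open>\<open>weak_power\<close> counts functions on initial segments of \<kappa>. By
  regularity a copy of \<open>A\<close> inside \<open>Field \<kappa>\<close> lies below some
  \<open>a\<close>, so a function on \<open>A\<close> is transported to that segment; the value
  \<open>a\<close> fills the places outside the copy.\<close>

lemma card_PiE_lt:
  assumes A: "|A| <o \<kappa>" and K: "|K| \<le>o \<kappa>"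
  shows "|A \<rightarrow>\<^sub>E K| \<le>o \<kappa>"
proof -
  obtain f where f: "inj_on f A" "f ` A \<subseteq> Field \<kappa>"
    using inj_into[OF ordLess_imp_ordLeq[OF A] card] .
  obtain g where g: "inj_on g K" "g ` K \<subseteq> Field \<kappa>" using inj_into[OF K card] .
  obtain a where a: "a \<in> Field \<kappa>" "f ` A \<subseteq> underS \<kappa> a"
    using \<kappa>_bound[OF f(2) image_lt[OF A]] by blast
  define h where "h \<phi> = (a, \<lambda>x. if x \<in> underS \<kappa> a then (if x \<in> f ` A then g (\<phi> (inv_into A f x)) else a)
      else undefined)" for \<phi>
  have "inj_on h (A \<rightarrow>\<^sub>E K)"
  proof (rule inj_onI)
    fix \<phi> \<psi> assume \<phi>: "\<phi> \<in> A \<rightarrow>\<^sub>E K" and \<psi>: "\<psi> \<in> A \<rightarrow>\<^sub>E K" and eq: "h \<phi> = h \<psi>"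
    have "\<phi> x = \<psi> x" if x: "x \<in> A" for x
    proof -
      have "snd (h \<phi>) (f x) = snd (h \<psi>) (f x)" using eq by simp
      then have "g (\<phi> x) = g (\<psi> x)"
        using x a f(1) by (auto simp: h_def)
      then show ?thesis using g(1) \<phi> \<psi> x by (metis PiE_mem inj_onD)
    qed
    then show "\<phi> = \<psi>" using \<phi> \<psi> by (auto intro: PiE_ext)
  qed
  moreover have "h ` (A \<rightarrow>\<^sub>E K) \<subseteq> (SIGMA \<alpha>:Field \<kappa>. underS \<kappa> \<alpha> \<rightarrow>\<^sub>E Field \<kappa>)"
    using a g(2) f(1) by (auto simp: h_def PiE_iff extensional_def image_subset_iff)
  ultimately have "|A \<rightarrow>\<^sub>E K| \<le>o weak_power \<kappa>"
    unfolding weak_power_def by (rule inj_le) (rule card_of_mono1, simp)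
  then show ?thesis using wp by (rule ordLeq_ordIso_trans)
qed

lemma Omega_cexp: "\<Omega> ^c \<kappa> \<le>o \<Omega>"
proof -
  have "\<Omega> ^c \<kappa> =o (ctwo ^c \<kappa>) ^c \<kappa>"
    using cexp_cong1[OF pow card] by (rule ordIso_symmetric)
  also have "(ctwo ^c \<kappa>) ^c \<kappa> =o ctwo ^c (\<kappa> *c \<kappa>)"
    by (rule cexp_cprod) (rule Card_order_ctwo)
  also have "ctwo ^c (\<kappa> *c \<kappa>) =o ctwo ^c \<kappa>"
    by (rule cexp_cong2[OF cprod_infinite[OF cinf] Card_order_ctwo Card_order_cprod])
  also note pow
  finally show ?thesis by (rule ordIso_imp_ordLeq)
qed

text \<open>A nonempty set of at most \<kappa> elements is the range of a function on
  \<open>Field \<kappa>\<close>, and \<open>Omega_cexp\<close> bounds the number of these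
  functions.\<close>

lemma card_small_subsets:
  assumes A: "|A| \<le>o \<Omega>"
  shows "|{z. z \<subseteq> A \<and> |z| \<le>o \<kappa>}| \<le>o \<Omega>"
proof -
  let ?F = "Func (Field \<kappa>) A"
  have "|?F| \<le>o |A| ^c \<kappa>"
    unfolding cexp_def Field_card_of by (simp add: card_of_mono1)
  also have "|A| ^c \<kappa> \<le>o \<Omega> ^c \<kappa>" by (rule cexp_mono1[OF A card])
  also note Omega_cexp
  finally have F: "|(\<lambda>f. f ` Field \<kappa>) ` ?F| \<le>o \<Omega>" by (rule image_le)
  have "z \<in> insert {} ((\<lambda>f. f ` Field \<kappa>) ` ?F)" if z: "z \<subseteq> A" "|z| \<le>o \<kappa>" for z
  proof (cases "z = {}")
    case False
    obtain f where f: "f ` Field \<kappa> = z" using surj_from[OF z(2) card False] .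
    let ?g = "\<lambda>x. if x \<in> Field \<kappa> then f x else undefined"
    have "?g ` Field \<kappa> = z" using f by auto
    moreover have "?g \<in> ?F" using f z by (auto simp: Func_def)
    ultimately show ?thesis by blast
  qed simp
  then have "{z. z \<subseteq> A \<and> |z| \<le>o \<kappa>} \<subseteq> {{}} \<union> ((\<lambda>f. f ` Field \<kappa>) ` ?F)" by blast
  moreover have "|{{}} \<union> ((\<lambda>f. f ` Field \<kappa>) ` ?F)| \<le>o \<Omega>"
    by (rule Un_Cinfinite_bound[OF _ F cinf_\<Omega>]) (rule le_imp_le_\<Omega>[OF finite_le], simp)
  ultimately show ?thesis by (rule subset_le)
qed

end

section \<open>The linear order \<open>\<rat>\<^sub>\<kappa>\<close>\<close>

declare One_nat_def [simp del]

context kappa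
begin

abbreviation Q where "Q \<equiv> Q_set \<kappa>"

lemma Q_vals: "f \<in> Q \<Longrightarrow> a \<in> Field \<kappa> \<Longrightarrow> f a = 0 \<or> f a = 1"
  unfolding Q_set_def by (auto simp: PiE_iff)

lemma Q_ext: "f \<in> Q \<Longrightarrow> g \<in> Q \<Longrightarrow> (\<And>a. a \<in> Field \<kappa> \<Longrightarrow> f a = g a) \<Longrightarrow> f = g"
  unfolding Q_set_def by (auto intro: PiE_ext)

lemma Q_first_diff:
  assumes "f \<in> Q" "g \<in> Q" "f \<noteq> g"
  obtains a where "a \<in> Field \<kappa>" "f a \<noteq> g a" "\<And>b. b \<in> underS \<kappa> a \<Longrightarrow> f b = g b"
proof -
  let ?D = "{a \<in> Field \<kappa>. f a \<noteq> g a}"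
  have "?D \<noteq> {}" using Q_ext[OF assms(1,2)] assms(3) by blast
  then obtain a where a: "a \<in> ?D" "\<And>b. b \<in> ?D \<Longrightarrow> (a, b) \<in> \<kappa>" using k.ex_least[of ?D] by auto
  have "f b = g b" if "b \<in> underS \<kappa> a" for b
    using a(2)[of b] k.lt_not_le[OF that] k.lt_fieldL[OF that] by blast
  with a(1) that show ?thesis by blast
qed

lemma Field_Q: "Field (Q_order \<kappa>) = Q"
  by (auto simp: Q_order_def Field_def)

lemma Q_lt_iff: "f \<in> underS (Q_order \<kappa>) g \<longleftrightarrow> f \<in> Q \<and> g \<in> Q \<and>
   (\<exists>a\<in>Field \<kappa>. f a < g a \<and> (\<forall>b\<in>underS \<kappa> a. f b = g b))"
  by (auto simp: Q_order_def underS_def)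

lemma Linear_order_Q: "Linear_order (Q_order \<kappa>)"
proof -
  have refl: "refl_on Q (Q_order \<kappa>)" by (auto simp: Q_order_def refl_on_def)
  have tr: "trans (Q_order \<kappa>)"
  proof (rule transI)
    fix f g h assume fg: "(f, g) \<in> Q_order \<kappa>" and gh: "(g, h) \<in> Q_order \<kappa>"
    show "(f, h) \<in> Q_order \<kappa>"
    proof (cases "f = g \<or> g = h")
      case True
      then show ?thesis using fg gh by blast
    next
      case False
      then obtain a b where a: "a \<in> Field \<kappa>" "f a < g a" "\<forall>x\<in>underS \<kappa> a. f x = g x"
        and b: "b \<in> Field \<kappa>" "g b < h b" "\<forall>x\<in>underS \<kappa> b. g x = h x"
        using fg gh by (auto simp: Q_order_def)
      have "f c < h c \<and> (\<forall>x\<in>underS \<kappa> c. f x = h x)"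
        if c: "c = a \<and> (a, b) \<in> \<kappa> \<or> c = b \<and> b \<in> underS \<kappa> a" for c
        using c
      proof
        assume c: "c = a \<and> (a, b) \<in> \<kappa>"
        then show ?thesis
          using a b by (cases "a = b") (auto simp: k.lt_iff dest: k.lt_le_trans)
      next
        assume c: "c = b \<and> b \<in> underS \<kappa> a"
        then show ?thesis using a b k.lt_trans by auto
      qed
      moreover have "(a, b) \<in> \<kappa> \<or> b \<in> underS \<kappa> a" using a b k.linear by blast
      ultimately have "\<exists>c\<in>Field \<kappa>. f c < h c \<and> (\<forall>x\<in>underS \<kappa> c. f x = h x)" using a(1) b(1) by blast
      then show ?thesis using fg gh by (auto simp: Q_order_def)
    qed
  qed
  have anti: "antisym (Q_order \<kappa>)"
  proof (rule antisymI, rule ccontr)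
    fix f g assume fg: "(f, g) \<in> Q_order \<kappa>" "(g, f) \<in> Q_order \<kappa>" "f \<noteq> g"
    then obtain a b where a: "a \<in> Field \<kappa>" "f a < g a" "\<forall>x\<in>underS \<kappa> a. f x = g x"
      and b: "b \<in> Field \<kappa>" "g b < f b" "\<forall>x\<in>underS \<kappa> b. g x = f x"
      by (auto simp: Q_order_def)
    then show False using k.linear[of a b] k.le_iff by fastforce
  qed
  have "(f, g) \<in> Q_order \<kappa> \<or> (g, f) \<in> Q_order \<kappa>" if fg: "f \<in> Q" "g \<in> Q" "f \<noteq> g" for f g
  proof -
    obtain a where a: "a \<in> Field \<kappa>" "f a \<noteq> g a" "\<And>b. b \<in> underS \<kappa> a \<Longrightarrow> f b = g b"
      using Q_first_diff[OF fg] by blast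
    then have "f a < g a \<or> g a < f a" by linarith
    then show ?thesis using a fg by (auto simp: Q_order_def)
  qed
  with refl tr anti show ?thesis
    unfolding order_on_defs total_on_def Field_Q by (auto simp: Q_order_def)
qed

end

sublocale kappa \<subseteq> q: lin "Q_order \<kappa>"
  by unfold_locales (rule Linear_order_Q)

context kappa
begin

abbreviation qlt (infix "\<sqsubset>" 50) where "x \<sqsubset> y \<equiv> x \<in> underS (Q_order \<kappa>) y"
abbreviation qle (infix "\<sqsubseteq>" 50) where "x \<sqsubseteq> y \<equiv> (x, y) \<in> Q_order \<kappa>"

lemma q_fieldL: "p \<sqsubset> q \<Longrightarrow> p \<in> Q" and q_fieldR: "p \<sqsubset> q \<Longrightarrow> q \<in> Q"
  by (auto simp: Q_lt_iff)

lemma qle_fieldR: "p \<sqsubseteq> q \<Longrightarrow> q \<in> Q"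
  by (auto simp: Q_order_def)

lemma Q_leI:
  assumes "f \<in> Q" "g \<in> Q" "\<And>a. a \<in> Field \<kappa> \<Longrightarrow> f a \<le> g a"
  shows "f \<sqsubseteq> g"
proof (cases "f = g")
  case True
  then show ?thesis using assms by (auto simp: Q_order_def)
next
  case False
  obtain a where "a \<in> Field \<kappa>" "f a \<noteq> g a" "\<And>b. b \<in> underS \<kappa> a \<Longrightarrow> f b = g b"
    using Q_first_diff[OF assms(1,2) False] by blast
  then show ?thesis using assms by (fastforce simp: Q_order_def)
qed

lemma Q_supp_bound:
  assumes "q \<in> Q"
  obtains a where "a \<in> Field \<kappa>" "\<And>b. b \<in> Field \<kappa> \<Longrightarrow> q b = 1 \<Longrightarrow> b \<in> underS \<kappa> a"
  using assms \<kappa>_bound[of "{b \<in> Field \<kappa>. q b = 1}"] unfolding Q_set_def by blast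

definition ones :: "'a set \<Rightarrow> 'a \<Rightarrow> nat" where
  "ones D = (\<lambda>a. if a \<in> Field \<kappa> then (if a \<in> D then 1 else 0) else undefined)"

lemma ones_Q: "D \<subseteq> Field \<kappa> \<Longrightarrow> D \<noteq> {} \<Longrightarrow> |D| <o \<kappa> \<Longrightarrow> ones D \<in> Q"
proof -
  assume D: "D \<subseteq> Field \<kappa>" "D \<noteq> {}" "|D| <o \<kappa>"
  then have "{a \<in> Field \<kappa>. ones D a = 1} = D" by (auto simp: ones_def)
  with D show ?thesis unfolding Q_set_def by (auto simp: ones_def PiE_iff extensional_def)
qed

text \<open>A function whose single 1 lies beyond the first 1 of \<open>q\<close> is smaller. This
  later makes the cuts in \<open>embeddable_Tr\<close> nonempty.\<close>

lemma Q_no_least: "q \<in> Q \<Longrightarrow> \<exists>p. p \<sqsubset> q"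
proof -
  assume q: "q \<in> Q"
  let ?D = "{b \<in> Field \<kappa>. q b = 1}"
  have "?D \<noteq> {}" using q unfolding Q_set_def by blast
  then obtain m where m: "m \<in> ?D" "\<And>b. b \<in> ?D \<Longrightarrow> (m, b) \<in> \<kappa>" using k.ex_least[of ?D] by auto
  obtain a where a: "a \<in> Field \<kappa>" "m \<in> underS \<kappa> a" using \<kappa>_limit[of m] m(1) by blast
  have "ones {a} \<in> Q" using a by (intro ones_Q finite_lt) auto
  moreover have "ones {a} m < q m" using m a k.lt_irrefl by (auto simp: ones_def)
  moreover have "ones {a} b = q b" if b: "b \<in> underS \<kappa> m" for b
  proof -
    have "b \<in> Field \<kappa>" "b \<noteq> a" using b a k.lt_fieldL k.lt_asym by blast+
    moreover have "q b \<noteq> 1" using m(2)[of b] k.lt_not_le[OF b] \<open>b \<in> Field \<kappa>\<close> by blast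
    ultimately show ?thesis using Q_vals[OF q] by (auto simp: ones_def)
  qed
  ultimately show ?thesis using q m(1) Q_lt_iff by blast
qed

lemma Q_nonempty: "Q \<noteq> {}"
proof -
  obtain a where "a \<in> Field \<kappa>" using inf by fastforce
  then have "ones {a} \<in> Q" by (intro ones_Q finite_lt) auto
  then show ?thesis by blast
qed

text \<open>Supports are bounded, so every \<open>f\<close> in \<open>A\<close> vanishes somewhere,
  and regularity collects such zeros below a common \<open>u\<close>. An initial block of ones that
  reaches past \<open>u\<close> differs from \<open>f\<close> for the first time no later than at
  that zero, and \<open>f\<close> has value 0 where they differ. This is what bounds unions of short
  chains of nodes.\<close>

lemma Q_upper:
  assumes A: "A \<subseteq> Q" "|A| <o \<kappa>"
  shows "\<exists>q\<in>Q. \<forall>a\<in>A. a \<sqsubset> q"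
proof -
  have "\<exists>m\<in>Field \<kappa>. f m = 0" if "f \<in> A" for f
  proof -
    have f: "f \<in> Q" using that A by blast
    obtain a where "a \<in> Field \<kappa>" "\<And>b. b \<in> Field \<kappa> \<Longrightarrow> f b = 1 \<Longrightarrow> b \<in> underS \<kappa> a"
      using Q_supp_bound[OF f] by blast
    then show ?thesis using Q_vals[OF f] k.lt_irrefl by blast
  qed
  then obtain z where z: "\<And>f. f \<in> A \<Longrightarrow> z f \<in> Field \<kappa> \<and> f (z f) = 0" by metis
  obtain u where u: "u \<in> Field \<kappa>" "\<And>f. f \<in> A \<Longrightarrow> z f \<in> underS \<kappa> u"
    using \<kappa>_bound[of "z ` A"] image_lt[OF A(2)] z by blast
  \<comment> \<open>Passing from \<open>u\<close> to \<open>u'\<close> makes the block of ones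
    nonempty, as membership in \<open>Q\<close> demands, even if \<open>A\<close> is empty.\<close>
  obtain u' where u': "u' \<in> Field \<kappa>" "u \<in> underS \<kappa> u'" using \<kappa>_limit[OF u(1)] by blast
  have Q: "ones (underS \<kappa> u') \<in> Q"
    using u' card_underS_\<kappa> k.lt_fieldL by (intro ones_Q) blast+
  have "f \<sqsubset> ones (underS \<kappa> u')" if f: "f \<in> A" for f
  proof -
    have "f \<noteq> ones (underS \<kappa> u')"
      using z[OF f] u(2)[OF f] k.lt_trans u'(2) by (auto simp: ones_def dest!: fun_cong[of _ _ "z f"])
    then obtain a where a: "a \<in> Field \<kappa>" "f a \<noteq> ones (underS \<kappa> u') a"
      "\<And>b. b \<in> underS \<kappa> a \<Longrightarrow> f b = ones (underS \<kappa> u') b"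
      using Q_first_diff[OF _ Q] f A by blast
    have "(a, z f) \<in> \<kappa>"
    proof (rule ccontr)
      assume "(a, z f) \<notin> \<kappa>"
      then have "z f \<in> underS \<kappa> a" using k.linear z f a(1) by blast
      then have "0 = ones (underS \<kappa> u') (z f)" using a(3) z f by metis
      then show False using z[OF f] u(2)[OF f] k.lt_trans u'(2) by (auto simp: ones_def split: if_splits)
    qed
    then have "a \<in> underS \<kappa> u'" using u(2)[OF f] u'(2) k.le_lt_trans k.lt_trans by blast
    then have "f a < ones (underS \<kappa> u') a"
      using a(1,2) Q_vals[OF _ a(1), of f] f A by (auto simp: ones_def)
    then show ?thesis using a Q f A Q_lt_iff by blast
  qed
  with Q show ?thesis by blast
qed

section \<open>Room above a rational, and increasing sequences of length \<kappa> inside an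
  interval\<close>

definition strict_ub :: "('a \<Rightarrow> nat) \<Rightarrow> 'a \<Rightarrow> bool" where
  "strict_ub q a \<longleftrightarrow> a \<in> Field \<kappa> \<and> (\<forall>b\<in>Field \<kappa>. q b = 1 \<longrightarrow> b \<in> underS \<kappa> a)"

text \<open>
  The canonical extension of a node is required to stay below \<open>sc q\<close>, where \<open>q\<close> is the last value of
  the node; it thus depends on the node only, and not on the bound aimed at by the whole branch.
\<close>

definition sc :: "('a \<Rightarrow> nat) \<Rightarrow> 'a \<Rightarrow> nat" where
  "sc q = q((SOME a. strict_ub q a) := 1)"

lemma ex_strict_ub:
  assumes "q \<in> Q"
  shows "\<exists>a. strict_ub q a"
proof -
  obtain a where "a \<in> Field \<kappa>" "\<And>b. b \<in> Field \<kappa> \<Longrightarrow> q b = 1 \<Longrightarrow> b \<in> underS \<kappa> a"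
    by (rule Q_supp_bound[OF assms]) (rule that; blast)
  then show ?thesis unfolding strict_ub_def by blast
qed

lemma sc_eq:
  assumes "q \<in> Q"
  obtains a where "a \<in> Field \<kappa>" "\<And>b. b \<in> Field \<kappa> \<Longrightarrow> q b = 1 \<Longrightarrow> b \<in> underS \<kappa> a" "sc q = q(a := 1)"
proof -
  have "strict_ub q (SOME a. strict_ub q a)" using ex_strict_ub[OF assms] by (rule someI_ex)
  then obtain a where "strict_ub q a" "sc q = q(a := 1)" using sc_def by blast
  then show ?thesis using that unfolding strict_ub_def by blast
qed

lemma Q_upd:
  assumes "q \<in> Q" "D \<subseteq> Field \<kappa>" "|D| <o \<kappa>"
  shows "(\<lambda>b. if b \<in> D then 1 else q b) \<in> Q"
proof -
  have eq: "{a \<in> Field \<kappa>. (if a \<in> D then 1 else q a) = 1} = D \<union> {a \<in> Field \<kappa>. q a = 1}"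
    using assms(2) by auto
  have "|D \<union> {a \<in> Field \<kappa>. q a = 1}| <o \<kappa>"
    using assms by (intro Un_lt) (auto simp: Q_set_def)
  with assms show ?thesis unfolding Q_set_def
    by (auto simp: PiE_iff extensional_def eq)
qed

lemma Q_upd1: "q \<in> Q \<Longrightarrow> a \<in> Field \<kappa> \<Longrightarrow> q(a := 1) \<in> Q"
  using Q_upd[of q "{a}"] finite_lt[of "{a}"] by (simp add: fun_upd_def)

lemma sc_Q: "q \<in> Q \<Longrightarrow> sc q \<in> Q"
proof -
  assume q: "q \<in> Q"
  show ?thesis
  proof (rule sc_eq[OF q])
    fix a assume "a \<in> Field \<kappa>" "sc q = q(a := 1)"
    then show ?thesis using Q_upd1[OF q] by metis
  qed
qed

lemma lt_sc: "q \<in> Q \<Longrightarrow> q \<sqsubset> sc q"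
proof -
  assume q: "q \<in> Q"
  obtain a where a: "a \<in> Field \<kappa>" "\<And>b. b \<in> Field \<kappa> \<Longrightarrow> q b = 1 \<Longrightarrow> b \<in> underS \<kappa> a" "sc q = q(a := 1)"
    by (rule sc_eq[OF q]) (rule that; blast)
  have "q a = 0" using a(2)[OF a(1)] k.lt_irrefl Q_vals[OF q a(1)] by blast
  then show ?thesis using a q sc_Q[OF q] k.lt_irrefl unfolding Q_lt_iff
    by (intro conjI bexI[of _ a]) auto
qed

text \<open>Beyond a place \<open>a\<close> past the support of \<open>p\<close> and past the first
  difference \<open>d\<close> of \<open>p\<close> and \<open>q\<close>, let \<open>\<rho> x\<close>
  be \<open>p\<close> with a block of ones on the interval from \<open>a\<close> up to but excluding
  \<open>x\<close>. Then \<open>e x\<close> and \<open>sc (e x)\<close> only add ones beyond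
  \<open>x\<close>, so each first differs from \<open>\<rho> y\<close>, for \<open>y\<close> after
  \<open>x\<close>, at \<open>x\<close>, where \<open>\<rho> y\<close> has value 1. Everything
  agrees with \<open>p\<close> up to \<open>d\<close>, hence stays below \<open>q\<close>. The
  separate \<open>\<rho> x\<close> bounds all earlier terms, also when \<open>x\<close> is a
  limit.\<close>

lemma spread_tail:
  assumes pq: "p \<sqsubset> q"
  shows "\<exists>a \<rho> e. a \<in> Field \<kappa> \<and>
    (\<forall>x\<in>Field \<kappa>. (a, x) \<in> \<kappa> \<longrightarrow> p \<sqsubseteq> \<rho> x \<and> \<rho> x \<sqsubset> e x \<and> sc (e x) \<sqsubset> q) \<and>
    (\<forall>x y. (a, x) \<in> \<kappa> \<longrightarrow> x \<in> underS \<kappa> y \<longrightarrow> sc (e x) \<sqsubseteq> \<rho> y)"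
proof -
  have p: "p \<in> Q" and q: "q \<in> Q" using q_fieldL[OF pq] q_fieldR[OF pq] .
  obtain d where d: "d \<in> Field \<kappa>" "p d < q d" "\<And>b. b \<in> underS \<kappa> d \<Longrightarrow> p b = q b"
    using pq unfolding Q_lt_iff by auto
  obtain a0 where a0: "a0 \<in> Field \<kappa>" "\<And>b. b \<in> Field \<kappa> \<Longrightarrow> p b = 1 \<Longrightarrow> b \<in> underS \<kappa> a0"
    by (rule Q_supp_bound[OF p]) (rule that; blast)
  have "{d, a0} \<subseteq> Field \<kappa>" using d(1) a0(1) by simp
  from \<kappa>_bound[OF this finite_lt] obtain a where a: "a \<in> Field \<kappa>" "d \<in> underS \<kappa> a" "a0 \<in> underS \<kappa> a"
    by auto
  have p0: "p b = 0" if "(a, b) \<in> \<kappa>" for b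
  proof (rule ccontr)
    assume "p b \<noteq> 0"
    then have "p b = 1" using Q_vals[OF p k.le_fieldR[OF that]] by simp
    then have "b \<in> underS \<kappa> a" using k.lt_trans[OF a0(2) a(3)] k.le_fieldR[OF that] by simp
    then show False using k.lt_not_le that by simp
  qed
  define \<rho> where "\<rho> x = (\<lambda>b. if b \<in> {b. (a, b) \<in> \<kappa> \<and> b \<in> underS \<kappa> x} then 1 else p b)" for x
  have \<rho>Q: "\<rho> x \<in> Q" if "x \<in> Field \<kappa>" for x
    unfolding \<rho>_def
    by (rule Q_upd[OF p]) (auto dest: k.le_fieldR intro!: subset_lt[OF _ card_underS_\<kappa>[OF that]])
  obtain nx where nx: "\<And>x. x \<in> Field \<kappa> \<Longrightarrow> nx x \<in> Field \<kappa> \<and> x \<in> underS \<kappa> (nx x)"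
    using \<kappa>_limit by metis
  \<comment> \<open>The additional 1 sits strictly after \<open>x\<close>: position \<open>x\<close>
    must keep value 0, since the comparison with later \<open>\<rho> y\<close> is decided
    there.\<close>
  define e where "e x = (\<rho> x)(nx x := 1)" for x
  have eQ: "e x \<in> Q" if "x \<in> Field \<kappa>" for x
    unfolding e_def using Q_upd1 \<rho>Q nx that by blast
  have sce: "\<exists>c. c \<in> Field \<kappa> \<and> nx x \<in> underS \<kappa> c \<and> sc (e x) = (e x)(c := 1)" if x: "x \<in> Field \<kappa>" for x
  proof -
    obtain c where "c \<in> Field \<kappa>" "\<And>b. b \<in> Field \<kappa> \<Longrightarrow> e x b = 1 \<Longrightarrow> b \<in> underS \<kappa> c"
      "sc (e x) = (e x)(c := 1)"
      by (rule sc_eq[OF eQ[OF x]]) (rule that; blast)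
    moreover have "e x (nx x) = 1" by (simp add: e_def)
    ultimately show ?thesis using nx[OF x] by blast
  qed
  have scQ: "sc (e x) \<in> Q" if "x \<in> Field \<kappa>" for x using sc_Q eQ that by blast
  have "p \<sqsubseteq> \<rho> x \<and> \<rho> x \<sqsubset> e x \<and> sc (e x) \<sqsubset> q" if x: "x \<in> Field \<kappa>" "(a, x) \<in> \<kappa>" for x
  proof (intro conjI)
    show "p \<sqsubseteq> \<rho> x"
    proof (rule Q_leI[OF p \<rho>Q[OF x(1)]])
      fix b assume "b \<in> Field \<kappa>"
      then have "p b \<le> 1" using Q_vals[OF p] by force
      then show "p b \<le> \<rho> x b" by (simp add: \<rho>_def)
    qed
    have n: "nx x \<in> Field \<kappa>" "x \<in> underS \<kappa> (nx x)" using nx x by blast+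
    have "\<rho> x (nx x) = 0"
      using p0[OF k.le_trans[OF x(2) k.lt_imp_le[OF n(2)]]] k.lt_asym[OF n(2)] by (simp add: \<rho>_def)
    then show "\<rho> x \<sqsubset> e x"
      unfolding Q_lt_iff using \<rho>Q[OF x(1)] eQ[OF x(1)] n k.lt_irrefl
      by (intro conjI bexI[of _ "nx x"]) (auto simp: e_def)
    obtain c where c: "c \<in> Field \<kappa>" "nx x \<in> underS \<kappa> c" "sc (e x) = (e x)(c := 1)"
      using sce[OF x(1)] by blast
    have eqp: "sc (e x) b = p b" if b: "b \<in> underS \<kappa> a" for b
    proof -
      have "b \<in> underS \<kappa> x" using b x k.lt_le_trans by blast
      then have "b \<in> underS \<kappa> (nx x)" "b \<in> underS \<kappa> c" using n c k.lt_trans by blast+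
      then have "b \<noteq> nx x" "b \<noteq> c" using k.lt_irrefl by auto
      then show ?thesis using k.lt_not_le[OF b] unfolding c(3) by (simp add: e_def \<rho>_def)
    qed
    show "sc (e x) \<sqsubset> q"
      unfolding Q_lt_iff using scQ[OF x(1)] q d eqp[OF a(2)] eqp[OF k.lt_trans[OF _ a(2)]]
      by (intro conjI bexI[of _ d]) simp_all
  qed
  moreover have "sc (e x) \<sqsubseteq> \<rho> y" if x: "(a, x) \<in> \<kappa>" "x \<in> underS \<kappa> y" for x y
  proof -
    have f: "x \<in> Field \<kappa>" "y \<in> Field \<kappa>" using x k.lt_fieldL k.lt_fieldR by blast+
    have n: "nx x \<in> Field \<kappa>" "x \<in> underS \<kappa> (nx x)" using nx f by blast+
    obtain c where c: "c \<in> Field \<kappa>" "nx x \<in> underS \<kappa> c" "sc (e x) = (e x)(c := 1)"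
      using sce[OF f(1)] by blast
    have xc: "x \<in> underS \<kappa> c" using n c k.lt_trans by blast
    have eq: "sc (e x) b = \<rho> x b" if "b \<in> underS \<kappa> x \<or> b = x" for b
    proof -
      have "b \<noteq> c" "b \<noteq> nx x"
        using that n(2) xc k.lt_asym[OF n(2)] k.lt_asym[OF xc] k.lt_irrefl by metis+
      then show ?thesis unfolding c(3) by (simp add: e_def)
    qed
    have "sc (e x) x < \<rho> y x"
      using eq[of x] p0[OF x(1)] k.lt_irrefl x by (simp add: \<rho>_def)
    moreover have "sc (e x) b = \<rho> y b" if b: "b \<in> underS \<kappa> x" for b
      using eq[of b] b k.lt_trans[OF b x(2)] by (simp add: \<rho>_def)
    ultimately have "sc (e x) \<sqsubset> \<rho> y"
      unfolding Q_lt_iff using scQ[OF f(1)] \<rho>Q[OF f(2)] f(1) by blast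
    then show ?thesis by (rule q.lt_imp_le)
  qed
  ultimately show ?thesis using a(1) by (intro exI[of _ a] exI[of _ \<rho>] exI[of _ e]) simp
qed

text \<open>A tail of \<kappa> still has cardinality \<kappa>, so its order type is at least
  \<kappa> and \<open>s\<close> embeds into it.\<close>

lemma embed_tail:
  assumes s: "s \<le>o \<kappa>" and a: "a \<in> Field \<kappa>"
  obtains j where "\<And>x. x \<in> Field s \<Longrightarrow> j x \<in> Field \<kappa> \<and> (a, j x) \<in> \<kappa>"
    "\<And>x y. x \<in> underS s y \<Longrightarrow> j x \<in> underS \<kappa> (j y)"
proof -
  let ?B = "{x \<in> Field \<kappa>. (a, x) \<in> \<kappa>}"
  have F: "Field \<kappa> = underS \<kappa> a \<union> ?B" using a k.linear k.lt_fieldL by blast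
  have "\<not> |?B| <o \<kappa>"
  proof
    assume "|?B| <o \<kappa>"
    then have "|Field \<kappa>| <o \<kappa>" using Un_lt[OF card_underS_\<kappa>[OF a]] F by metis
    then show False using card_of_Field_ordIso[OF card] not_ordLess_ordIso by blast
  qed
  then have "\<kappa> \<le>o |?B|" by (simp only: not_lt_iff)
  also have "|?B| \<le>o Restr \<kappa> ?B"
    by (rule card_of_least) (rule well_order_on_Restr[OF k.wo], blast)
  finally have sB: "s \<le>o Restr \<kappa> ?B" using ordLeq_transitive[OF s] by blast
  then obtain f where f: "embed s (Restr \<kappa> ?B) f" and ws: "Well_order s"
    unfolding ordLeq_def by blast
  have inj: "inj_on f (Field s)" using embed_inj_on[OF ws f] .
  have comp: "(f x, f y) \<in> Restr \<kappa> ?B" if "(x, y) \<in> s" for x y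
    using embed_compat[OF f] that unfolding compat_def by blast
  have "f x \<in> Field \<kappa> \<and> (a, f x) \<in> \<kappa>" if "x \<in> Field s" for x
  proof -
    have "(x, x) \<in> s" using that ws unfolding order_on_defs refl_on_def by blast
    then show ?thesis using comp by blast
  qed
  moreover have "f x \<in> underS \<kappa> (f y)" if "x \<in> underS s y" for x y
  proof -
    have "x \<in> Field s" "y \<in> Field s" "x \<noteq> y" "(x, y) \<in> s"
      using that by (auto simp: underS_def Field_def)
    then show ?thesis using comp inj by (auto simp: underS_def inj_on_def)
  qed
  ultimately show ?thesis using that by blast
qed

text \<open>The values \<open>e x\<close> serve as the values of a branch at the points \<open>x\<close> of \<open>C\<^sub>\<delta>\<close>.\<close>

lemma ex_spread:
  assumes s: "s \<le>o \<kappa>" and pq: "p \<sqsubset> q"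
  shows "\<exists>e. \<forall>x\<in>Field s. sc (e x) \<sqsubset> q \<and>
     (\<exists>\<rho>. p \<sqsubseteq> \<rho> \<and> \<rho> \<sqsubset> e x \<and> (\<forall>y. y \<in> underS s x \<longrightarrow> sc (e y) \<sqsubseteq> \<rho>))"
proof -
  obtain a \<rho> e where a: "a \<in> Field \<kappa>" and
    1: "\<forall>x\<in>Field \<kappa>. (a, x) \<in> \<kappa> \<longrightarrow> p \<sqsubseteq> \<rho> x \<and> \<rho> x \<sqsubset> e x \<and> sc (e x) \<sqsubset> q" and
    2: "\<forall>x y. (a, x) \<in> \<kappa> \<longrightarrow> x \<in> underS \<kappa> y \<longrightarrow> sc (e x) \<sqsubseteq> \<rho> y"
    using spread_tail[OF pq] by (elim exE conjE)
  obtain j where j: "\<And>x. x \<in> Field s \<Longrightarrow> j x \<in> Field \<kappa> \<and> (a, j x) \<in> \<kappa>"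
    "\<And>x y. x \<in> underS s y \<Longrightarrow> j x \<in> underS \<kappa> (j y)"
    using embed_tail[OF s a] by metis
  show ?thesis
  proof (intro exI[of _ "\<lambda>x. e (j x)"] ballI)
    fix x assume x: "x \<in> Field s"
    have "sc (e (j y)) \<sqsubseteq> \<rho> (j x)" if y: "y \<in> underS s x" for y
    proof -
      have "y \<in> Field s" using y by (auto simp: underS_def Field_def)
      then show ?thesis using 2 j(1) j(2)[OF y] by simp
    qed
    with 1[rule_format, of "j x"] j(1)[OF x]
    show "sc (e (j x)) \<sqsubset> q \<and> (\<exists>\<rho>. p \<sqsubseteq> \<rho> \<and> \<rho> \<sqsubset> e (j x) \<and> (\<forall>y. y \<in> underS s x \<longrightarrow> sc (e (j y)) \<sqsubseteq> \<rho>))"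
      by (intro conjI exI[of _ "\<rho> (j x)"]) simp_all
  qed
qed

lemma Q_dense: "p \<sqsubset> q \<Longrightarrow> \<exists>r. p \<sqsubset> r \<and> r \<sqsubset> q"
proof -
  assume "p \<sqsubset> q"
  then obtain a \<rho> e where "a \<in> Field \<kappa>"
    "\<forall>x\<in>Field \<kappa>. (a, x) \<in> \<kappa> \<longrightarrow> p \<sqsubseteq> \<rho> x \<and> \<rho> x \<sqsubset> e x \<and> sc (e x) \<sqsubset> q"
    by (auto dest!: spread_tail)
  then have *: "p \<sqsubseteq> \<rho> a" "\<rho> a \<sqsubset> e a" "sc (e a) \<sqsubset> q" using k.le_refl by blast+
  have "e a \<sqsubset> sc (e a)" using lt_sc[OF q_fieldR[OF *(2)]] .
  with * show ?thesis using q.le_lt_trans q.lt_trans by blast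
qed

end

context kappa_exp
begin

text \<open>A rational is determined by a strict bound of its support together with its restriction
  below that bound. The points \<open>a0\<close> and \<open>a1\<close> play the roles of 0 and 1,
  because \<open>weak_power\<close> speaks of functions into \<open>Field \<kappa>\<close>.\<close>

lemma card_Q: "|Q| \<le>o \<kappa>"
proof -
  obtain a0 where a0: "a0 \<in> Field \<kappa>" using inf by fastforce
  then obtain a1 where a1: "a1 \<in> Field \<kappa>" "a1 \<noteq> a0" using \<kappa>_limit k.lt_irrefl by metis
  define A where "A q = (SOME a. strict_ub q a)" for q
  have A: "strict_ub q (A q)" if "q \<in> Q" for q
    unfolding A_def using ex_strict_ub[OF that] by (rule someI_ex)
  define h where "h q = (A q, \<lambda>b. if b \<in> underS \<kappa> (A q) then (if q b = 1 then a1 else a0) else undefined)"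
    for q :: "'a \<Rightarrow> nat"
  have "inj_on h Q"
  proof (rule inj_onI)
    fix p q assume p: "p \<in> Q" and q: "q \<in> Q" and eq: "h p = h q"
    show "p = q"
    proof (rule Q_ext[OF p q])
      fix b assume b: "b \<in> Field \<kappa>"
      have AA: "A p = A q" using eq by (simp add: h_def)
      have "snd (h p) b = snd (h q) b" using eq by simp
      then have "b \<in> underS \<kappa> (A p) \<Longrightarrow> (p b = 1) = (q b = 1)"
        using AA a1 by (auto simp: h_def split: if_splits)
      moreover have "b \<notin> underS \<kappa> (A p) \<Longrightarrow> p b \<noteq> 1 \<and> q b \<noteq> 1"
        using A[OF p] A[OF q] AA b by (auto simp: strict_ub_def)
      ultimately show "p b = q b" using Q_vals[OF p b] Q_vals[OF q b] by metis
    qed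
  qed
  moreover have "h ` Q \<subseteq> (SIGMA \<alpha>:Field \<kappa>. underS \<kappa> \<alpha> \<rightarrow>\<^sub>E Field \<kappa>)"
    using a0 a1 A by (auto simp: h_def PiE_iff extensional_def strict_ub_def)
  ultimately have "|Q| \<le>o weak_power \<kappa>"
    unfolding weak_power_def by (rule inj_le) (rule card_of_mono1, simp)
  then show ?thesis using wp by (rule ordLeq_ordIso_trans)
qed

end

section \<open>Clubs, stationary sets and cofinality\<close>

context kappa
begin

text \<open>Clubs are replaced by closure points of functions: these form a club, and every club
  contains the closure points of some function. Stationarity can then be tested against functions,
  which combine easily. Requiring a nonempty \<open>U d\<close> excludes the least ordinal, which is
  vacuously closed.\<close>

definition closed_under :: "('a set \<Rightarrow> 'a set) \<Rightarrow> 'a set \<Rightarrow> bool" where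
  "closed_under F d \<longleftrightarrow> d \<in> On \<and> U d \<noteq> {} \<and> (\<forall>a. a \<prec> d \<longrightarrow> F a \<prec> d)"

lemma card_under: "|under \<Omega> d| \<le>o \<kappa>"
proof (rule subset_le)
  show "under \<Omega> d \<subseteq> U d \<union> {d}" by (auto simp: under_def o.lt_iff)
  show "|U d \<union> {d}| \<le>o \<kappa>" by (rule Un_Cinfinite_bound[OF card_U finite_le cinf]) simp
qed

text \<open>The least strict upper bound of the iterates of a function that dominates
  \<open>F\<close> on initial segments is closed under \<open>F\<close>. The iterates
  \<open>b\<close> are part of the conclusion because the guessing argument needs a closure point
  together with a countable cofinal sequence.\<close>

lemma ex_closed_omega:
  assumes F: "\<forall>a\<in>On. F a \<in> On" and a: "a \<in> On"
  shows "\<exists>d b. closed_under F d \<and> a \<prec> d \<and> (\<forall>n::nat. b n \<prec> d) \<and> (\<forall>x. x \<prec> d \<longrightarrow> (\<exists>n. x \<prec> b n))"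
proof -
  have "\<exists>y. y \<in> On \<and> x \<prec> y \<and> (\<forall>z. z \<preceq> x \<longrightarrow> F z \<prec> y)" if x: "x \<in> On" for x
  proof -
    have "|insert x (F ` under \<Omega> x)| \<le>o \<kappa>"
      using Un_Cinfinite_bound[OF finite_le[of "{x}"] image_le[OF card_under] cinf] by simp
    moreover have "insert x (F ` under \<Omega> x) \<subseteq> On"
      using x F o.le_fieldL by (auto simp: under_def)
    ultimately obtain y where "y \<in> On" "\<forall>c\<in>insert x (F ` under \<Omega> x). c \<prec> y"
      using On_bound by meson
    then show ?thesis by (auto simp: under_def)
  qed
  then obtain s where s: "\<And>x. x \<in> On \<Longrightarrow> s x \<in> On \<and> x \<prec> s x \<and> (\<forall>z. z \<preceq> x \<longrightarrow> F z \<prec> s x)"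
    by metis
  define b where "b n = (s ^^ n) a" for n
  have b0: "b 0 = a" and bS: "b (Suc n) = s (b n)" for n by (simp_all add: b_def)
  have bOn: "b n \<in> On" for n by (induction n) (simp_all add: b0 bS a s)
  let ?B = "{m \<in> On. \<forall>n. b n \<prec> m}"
  have "|range b| \<le>o \<kappa>"
    by (rule image_le) (rule ordLeq_transitive[OF _ ordLess_imp_ordLeq[OF unc]],
      rule ordIso_imp_ordLeq[OF card_of_nat])
  then have "?B \<noteq> {}" using On_bound[of "range b"] bOn by blast
  then obtain d where d: "d \<in> ?B" and least: "\<And>m. m \<in> ?B \<Longrightarrow> d \<preceq> m"
    using o.ex_least[of ?B] by auto
  have cof: "\<exists>n. x \<preceq> b n" if x: "x \<prec> d" for x
  proof (rule ccontr)
    assume "\<not> ?thesis"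
    then have "b n \<prec> x" for n using o.linear[OF o.lt_fieldL[OF x] bOn[of n]] by simp
    then have "x \<in> ?B" using o.lt_fieldL[OF x] by simp
    then show False using least o.lt_not_le[OF x] by simp
  qed
  have "F x \<prec> d" if x: "x \<prec> d" for x
  proof -
    obtain n where "x \<preceq> b n" using cof[OF x] by auto
    then have "F x \<prec> b (Suc n)" using s bOn bS by simp
    then show ?thesis using d o.lt_trans by blast
  qed
  moreover have "\<exists>n. x \<prec> b n" if x: "x \<prec> d" for x
  proof -
    obtain n where "x \<preceq> b n" using cof[OF x] by auto
    then have "x \<prec> b (Suc n)" using s bOn bS o.le_lt_trans by simp
    then show ?thesis by auto
  qed
  moreover have "a \<prec> d" using d b0 by (metis (lifting) mem_Collect_eq)
  ultimately show ?thesis using d unfolding closed_under_def by (intro exI[of _ d] exI[of _ b]) auto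
qed

lemma ex_closed:
  assumes "\<forall>a\<in>On. F a \<in> On" "a \<in> On"
  shows "\<exists>d. closed_under F d \<and> a \<prec> d"
  using ex_closed_omega[OF assms] by (elim exE conjE) (intro exI conjI)

lemma club_closed_under:
  assumes F: "\<forall>a\<in>On. F a \<in> On"
  shows "club \<Omega> {d. closed_under F d}"
  unfolding club_def
proof
  show "unbounded_in \<Omega> {d. closed_under F d}"
    unfolding unbounded_in_def
  proof (intro conjI ballI)
    fix a assume "a \<in> On"
    then obtain d where "closed_under F d" "a \<prec> d" using ex_closed[OF F] by auto
    then show "\<exists>b\<in>{d. closed_under F d}. a \<preceq> b" using o.lt_imp_le by blast
  qed (auto simp: closed_under_def)
  show "lim_points \<Omega> {d. closed_under F d} \<subseteq> {d. closed_under F d}"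
  proof
    fix d assume d: "d \<in> lim_points \<Omega> {d. closed_under F d}"
    have "F a \<prec> d" if "a \<prec> d" for a
    proof -
      obtain c where "closed_under F c" "a \<prec> c" "c \<prec> d"
        using d \<open>a \<prec> d\<close> unfolding o.lim_points_iff by auto
      then show ?thesis unfolding closed_under_def by (metis o.lt_trans)
    qed
    then show "d \<in> {d. closed_under F d}"
      using d unfolding closed_under_def o.lim_points_iff by (auto intro: o.lt_fieldR)
  qed
qed

lemma On_bound2:
  assumes I: "|I| \<le>o \<kappa>" and F: "\<forall>i\<in>I. \<forall>a\<in>On. F i a \<in> On"
  shows "\<exists>G. \<forall>a\<in>On. G a \<in> On \<and> (\<forall>i\<in>I. F i a \<prec> G a)"
proof -
  have "\<exists>y. y \<in> On \<and> (\<forall>i\<in>I. F i a \<prec> y)" if a: "a \<in> On" for a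
  proof -
    have "(\<lambda>i. F i a) ` I \<subseteq> On" using F a by auto
    from On_bound[OF this image_le[OF I]] show ?thesis by auto
  qed
  then show ?thesis by metis
qed

lemma closed_under_mono:
  "closed_under G d \<Longrightarrow> (\<And>a. a \<in> On \<Longrightarrow> F a \<prec> G a) \<Longrightarrow> closed_under F d"
  unfolding closed_under_def using o.lt_trans o.lt_fieldL by meson

text \<open>\<open>F\<close> jumps from any point into \<open>C\<close>, so a closure point of
  \<open>F\<close> is a limit point of \<open>C\<close>.\<close>

lemma clubE:
  assumes "club \<Omega> C"
  obtains F where "\<forall>a\<in>On. F a \<in> On" "\<And>a. a \<in> On \<Longrightarrow> F a \<in> C \<and> a \<prec> F a"
    "\<And>d. closed_under F d \<Longrightarrow> d \<in> C"
proof -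
  have "\<exists>c. c \<in> C \<and> a \<prec> c \<and> c \<in> On" if a: "a \<in> On" for a
  proof -
    obtain b where b: "b \<in> On" "a \<prec> b" using On_limit[OF a] by auto
    then obtain c where "c \<in> C" "b \<preceq> c"
      using assms unfolding club_def unbounded_in_def by auto
    then show ?thesis using b o.lt_le_trans o.le_fieldR by auto
  qed
  then obtain F where F: "\<And>a. a \<in> On \<Longrightarrow> F a \<in> C \<and> a \<prec> F a \<and> F a \<in> On" by metis
  have "d \<in> C" if d: "closed_under F d" for d
  proof -
    have "d \<in> lim_points \<Omega> C"
      unfolding o.lim_points_iff
    proof (intro conjI allI impI)
      fix b assume "b \<prec> d"
      then show "\<exists>c\<in>C. b \<prec> c \<and> c \<prec> d"
        using d F[of b] o.lt_fieldL unfolding closed_under_def by auto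
    qed (use d in \<open>simp add: closed_under_def\<close>)
    then show ?thesis using assms unfolding club_def by auto
  qed
  with F that[of F] show ?thesis by simp
qed

lemma stationaryD:
  assumes "stationary \<Omega> S" "\<forall>a\<in>On. F a \<in> On"
  shows "\<exists>d\<in>S. closed_under F d"
  using assms(1) club_closed_under[of F, OF assms(2)] unfolding stationary_def by auto

lemma stationaryI:
  assumes "S \<subseteq> On" "\<And>F. \<forall>a\<in>On. F a \<in> On \<Longrightarrow> \<exists>d\<in>S. closed_under F d"
  shows "stationary \<Omega> S"
  unfolding stationary_def
proof (intro conjI allI impI)
  fix C assume "club \<Omega> C"
  then obtain F where F: "\<forall>a\<in>On. F a \<in> On" "\<And>d. closed_under F d \<Longrightarrow> d \<in> C"
    by (rule clubE) (rule that; assumption)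
  obtain d where "d \<in> S" "closed_under F d" using assms(2)[OF F(1)] by auto
  then show "S \<inter> C \<noteq> {}" using F(2) by auto
qed (rule assms(1))

section \<open>Points of cofinality \<kappa>\<close>

lemma ordLess_\<kappa>: "Well_order s \<Longrightarrow> s <o \<kappa> \<longleftrightarrow> |Field s| <o \<kappa>"
proof
  assume "Well_order s" "s <o \<kappa>"
  then show "|Field s| <o \<kappa>"
    using card_of_least[of "Field s" s] by (blast intro: ordLeq_ordLess_trans)
next
  assume s: "Well_order s" "|Field s| <o \<kappa>"
  show "s <o \<kappa>"
  proof (rule ccontr)
    assume "\<not> ?thesis"
    then have "\<kappa> \<le>o s" using not_ordLess_iff_ordLeq[OF k.wo s(1)] by simp
    then have "|Field \<kappa>| \<le>o |Field s|" by (rule card_of_mono2)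
    then have "|Field \<kappa>| <o \<kappa>" using s(2) by (rule ordLeq_ordLess_trans)
    then show False using card_of_Field_ordIso[OF card] not_ordLess_ordIso by auto
  qed
qed

lemma Field_Restr: "D \<subseteq> On \<Longrightarrow> Field (Restr \<Omega> D) = D"
  using o.wo by (intro Refl_Field_Restr2) (simp_all add: order_on_defs)

lemma ordLeq_Restr: "D \<subseteq> On \<Longrightarrow> |D| \<le>o Restr \<Omega> D"
  by (rule card_of_least) (rule well_order_on_Restr[OF o.wo])

lemma Well_order_Restr_On: "Well_order (Restr \<Omega> D)"
  by (rule Well_order_Restr[OF o.wo])

lemma underS_Restr: "c \<in> D \<Longrightarrow> underS (Restr \<Omega> D) c = D \<inter> U c"
  by (auto simp: underS_def)

lemma card_init:
  assumes "C \<subseteq> On" "Restr \<Omega> C \<le>o \<kappa>" "c \<in> C"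
  shows "|C \<inter> U c| <o \<kappa>"
proof -
  have "Restr (Restr \<Omega> C) (underS (Restr \<Omega> C) c) <o Restr \<Omega> C"
    using Field_Restr[OF assms(1)] assms(3) by (intro underS_Restr_ordLess[OF Well_order_Restr_On]) auto
  then have "Restr (Restr \<Omega> C) (C \<inter> U c) <o \<kappa>"
    unfolding underS_Restr[OF assms(3)] by (rule ordLess_ordLeq_trans[OF _ assms(2)])
  then have "Restr \<Omega> (C \<inter> U c) <o \<kappa>" by (simp add: Restr_subset)
  then show ?thesis
    unfolding ordLess_\<kappa>[OF Well_order_Restr_On] using assms(1) by (subst (asm) Field_Restr) auto
qed

lemma Restr_seg: "D \<subseteq> U d \<Longrightarrow> Restr (seg \<Omega> d) D = Restr \<Omega> D"
  unfolding seg_def by (simp add: Restr_subset)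

lemma U_sub: "U d \<subseteq> On"
  using o.lt_fieldL by auto

text \<open>Small initial parts and size at least \<kappa> give \<open>D\<close> order type exactly
  \<kappa>. A cofinal \<open>X\<close> of size below \<kappa> would split \<open>D\<close> into
  fewer than \<kappa> pieces, each of size below \<kappa>, against regularity.\<close>

lemma cof_setI:
  assumes d: "d \<in> On" and D: "D \<subseteq> U d" "\<And>b. b \<prec> d \<Longrightarrow> \<exists>c\<in>D. b \<preceq> c"
    and big: "\<kappa> \<le>o |D|" and small: "\<And>y. y \<prec> d \<Longrightarrow> |D \<inter> U y| <o \<kappa>"
  shows "d \<in> cof_set \<Omega> \<kappa>"
proof -
  have DOn: "D \<subseteq> On" using D(1) U_sub by auto
  have "Restr \<Omega> D \<le>o \<kappa>"
    unfolding ordLeq_iff_ordLess_Restr[OF Well_order_Restr_On k.wo] Field_Restr[OF DOn]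
  proof
    fix a assume a: "a \<in> D"
    have "Restr \<Omega> (D \<inter> U a) <o \<kappa>"
      unfolding ordLess_\<kappa>[OF Well_order_Restr_On]
      using small[of a] a D(1) DOn by (subst Field_Restr) auto
    then show "Restr (Restr \<Omega> D) (underS (Restr \<Omega> D) a) <o \<kappa>"
      unfolding underS_Restr[OF a] by (simp add: Restr_subset)
  qed
  moreover have "\<kappa> \<le>o Restr \<Omega> D" using big ordLeq_Restr[OF DOn] by (rule ordLeq_transitive)
  ultimately have 1: "Restr (seg \<Omega> d) D =o \<kappa>"
    unfolding Restr_seg[OF D(1)] by (simp add: ordIso_iff_ordLeq)
  have 2: "\<kappa> \<le>o Restr (seg \<Omega> d) X" if X: "unbounded_in (seg \<Omega> d) X" for X
  proof -
    have XU: "X \<subseteq> U d" and Xu: "\<And>b. b \<prec> d \<Longrightarrow> \<exists>c\<in>X. b \<preceq> c"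
      using X unfolding o.unbounded_in_seg by auto
    have "\<not> |X| <o \<kappa>"
    proof
      assume s: "|X| <o \<kappa>"
      have "D \<subseteq> (\<Union>x\<in>X. D \<inter> U x \<union> {x})"
      proof
        fix y assume y: "y \<in> D"
        then obtain x where "x \<in> X" "y \<preceq> x" using Xu D(1) by blast
        then show "y \<in> (\<Union>x\<in>X. D \<inter> U x \<union> {x})" using y o.le_iff by auto
      qed
      moreover have "|\<Union>x\<in>X. D \<inter> U x \<union> {x}| <o \<kappa>"
        using XU by (intro UN_lt s Un_lt small finite_lt) auto
      ultimately have "|D| <o \<kappa>" by (rule subset_lt)
      then show False using big not_lt_iff by auto
    qed
    then have "\<kappa> \<le>o |X|" by (simp add: not_lt_iff)
    also have "|X| \<le>o Restr \<Omega> X" using XU U_sub by (intro ordLeq_Restr) auto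
    finally show ?thesis unfolding Restr_seg[OF XU] by (rule ordLeq_transitive) (rule ordLeq_reflexive[OF Well_order_Restr_On])
  qed
  have "unbounded_in (seg \<Omega> d) D" using D unfolding o.unbounded_in_seg by auto
  then show ?thesis using d 1 2 unfolding cof_set_def has_cofinality_def by auto
qed

lemma cof_setD:
  assumes d: "d \<in> cof_set \<Omega> \<kappa>" and X: "X \<subseteq> U d" "\<And>b. b \<prec> d \<Longrightarrow> \<exists>c\<in>X. b \<preceq> c"
  shows "\<not> |X| <o \<kappa>"
proof
  assume s: "|X| <o \<kappa>"
  have "unbounded_in (seg \<Omega> d) X" using X unfolding o.unbounded_in_seg by auto
  then have "\<kappa> \<le>o Restr \<Omega> X"
    using d unfolding cof_set_def has_cofinality_def by (metis (no_types, lifting) mem_Collect_eq Restr_seg X(1))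
  moreover have "Restr \<Omega> X <o \<kappa>"
    unfolding ordLess_\<kappa>[OF Well_order_Restr_On] using s X(1) U_sub by (subst Field_Restr) auto
  ultimately show False using not_ordLess_ordLeq by auto
qed

lemma cof_set_lim: "d \<in> cof_set \<Omega> \<kappa> \<Longrightarrow> o.lim d"
proof -
  assume d: "d \<in> cof_set \<Omega> \<kappa>"
  have "U d \<noteq> {}" using cof_setD[OF d, of "{}"] finite_lt[of "{}"] by auto
  moreover have "\<exists>c. b \<prec> c \<and> c \<prec> d" if b: "b \<prec> d" for b
  proof (rule ccontr)
    assume no: "\<not> ?thesis"
    have "x \<preceq> b" if "x \<prec> d" for x
      using no o.linear[OF o.lt_fieldL[OF that] o.lt_fieldL[OF b]] that by auto
    then show False using cof_setD[OF d, of "{b}"] b finite_lt[of "{b}"] by auto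
  qed
  ultimately show ?thesis using d unfolding o.lim_def cof_set_def by auto
qed

text \<open>If \<open>C\<close> had size \<kappa>, its proper initial parts would be smaller by
  \<open>card_init\<close>, and \<open>cof_setI\<close> would put \<open>d\<close> at cofinality
  \<kappa>. This bounds \<open>C d\<close> at the levels that take all bounded branches.\<close>

lemma card_not_cof:
  assumes "d \<in> On" "d \<notin> cof_set \<Omega> \<kappa>" "C \<subseteq> U d" "\<And>b. b \<prec> d \<Longrightarrow> \<exists>c\<in>C. b \<preceq> c" "Restr \<Omega> C \<le>o \<kappa>"
  shows "|C| <o \<kappa>"
proof (rule ccontr)
  assume "\<not> |C| <o \<kappa>"
  then have big: "\<kappa> \<le>o |C|" by (simp add: not_lt_iff)
  have small: "|C \<inter> U y| <o \<kappa>" if "y \<prec> d" for y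
  proof -
    obtain c where c: "c \<in> C" "y \<preceq> c" using assms(4)[OF \<open>y \<prec> d\<close>] by auto
    have "|C \<inter> U c| <o \<kappa>" using assms(3,5) U_sub c by (intro card_init) auto
    moreover have "C \<inter> U y \<subseteq> C \<inter> U c" using o.underS_mono[OF c(2)] by auto
    ultimately show ?thesis by (rule subset_lt[rotated])
  qed
  show False using cof_setI[OF assms(1,3,4) big small] assms(2) by simp
qed

text \<open>The first \<open>d\<close> with \<kappa> many closure points of \<open>F\<close> below
  it works: by minimality fewer than \<kappa> lie below any earlier point, so the closure points are
  cofinal in \<open>d\<close> with order type \<kappa>, and \<open>d\<close> is itself closed as
  their limit.\<close>

lemma stationary_cof_set: "stationary \<Omega> (cof_set \<Omega> \<kappa>)"
proof (rule stationaryI)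
  show "cof_set \<Omega> \<kappa> \<subseteq> On" by (auto simp: cof_set_def)
  fix F assume F: "\<forall>a\<in>On. F a \<in> On"
  let ?D = "{d. closed_under F d}"
  let ?E = "{d \<in> On. \<kappa> \<le>o |?D \<inter> U d| }"
  have "\<not> |?D| \<le>o \<kappa>"
  proof
    assume "|?D| \<le>o \<kappa>"
    then obtain d where "d \<in> On" "\<forall>a\<in>?D. a \<prec> d"
      using On_bound[of ?D] by (auto simp: closed_under_def)
    moreover obtain c where "closed_under F c" "d \<prec> c"
      using ex_closed[of F, OF F \<open>d \<in> On\<close>] by auto
    ultimately show False using o.lt_asym by auto
  qed
  then have "\<not> |?D| <o \<kappa>" using ordLess_imp_ordLeq by auto
  then have "|Field \<kappa>| \<le>o |?D|"
    unfolding not_lt_iff using ordLeq_transitive[OF card_Field] by auto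
  then obtain f where f: "inj_on f (Field \<kappa>)" "f ` Field \<kappa> \<subseteq> ?D"
    using card_of_ordLeq[of "Field \<kappa>" ?D] by auto
  have "f ` Field \<kappa> \<subseteq> On" using f(2) by (auto simp: closed_under_def)
  then obtain d0 where d0: "d0 \<in> On" "\<forall>a\<in>f ` Field \<kappa>. a \<prec> d0"
    using On_bound image_le[OF card_Field] by meson
  have "|Field \<kappa>| \<le>o |?D \<inter> U d0|"
    using card_of_ordLeq[of "Field \<kappa>" "?D \<inter> U d0"] f d0(2) by auto
  then have "\<kappa> \<le>o |?D \<inter> U d0|"
    using ordIso_ordLeq_trans[OF ordIso_symmetric[OF card_of_Field_ordIso[OF card]]] by auto
  then have "?E \<noteq> {}" using d0(1) by auto
  then obtain d where d: "d \<in> ?E" and least: "\<And>m. m \<in> ?E \<Longrightarrow> d \<preceq> m"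
    using o.ex_least[of ?E] by auto
  have small: "|?D \<inter> U y| <o \<kappa>" if y: "y \<prec> d" for y
  proof (rule ccontr)
    assume "\<not> ?thesis"
    then have "y \<in> ?E" using not_lt_iff[of "?D \<inter> U y"] o.lt_fieldL[OF y] by simp
    then show False using least[of y] o.lt_not_le[OF y] by simp
  qed
  have cof: "\<exists>c\<in>?D \<inter> U d. b \<prec> c" if b: "b \<prec> d" for b
  proof (rule ccontr)
    assume no: "\<not> ?thesis"
    have "?D \<inter> U d \<subseteq> (?D \<inter> U b) \<union> {b}"
    proof
      fix x assume x: "x \<in> ?D \<inter> U d"
      then have "\<not> b \<prec> x" using no by auto
      then have "x \<preceq> b" using x b o.not_lt o.lt_fieldL by auto
      then show "x \<in> (?D \<inter> U b) \<union> {b}" using x o.le_iff by auto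
    qed
    then have "|?D \<inter> U d| <o \<kappa>" using Un_lt[OF small[OF b] finite_lt[of "{b}"]] by (auto intro: subset_lt)
    then show False using d not_lt_iff by auto
  qed
  have "d \<in> cof_set \<Omega> \<kappa>"
  proof (rule cof_setI[of d "?D \<inter> U d"])
    show "\<exists>c\<in>?D \<inter> U d. b \<preceq> c" if "b \<prec> d" for b
      using cof[OF that] by (elim bexE) (rule bexI, erule o.lt_imp_le)
    show "|?D \<inter> U d \<inter> U y| <o \<kappa>" if "y \<prec> d" for y
      using small[OF that] by (rule subset_lt[rotated]) auto
  qed (use d in auto)
  moreover have "closed_under F d"
    unfolding closed_under_def
  proof (intro conjI allI impI)
    show "U d \<noteq> {}" using cof_set_lim[OF \<open>d \<in> cof_set \<Omega> \<kappa>\<close>] by (simp add: o.lim_def)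
    fix a assume "a \<prec> d"
    then obtain c where "closed_under F c" "c \<prec> d" "a \<prec> c" using cof by auto
    then show "F a \<prec> d" unfolding closed_under_def by (metis o.lt_trans)
  qed (use d in auto)
  ultimately show "\<exists>d\<in>cof_set \<Omega> \<kappa>. closed_under F d" by auto
qed

text \<open>An Ulam matrix: \<open>f b\<close> injects the predecessors of \<open>b\<close> into \<open>\<kappa>\<close>.\<close>

lemma ex_disjoint_stationary:
  assumes S: "stationary \<Omega> S"
  shows "\<exists>I T. \<Omega> \<le>o |I| \<and> (\<forall>i\<in>I. stationary \<Omega> (T i) \<and> T i \<subseteq> S) \<and>
    (\<forall>i\<in>I. \<forall>j\<in>I. \<forall>d. d \<in> T i \<longrightarrow> d \<in> T j \<longrightarrow> (i :: 'a set) = j)"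
proof -
  have SOn: "S \<subseteq> On" using S by (simp add: stationary_def)
  have "\<exists>f. inj_on f (U b) \<and> f ` U b \<subseteq> Field \<kappa>" for b
    by (rule inj_into[OF card_U[of b] card]) auto
  then obtain f where f: "\<And>b. inj_on (f b) (U b)" "\<And>b. f b ` U b \<subseteq> Field \<kappa>" by metis
  define A where "A a x = {b \<in> S. a \<prec> b \<and> f b a = x}" for a x
  have "\<exists>x\<in>Field \<kappa>. stationary \<Omega> (A a x)" if a: "a \<in> On" for a
  proof (rule ccontr)
    assume no: "\<not> ?thesis"
    have "\<exists>F. (\<forall>c\<in>On. F c \<in> On) \<and> (\<forall>d\<in>A a x. \<not> closed_under F d)" if x: "x \<in> Field \<kappa>" for x
    proof (rule ccontr)
      assume "\<not> ?thesis"
      then have "stationary \<Omega> (A a x)"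
        by (intro stationaryI) (use SOn in \<open>auto simp: A_def\<close>)
      then show False using no x by auto
    qed
    then obtain F where F: "\<And>x. x \<in> Field \<kappa> \<Longrightarrow> (\<forall>c\<in>On. F x c \<in> On) \<and> (\<forall>d\<in>A a x. \<not> closed_under (F x) d)"
      by metis
    have "\<forall>x\<in>Field \<kappa>. \<forall>c\<in>On. F x c \<in> On" using F by simp
    from On_bound2[OF card_Field this] obtain G
      where "\<forall>c\<in>On. G c \<in> On \<and> (\<forall>x\<in>Field \<kappa>. F x c \<prec> G c)" by (elim exE)
    then have G: "\<And>c. c \<in> On \<Longrightarrow> G c \<in> On" "\<And>c x. x \<in> Field \<kappa> \<Longrightarrow> c \<in> On \<Longrightarrow> F x c \<prec> G c"
      by simp_all
    have "{a, G c} \<subseteq> On" if "c \<in> On" for c using a G(1) that by auto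
    then have "\<exists>y. y \<in> On \<and> a \<prec> y \<and> G c \<prec> y" if "c \<in> On" for c
      using On_bound[OF _ finite_le[of "{a, G c}"]] that by auto
    \<comment> \<open>Since \<open>H\<close> also exceeds \<open>a\<close>, each of its closure
      points \<open>b\<close> lies above \<open>a\<close>, so \<open>f b a\<close> is defined by the
      matrix and is one of the values \<open>x\<close> already treated.\<close>
    then obtain H where H: "\<And>c. c \<in> On \<Longrightarrow> H c \<in> On \<and> a \<prec> H c \<and> G c \<prec> H c" by metis
    obtain b where b: "b \<in> S" "closed_under H b" using stationaryD[OF S, of H] H by metis
    then obtain c where c: "c \<prec> b" unfolding closed_under_def by auto
    then have "a \<prec> H c" "H c \<prec> b" using H[OF o.lt_fieldL[OF c]] b(2) by (auto simp: closed_under_def)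
    then have ab: "a \<prec> b" by (rule o.lt_trans)
    then have "f b a \<in> Field \<kappa>" "b \<in> A a (f b a)" using f(2)[of b] b(1) by (auto simp: A_def)
    moreover have "closed_under (F (f b a)) b"
      using b(2) by (rule closed_under_mono) (use G(2) H \<open>f b a \<in> Field \<kappa>\<close> o.lt_trans in meson)
    ultimately show False using F by auto
  qed
  then obtain X where X: "\<And>a. a \<in> On \<Longrightarrow> X a \<in> Field \<kappa> \<and> stationary \<Omega> (A a (X a))" by metis
  \<comment> \<open>Pigeonhole over the \<kappa> possible values leaves one \<open>x\<close>
    attained \<kappa>^+ times. For this fixed \<open>x\<close> the sets \<open>A a x\<close> are
    disjoint, because each \<open>f b\<close> is injective.\<close>
  have "\<exists>x\<in>Field \<kappa>. \<not> |{a \<in> On. X a = x}| \<le>o \<kappa>"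
  proof (rule ccontr)
    assume "\<not> ?thesis"
    then have "|\<Union>x\<in>Field \<kappa>. {a \<in> On. X a = x}| \<le>o \<kappa>"
      by (intro UN_le card_Field) auto
    moreover have "On \<subseteq> (\<Union>x\<in>Field \<kappa>. {a \<in> On. X a = x})" using X by auto
    ultimately have "|On| \<le>o \<kappa>" by (rule subset_le[rotated])
    then show False
      using not_le_\<kappa> ordIso_imp_ordLeq[OF ordIso_symmetric[OF card_of_Field_ordIso[OF card_\<Omega>]]] by auto
  qed
  then obtain x where x: "x \<in> Field \<kappa>" "\<Omega> \<le>o |{a \<in> On. X a = x}|" unfolding not_le_iff by auto
  show ?thesis
  proof (intro exI[of _ "{a \<in> On. X a = x}"] exI[of _ "\<lambda>a. A a x"] conjI ballI allI impI)
    fix i j d assume i: "i \<in> {a \<in> On. X a = x}" "j \<in> {a \<in> On. X a = x}" "d \<in> A i x" "d \<in> A j x"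
    then have "i \<prec> d" "j \<prec> d" "f d i = f d j" by (auto simp: A_def)
    then show "i = j" using f(1)[of d] by (auto dest: inj_onD)
  qed (use x X in \<open>auto simp: A_def\<close>)
qed

text \<open>The three coordinates serve the final coding: \<open>i\<close> is a potential element of
  a coded subset of \<kappa>^+, \<open>v\<close> the truth value of its membership, and
  \<open>x\<close> the index of the guess that is diverted there.\<close>

lemma ex_stationary_family:
  assumes S: "stationary \<Omega> S"
  shows "\<exists>T :: 'a set \<Rightarrow> bool \<Rightarrow> 'a \<Rightarrow> 'a set set.
    (\<forall>i\<in>On. \<forall>v. \<forall>x\<in>Field \<kappa>. stationary \<Omega> (T i v x) \<and> T i v x \<subseteq> S) \<and>
    (\<forall>i\<in>On. \<forall>j\<in>On. \<forall>v w. \<forall>x\<in>Field \<kappa>. \<forall>y\<in>Field \<kappa>. \<forall>d. d \<in> T i v x \<longrightarrow> d \<in> T j w y \<longrightarrow>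
       i = j \<and> v = w \<and> x = y)"
proof -
  obtain I and T :: "'a set \<Rightarrow> 'a set set" where I: "\<Omega> \<le>o |I|"
    "\<forall>i\<in>I. stationary \<Omega> (T i) \<and> T i \<subseteq> S"
    "\<forall>i\<in>I. \<forall>j\<in>I. \<forall>d. d \<in> T i \<longrightarrow> d \<in> T j \<longrightarrow> i = j"
    using ex_disjoint_stationary[OF S] by auto
  let ?J = "On \<times> (UNIV :: bool set) \<times> Field \<kappa>"
  have "|?J| \<le>o \<Omega>"
    by (intro Times_le_\<Omega> card_On le_imp_le_\<Omega>[OF card_Field] le_imp_le_\<Omega>[OF finite_le]) simp
  then have "|?J| \<le>o |I|" using I(1) by (rule ordLeq_transitive)
  then obtain g where g: "inj_on g ?J" "g ` ?J \<subseteq> I" using card_of_ordLeq[of ?J I] by auto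
  have gI: "g (i, v, x) \<in> I" if "i \<in> On" "x \<in> Field \<kappa>" for i v x using g(2) that by auto
  show ?thesis
  proof (intro exI[of _ "\<lambda>i v x. T (g (i, v, x))"] conjI ballI allI impI)
    fix i j v w x y d
    assume a: "i \<in> On" "j \<in> On" "x \<in> Field \<kappa>" "y \<in> Field \<kappa>"
      "d \<in> T (g (i, v, x))" "d \<in> T (g (j, w, y))"
    then have "g (i, v, x) = g (j, w, y)" using I(3) gI by blast
    then have "(i, v, x) = (j, w, y)" using g(1) a by (auto dest: inj_onD)
    then show "i = j" "v = w" "x = y" by auto
  qed (use I(2) gI in auto)
qed

end

section \<open>Guessing at points of countable cofinality\<close>

context kappa_exp
begin

text \<open>Gregory's argument: a set is determined below a point of cofinality \<open>\<omega>\<close> by countably many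
  of its initial pieces, and these are enumerated in advance.\<close>

lemma ex_guess:
  fixes \<U> :: "'u set" and \<rho> :: "'u \<Rightarrow> 'a set"
  assumes \<U>: "|\<U>| \<le>o \<Omega>"
  shows "\<exists>G :: 'a set \<Rightarrow> 'a \<Rightarrow> 'u set. \<forall>Z F. Z \<subseteq> \<U> \<longrightarrow> (\<forall>e\<in>On. |{z \<in> Z. \<rho> z \<prec> e}| \<le>o \<kappa>) \<longrightarrow>
    (\<forall>a\<in>On. F a \<in> On) \<longrightarrow>
    (\<exists>i\<in>Field \<kappa>. \<forall>a\<in>On. \<exists>b. a \<prec> b \<and> closed_under F b \<and> b \<notin> cof_set \<Omega> \<kappa> \<and> G b i = {z \<in> Z. \<rho> z \<prec> b})"
proof -
  let ?P = "{z. z \<subseteq> \<U> \<and> |z| \<le>o \<kappa>}"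
  have "{} \<in> ?P" using finite_le[of "{}"] by simp
  then have "?P \<noteq> {}" by blast
  then obtain H where H: "H ` On = ?P" using surj_from[OF card_small_subsets[OF \<U>] card_\<Omega>] by metis
  have "\<exists>e. e ` Field \<kappa> = ((UNIV :: nat set) \<rightarrow>\<^sub>E U b)" if "U b \<noteq> {}" for b
  proof (rule surj_from)
    have "|UNIV :: nat set| <o \<kappa>" using ordIso_ordLess_trans[OF card_of_nat unc] .
    then show "|(UNIV :: nat set) \<rightarrow>\<^sub>E U b| \<le>o \<kappa>" by (rule card_PiE_lt[OF _ card_U])
    show "(UNIV :: nat set) \<rightarrow>\<^sub>E U b \<noteq> {}" using that by (simp add: PiE_eq_empty_iff)
  qed (use card in auto)
  then obtain e where e: "\<And>b. U b \<noteq> {} \<Longrightarrow> e b ` Field \<kappa> = ((UNIV :: nat set) \<rightarrow>\<^sub>E U b)" by metis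
  \<comment> \<open>By \<kappa>^{<\<kappa>} = \<kappa> the map \<open>e b\<close> lists all
    omega-sequences below \<open>b\<close> in \<kappa> steps. The \<open>i\<close>-th guess reads
    such a sequence as codes, under \<open>H\<close>, of pieces to be united.\<close>
  define G where "G b i = (\<Union>n::nat. H (e b i n))" for b i
  have "\<exists>i\<in>Field \<kappa>. \<forall>a\<in>On. \<exists>b. a \<prec> b \<and> closed_under F b \<and> b \<notin> cof_set \<Omega> \<kappa> \<and> G b i = {z \<in> Z. \<rho> z \<prec> b}"
    if Z: "Z \<subseteq> \<U>" "\<forall>e\<in>On. |{z \<in> Z. \<rho> z \<prec> e}| \<le>o \<kappa>" and F: "\<forall>a\<in>On. F a \<in> On" for Z F
  proof -
    have "\<exists>x. x \<in> On \<and> H x = {z \<in> Z. \<rho> z \<prec> c}" if "c \<in> On" for c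
    proof -
      have "{z \<in> Z. \<rho> z \<prec> c} \<in> ?P" using Z that by auto
      then show ?thesis unfolding H[symmetric] by auto
    qed
    then obtain x where x: "\<And>c. c \<in> On \<Longrightarrow> x c \<in> On \<and> H (x c) = {z \<in> Z. \<rho> z \<prec> c}" by metis
    \<comment> \<open>Closing under the codes \<open>x\<close> as well as under \<open>F\<close>
      ensures that the codes of the pieces of \<open>Z\<close> cut at the points \<open>b n\<close>
      lie below \<open>d\<close>, so that their sequence occurs in the list
      \<open>e d\<close>.\<close>
    have "\<exists>y. y \<in> On \<and> F c \<prec> y \<and> x c \<prec> y" if "c \<in> On" for c
      using On_bound[of "{F c, x c}"] finite_le[of "{F c, x c}"] F x that by auto
    then obtain K where K: "\<And>c. c \<in> On \<Longrightarrow> K c \<in> On \<and> F c \<prec> K c \<and> x c \<prec> K c" by metis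
    define good where "good i b \<longleftrightarrow> closed_under F b \<and> b \<notin> cof_set \<Omega> \<kappa> \<and> G b i = {z \<in> Z. \<rho> z \<prec> b}" for i b
    have ex: "\<exists>b i. i \<in> Field \<kappa> \<and> a \<prec> b \<and> good i b" if a: "a \<in> On" for a
    proof -
      obtain d b where d: "closed_under K d" "a \<prec> d" "\<And>n::nat. b n \<prec> d" "\<And>y. y \<prec> d \<Longrightarrow> \<exists>n. y \<prec> b n"
        using ex_closed_omega[OF _ a, of K] K by metis
      have cF: "closed_under F d" and cx: "closed_under x d"
        using closed_under_mono[OF d(1)] K by auto
      have nc: "d \<notin> cof_set \<Omega> \<kappa>"
      proof
        assume c: "d \<in> cof_set \<Omega> \<kappa>"
        have "\<exists>c\<in>range b. y \<preceq> c" if "y \<prec> d" for y using d(4)[OF that] o.lt_imp_le by auto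
        moreover have "|range b| <o \<kappa>" by (rule image_lt[OF ordIso_ordLess_trans[OF card_of_nat unc]])
        ultimately show False using cof_setD[OF c, of "range b"] d(3) by auto
      qed
      have "(\<lambda>n. x (b n)) \<in> (UNIV :: nat set) \<rightarrow>\<^sub>E U d"
        using cx d(3) unfolding closed_under_def by auto
      moreover have "U d \<noteq> {}" using d(2) by auto
      ultimately obtain i where i: "i \<in> Field \<kappa>" "e d i = (\<lambda>n. x (b n))" using e[of d] by (metis imageE)
      have "G d i = (\<Union>n. {z \<in> Z. \<rho> z \<prec> b n})"
        unfolding G_def i(2) using x[OF o.lt_fieldL[OF d(3)]] by simp
      also have "\<dots> = {z \<in> Z. \<rho> z \<prec> d}"
        using d(4) o.lt_trans[OF _ d(3)] by auto
      finally show ?thesis using i(1) d(2) cF nc unfolding good_def by auto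
    qed
    \<comment> \<open>If each index failed from some point on, \<kappa> many such points would have
      a common bound, and no guess would be right beyond it.\<close>
    have "\<exists>i\<in>Field \<kappa>. \<forall>a\<in>On. \<exists>b. a \<prec> b \<and> good i b"
    proof (rule ccontr)
      assume "\<not> ?thesis"
      then obtain m where m: "\<And>i. i \<in> Field \<kappa> \<Longrightarrow> m i \<in> On \<and> (\<forall>b. m i \<prec> b \<longrightarrow> \<not> good i b)" by metis
      obtain a where a: "a \<in> On" "\<And>i. i \<in> Field \<kappa> \<Longrightarrow> m i \<prec> a"
        using On_bound_image[OF card_Field, of m] m by metis
      obtain b i where "i \<in> Field \<kappa>" "a \<prec> b" "good i b" using ex[OF a(1)] by auto
      then show False using m a(2) o.lt_trans by blast
    qed
    then show ?thesis unfolding good_def .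
  qed
  then show ?thesis by (intro exI[of _ G]) auto
qed

end

section \<open>The trees\<close>

type_synonym 'a node = "'a set \<rightharpoonup> ('a \<Rightarrow> nat)"

context kappa_exp
begin

definition all_nodes :: "'a node set" where
  "all_nodes = {s. ran s \<subseteq> Q \<and> (\<exists>d\<in>On. dom s = U d)}"

definition len :: "'a node \<Rightarrow> 'a set" where
  "len s = (THE d. d \<in> On \<and> dom s = U d)"

lemma len_eq: "d \<in> On \<Longrightarrow> dom s = U d \<Longrightarrow> len s = d"
  unfolding len_def by (rule the_equality) (simp, metis o.underS_inj)

lemma card_all_nodes: "|all_nodes| \<le>o \<Omega>"
proof -
  let ?g = "\<lambda>s :: 'a node. {(x, v). s x = Some v}"
  have "inj_on ?g all_nodes"
  proof (rule inj_onI, rule ext)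
    fix s t :: "'a node" and x assume "?g s = ?g t"
    then have "(x, v) \<in> ?g s \<longleftrightarrow> (x, v) \<in> ?g t" for v by simp
    then have "s x = Some v \<longleftrightarrow> t x = Some v" for v by simp
    then show "s x = t x" by (metis not_None_eq)
  qed
  moreover have "?g ` all_nodes \<subseteq> {z. z \<subseteq> On \<times> Q \<and> |z| \<le>o \<kappa>}"
  proof -
    have "?g s \<subseteq> On \<times> Q \<and> |?g s| \<le>o \<kappa>" if s: "s \<in> all_nodes" for s
    proof
      obtain d where d: "dom s = U d" "ran s \<subseteq> Q" using s unfolding all_nodes_def by blast
      then show "?g s \<subseteq> On \<times> Q" using U_sub[of d] by (auto simp: ran_def dom_def)
      have "?g s \<subseteq> (\<lambda>x. (x, the (s x))) ` U d" using d(1) by force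
      then show "|?g s| \<le>o \<kappa>" by (rule subset_le) (rule image_le[OF card_U])
    qed
    then show ?thesis by auto
  qed
  moreover have "|{z. z \<subseteq> On \<times> Q \<and> |z| \<le>o \<kappa>}| \<le>o \<Omega>"
    by (intro card_small_subsets Times_le_\<Omega> card_On le_imp_le_\<Omega>[OF card_Q])
  ultimately show ?thesis by (rule inj_le)
qed

end

locale tree_construction = kappa_exp \<kappa> for \<kappa> :: "'a rel" +
  fixes C :: "'a set \<Rightarrow> 'a set set"
    and G :: "'a set \<Rightarrow> 'a \<Rightarrow> ('a node \<times> 'a node + 'a node) set"
    and q0 :: "'a \<Rightarrow> nat"
  assumes C: "\<And>d. d \<in> Field (cardSuc \<kappa>) \<Longrightarrow> club (seg (cardSuc \<kappa>) d) (C d) \<and> Restr (cardSuc \<kappa>) (C d) \<le>o \<kappa>"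
    and q0: "q0 \<in> Q_set \<kappa>"
begin

text \<open>The base value \<open>q0\<close> stands in for the values of the empty node, so that
  every node, even the empty one, determines a nonempty cut.\<close>

definition bd :: "'a node \<Rightarrow> ('a \<Rightarrow> nat) \<Rightarrow> bool" where
  "bd s p \<longleftrightarrow> q0 \<sqsubseteq> p \<and> (\<forall>v\<in>ran s. v \<sqsubseteq> p)"

text \<open>Mere strict growth would allow \<open>s x\<close> at a limit \<open>x\<close> to be the
  supremum of the earlier values, and then the associated cut would not grow. The intermediate
  rational \<open>p\<close> makes the embedding strict there too.\<close>

definition good :: "'a node \<Rightarrow> bool" where
  "good s \<longleftrightarrow> (\<forall>x\<in>dom s. \<exists>p. bd (s |` U x) p \<and> p \<sqsubset> the (s x))"

definition hat :: "'a set \<Rightarrow> 'a node set \<Rightarrow> 'a node set" where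
  "hat d M = {s. dom s = U d \<and> good s \<and> (\<exists>p. bd s p) \<and> (\<forall>c\<in>U d. s |` U c \<in> M)}"

definition lev :: "'a node set \<Rightarrow> 'a set \<Rightarrow> 'a node set" where
  "lev M b = {s \<in> M. dom s = U b}"

text \<open>Meant for \<open>u\<close> with domain \<open>under \<Omega> c\<close>; then
  \<open>the (u c)\<close> is the last value of \<open>u\<close> and bounds all of \<open>u\<close>.
  The interval from it to its \<open>sc\<close> is the room in which \<open>u\<close> may be
  extended.\<close>

definition ext :: "'a node set \<Rightarrow> 'a set \<Rightarrow> 'a node \<Rightarrow> 'a node set" where
  "ext M c u = {y \<in> M. u \<subseteq>\<^sub>m y \<and> bd y (sc (the (u c)))}"

definition can :: "'a node set \<Rightarrow> 'a set \<Rightarrow> 'a node \<Rightarrow> 'a node" where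
  "can M c u = (SOME y. y \<in> ext M c u)"

text \<open>A guess \<open>Z\<close> codes (the part below \<open>b\<close> of) a partial isomorphism from the tree under
  construction into another tree, together with that other tree.  A branch \<open>y\<close> is captured if its
  image is the canonical extension of the restriction of that image to \<open>under \<Omega> c\<close>.\<close>

definition captured :: "('a node \<times> 'a node + 'a node) set \<Rightarrow> 'a set \<Rightarrow> 'a set \<Rightarrow> 'a node \<Rightarrow> bool" where
  "captured Z c b y \<longleftrightarrow> (\<exists>z. dom z = U b \<and> z = can (hat b {t. Inr t \<in> Z}) c (z |` under \<Omega> c) \<and>
     (\<forall>x. x \<prec> b \<longrightarrow> (\<exists>e. x \<prec> e \<and> e \<prec> b \<and> Inl (y |` U e, z |` U e) \<in> Z)))"

text \<open>The final alternative makes the diverted step total. At the gaps that decide farness,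
  \<open>ex_not_captured\<close> guarantees that an uncaptured extension exists.\<close>

definition step :: "'a option \<Rightarrow> 'a node set \<Rightarrow> 'a set \<Rightarrow> 'a set \<Rightarrow> 'a node \<Rightarrow> 'a node" where
  "step v M c b u = (case v of None \<Rightarrow> can (lev M b) c u
    | Some i \<Rightarrow> if \<exists>y. y \<in> ext (lev M b) c u \<and> \<not> captured (G b i) c b y
               then SOME y. y \<in> ext (lev M b) c u \<and> \<not> captured (G b i) c b y
               else can (lev M b) c u)"

definition nxt :: "'a set \<Rightarrow> 'a set \<Rightarrow> 'a set" where
  "nxt d c = (SOME b. b \<in> C d \<and> c \<prec> b \<and> (\<forall>b'\<in>C d. c \<prec> b' \<longrightarrow> b \<preceq> b'))"

definition prv :: "'a set \<Rightarrow> 'a set \<Rightarrow> 'a set" where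
  "prv d x = (SOME c. c \<in> C d \<and> c \<prec> x \<and> (\<forall>c'\<in>C d. c' \<prec> x \<longrightarrow> c' \<preceq> c))"

text \<open>The recursion is pointwise: a point inside a gap of \<open>C d\<close> recomputes the
  entire step node of that gap from the part up to the left end and reads off its own value.
  Prescribing \<open>e x\<close> on \<open>C d\<close> fixes the last value before each step, and
  thereby the room available to it.\<close>

definition build :: "'a option \<Rightarrow> 'a set \<Rightarrow> 'a node set \<Rightarrow> 'a set \<Rightarrow> 'a node \<Rightarrow> ('a set \<Rightarrow> 'a \<Rightarrow> nat) \<Rightarrow> 'a node" where
  "build v d M c0 x0 e = wfrec (\<Omega> - Id) (\<lambda>s x. if x \<prec> c0 then x0 x else if x \<in> C d then Some (e x)
     else step v M (prv d x) (nxt d (prv d x)) (s |` under \<Omega> (prv d x)) x)"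

definition spread :: "'a set \<Rightarrow> ('a \<Rightarrow> nat) \<Rightarrow> ('a \<Rightarrow> nat) \<Rightarrow> ('a set \<Rightarrow> 'a \<Rightarrow> nat) \<Rightarrow> bool" where
  "spread d p q e \<longleftrightarrow> (\<forall>x\<in>C d. sc (e x) \<sqsubset> q \<and>
     (\<exists>\<rho>. p \<sqsubseteq> \<rho> \<and> \<rho> \<sqsubset> e x \<and> (\<forall>y\<in>C d. y \<prec> x \<longrightarrow> sc (e y) \<sqsubseteq> \<rho>)))"

text \<open>Selecting \<open>e\<close> by \<open>SOME\<close> leaves only the four parameters
  \<open>c0\<close>, \<open>x0\<close>, \<open>p\<close>, \<open>q\<close>, each from a set of size
  at most \<kappa>; this keeps a level of cofinality \<kappa> small.\<close>

definition level_fun :: "'a option \<Rightarrow> 'a set \<Rightarrow> 'a node set \<Rightarrow> 'a node set" where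
  "level_fun v d M = (if d \<in> cof_set \<Omega> \<kappa>
     then {s \<in> hat d M. \<exists>c0\<in>C d. \<exists>x0\<in>M. \<exists>p\<in>Q. \<exists>q\<in>Q. s = build v d M c0 x0 (SOME e. spread d p q e) |` U d}
     else hat d M)"

definition L :: "('a set \<Rightarrow> 'a option) \<Rightarrow> 'a set \<Rightarrow> 'a node set" where
  "L \<tau> = wfrec (\<Omega> - Id) (\<lambda>f d. level_fun (\<tau> d) d (\<Union>c\<in>U d. f c))"

definition below :: "('a set \<Rightarrow> 'a option) \<Rightarrow> 'a set \<Rightarrow> 'a node set" where
  "below \<tau> d = (\<Union>c\<in>U d. L \<tau> c)"

lemma L_eq: "L \<tau> d = level_fun (\<tau> d) d (below \<tau> d)"
proof -
  have "L \<tau> d = level_fun (\<tau> d) d (\<Union>c\<in>U d. cut (L \<tau>) (\<Omega> - Id) d c)"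
    unfolding L_def by (subst o.wfrec_lt_cut) (rule refl)
  also have "(\<Union>c\<in>U d. cut (L \<tau>) (\<Omega> - Id) d c) = below \<tau> d"
    unfolding below_def by (intro SUP_cong refl) (rule o.cut_lt)
  finally show ?thesis .
qed

section \<open>Restrictions, bounds and single steps\<close>

lemma bd_mono: "bd s p \<Longrightarrow> p \<sqsubseteq> q \<Longrightarrow> bd s q"
  unfolding bd_def using q.le_trans by blast

lemma bd_Q: "bd s p \<Longrightarrow> p \<in> Q"
  unfolding bd_def using qle_fieldR by blast

lemma restrict_U: "c \<preceq> d \<Longrightarrow> (s |` U d) |` U c = s |` U c"
  using o.underS_mono[of c d] by (simp add: inf.absorb2)

lemma restrict_under_U: "c \<prec> d \<Longrightarrow> (s |` U d) |` under \<Omega> c = s |` under \<Omega> c"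
proof -
  assume "c \<prec> d"
  then have "under \<Omega> c \<subseteq> U d" using o.le_lt_trans by (auto simp: under_def)
  then show ?thesis by (simp add: inf.absorb2)
qed

lemma restrict_dom: "dom s = A \<Longrightarrow> s |` A = s"
  by (auto simp: restrict_map_def dom_def)

lemma map_le_restrict: "u \<subseteq>\<^sub>m y \<Longrightarrow> y |` dom u = u"
  by (rule ext) (auto simp: map_le_def restrict_map_def dom_def)

lemma restrict_map_le: "s |` A \<subseteq>\<^sub>m s"
  by (auto simp: map_le_def)

lemma L_hat: "s \<in> L \<tau> d \<Longrightarrow> s \<in> hat d (below \<tau> d)"
  unfolding L_eq[of \<tau> d] level_fun_def by (auto split: if_splits)

lemma L_dom: "s \<in> L \<tau> d \<Longrightarrow> dom s = U d"
  using L_hat unfolding hat_def by blast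

lemma L_good: "s \<in> L \<tau> d \<Longrightarrow> good s"
  using L_hat unfolding hat_def by blast

lemma L_bd: "s \<in> L \<tau> d \<Longrightarrow> \<exists>p. bd s p"
  using L_hat unfolding hat_def by blast

lemma lev_below: "b \<prec> d \<Longrightarrow> lev (below \<tau> d) b = L \<tau> b"
proof -
  assume b: "b \<prec> d"
  have "s \<in> L \<tau> b" if "s \<in> L \<tau> c" "c \<prec> d" "dom s = U b" for s c
  proof -
    have "U c = U b" using L_dom[OF that(1)] that(3) by simp
    then have "c = b" using o.underS_inj[OF o.lt_fieldL[OF that(2)] o.lt_fieldL[OF b]] by simp
    then show ?thesis using that(1) by simp
  qed
  then show ?thesis using b L_dom unfolding lev_def below_def by blast
qed

lemma L_restrict: "s \<in> L \<tau> d \<Longrightarrow> c \<prec> d \<Longrightarrow> s |` U c \<in> L \<tau> c"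
proof -
  assume s: "s \<in> L \<tau> d" and c: "c \<prec> d"
  have "s |` U c \<in> below \<tau> d" using L_hat[OF s] c unfolding hat_def by blast
  moreover have "dom (s |` U c) = U c"
    using L_dom[OF s] o.underS_mono[OF o.lt_imp_le[OF c]] by auto
  ultimately have "s |` U c \<in> lev (below \<tau> d) c" by (simp add: lev_def)
  then show ?thesis by (simp add: lev_below[OF c])
qed

lemma L_restrict_le: "s \<in> L \<tau> d \<Longrightarrow> c \<preceq> d \<Longrightarrow> s |` U c \<in> L \<tau> c"
  using L_restrict L_dom restrict_dom o.le_iff by metis

lemma hat_below_iff:
  "s \<in> hat d (below \<tau> d) \<longleftrightarrow> dom s = U d \<and> good s \<and> (\<exists>p. bd s p) \<and> (\<forall>c. c \<prec> d \<longrightarrow> s |` U c \<in> L \<tau> c)"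
proof
  assume s: "s \<in> hat d (below \<tau> d)"
  have "s |` U c \<in> L \<tau> c" if c: "c \<prec> d" for c
  proof -
    have "s |` U c \<in> below \<tau> d" "dom s = U d" using s c unfolding hat_def by blast+
    moreover have "dom (s |` U c) = U c"
      using \<open>dom s = U d\<close> o.underS_mono[OF o.lt_imp_le[OF c]] by auto
    ultimately have "s |` U c \<in> lev (below \<tau> d) c" by (simp add: lev_def)
    then show ?thesis by (simp add: lev_below[OF c])
  qed
  with s show "dom s = U d \<and> good s \<and> (\<exists>p. bd s p) \<and> (\<forall>c. c \<prec> d \<longrightarrow> s |` U c \<in> L \<tau> c)"
    unfolding hat_def by blast
qed (auto simp: hat_def below_def)

lemma L_not_cof: "d \<notin> cof_set \<Omega> \<kappa> \<Longrightarrow> L \<tau> d = hat d (below \<tau> d)"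
  unfolding L_eq[of \<tau> d] level_fun_def by simp

lemma good_bd_last:
  assumes "good u" "dom u = under \<Omega> c" "c \<in> On"
  shows "bd u (the (u c)) \<and> the (u c) \<in> Q"
proof -
  have c: "c \<in> dom u" using assms(2,3) o.le_refl by (simp add: under_def)
  then obtain p where p: "bd (u |` U c) p" "p \<sqsubset> the (u c)" using assms(1) unfolding good_def by blast
  have v: "v \<sqsubseteq> the (u c)" if v: "v \<in> ran u" for v
  proof -
    obtain x where x: "u x = Some v" using v by (auto simp: ran_def)
    then have "x \<in> under \<Omega> c" using assms(2) by blast
    then have "x \<prec> c \<or> x = c" by (auto simp: under_def o.le_iff)
    then show ?thesis
    proof
      assume "x \<prec> c"
      then have "v \<in> ran (u |` U c)" using x by (auto simp: ran_def restrict_map_def)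
      then have "v \<sqsubseteq> p" using p(1) by (simp add: bd_def)
      then show ?thesis using q.le_trans q.lt_imp_le[OF p(2)] by blast
    next
      assume "x = c"
      then show ?thesis using x q.le_refl q_fieldR[OF p(2)] by (simp add: Field_Q)
    qed
  qed
  have "q0 \<sqsubseteq> the (u c)" using p q.le_trans q.lt_imp_le unfolding bd_def by blast
  with v q_fieldR[OF p(2)] show ?thesis by (simp add: bd_def)
qed

text \<open>The induction hypothesis for the existence of extensions. The strict gap between
  \<open>p\<close> and \<open>q\<close> is the room for new values; without it the bound could not
  be controlled through limits.\<close>

definition extends_to :: "('a set \<Rightarrow> 'a option) \<Rightarrow> 'a set \<Rightarrow> bool" where
  "extends_to \<tau> b \<longleftrightarrow> (\<forall>a x p q. a \<preceq> b \<longrightarrow> x \<in> L \<tau> a \<longrightarrow> bd x p \<longrightarrow> p \<sqsubset> q \<longrightarrow>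
     (\<exists>y\<in>L \<tau> b. x \<subseteq>\<^sub>m y \<and> bd y q))"

lemma under_le_U: "c \<prec> b \<Longrightarrow> U s = under \<Omega> c \<Longrightarrow> s \<in> On \<Longrightarrow> s \<preceq> b"
proof -
  assume a: "c \<prec> b" "U s = under \<Omega> c" "s \<in> On"
  show "s \<preceq> b"
  proof (rule ccontr)
    assume "\<not> s \<preceq> b"
    then have "b \<prec> s" using o.linear[OF a(3) o.lt_fieldR[OF a(1)]] by simp
    then have "b \<preceq> c" using a(2) by (simp add: under_def)
    then show False using o.lt_not_le[OF a(1)] by simp
  qed
qed

lemma ext_nonempty:
  assumes E: "extends_to \<tau> b" and cb: "c \<prec> b" and s: "s \<in> On" "U s = under \<Omega> c" and u: "u \<in> L \<tau> s"
  shows "ext (L \<tau> b) c u \<noteq> {}"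
proof -
  have *: "bd u (the (u c))" "the (u c) \<in> Q"
    using good_bd_last[OF L_good[OF u] _ o.lt_fieldL[OF cb]] L_dom[OF u] s(2) by simp_all
  obtain y where "y \<in> L \<tau> b" "u \<subseteq>\<^sub>m y" "bd y (sc (the (u c)))"
    using E under_le_U[OF cb s(2,1)] u *(1) lt_sc[OF *(2)] unfolding extends_to_def by metis
  then show ?thesis unfolding ext_def by blast
qed

lemma can_ext: "ext M c u \<noteq> {} \<Longrightarrow> can M c u \<in> ext M c u"
  unfolding can_def some_in_eq .

lemma step_ext:
  assumes "ext (lev M b) c u \<noteq> {}"
  shows "step v M c b u \<in> ext (lev M b) c u"
proof (cases v)
  case None
  then show ?thesis using can_ext[OF assms] by (simp add: step_def)
next
  case (Some i)
  show ?thesis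
  proof (cases "\<exists>y. y \<in> ext (lev M b) c u \<and> \<not> captured (G b i) c b y")
    case True
    then show ?thesis using someI_ex[OF True] by (simp add: step_def Some)
  next
    case False
    then show ?thesis using can_ext[OF assms] by (simp only: step_def Some option.case if_False)
  qed
qed

lemma step_not_captured:
  assumes "y \<in> ext (lev M b) c u" "\<not> captured (G b i) c b y"
  shows "\<not> captured (G b i) c b (step (Some i) M c b u)"
proof -
  have ex: "\<exists>y. y \<in> ext (lev M b) c u \<and> \<not> captured (G b i) c b y" using assms by blast
  then show ?thesis using someI_ex[OF ex] by (simp add: step_def)
qed

lemma under_suc_in_L:
  assumes cOn: "c \<in> On" and s: "s |` U c \<in> L \<tau> c" "s c = Some v" and p: "bd (s |` U c) p" "p \<sqsubset> v"
    and S: "S \<in> On" "U S = under \<Omega> c"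
  shows "s |` under \<Omega> c \<in> L \<tau> S"
proof -
  let ?u = "s |` under \<Omega> c"
  have dom: "dom ?u = under \<Omega> c"
    using L_dom[OF s(1)] s(2) o.lt_imp_le unfolding under_iff[OF cOn] by auto
  have cS: "c \<prec> S" using S(2) under_iff[OF cOn] by simp
  have r: "?u |` U x = (s |` U c) |` U x" if "x \<preceq> c" for x
  proof -
    have "y \<prec> c" if "y \<prec> x" for y using o.lt_le_trans[OF that \<open>x \<preceq> c\<close>] .
    then show ?thesis by (auto simp: restrict_map_def under_iff[OF cOn] fun_eq_iff)
  qed
  have "good ?u"
    unfolding good_def
  proof
    fix x assume "x \<in> dom ?u"
    then have "x = c \<or> x \<prec> c" using dom under_iff[OF cOn] by auto
    then show "\<exists>p. bd (?u |` U x) p \<and> p \<sqsubset> the (?u x)"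
    proof
      assume "x = c"
      have "?u |` U x = s |` U c"
        unfolding \<open>x = c\<close> r[OF o.le_refl[OF cOn]] by (rule restrict_U[OF o.le_refl[OF cOn]])
      moreover have "the (?u x) = v" using s(2) \<open>x = c\<close> under_iff[OF cOn] by simp
      ultimately show ?thesis using p by auto
    next
      assume x: "x \<prec> c"
      then have "x \<in> dom (s |` U c)" using L_dom[OF s(1)] by simp
      then obtain p where "bd ((s |` U c) |` U x) p" "p \<sqsubset> the ((s |` U c) x)"
        using L_good[OF s(1)] unfolding good_def by blast
      then show ?thesis unfolding r[OF o.lt_imp_le[OF x]] using x under_iff[OF cOn] by auto
    qed
  qed
  moreover have "bd ?u v"
    using good_bd_last[OF \<open>good ?u\<close> dom cOn] s(2) under_iff[OF cOn] by simp
  moreover have "?u |` U x \<in> L \<tau> x" if "x \<prec> S" for x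
  proof -
    have "x \<preceq> c" using that S(2) by (simp add: under_def)
    then show ?thesis using L_restrict_le[OF s(1)] r by simp
  qed
  moreover have "S \<notin> cof_set \<Omega> \<kappa>"
  proof
    assume "S \<in> cof_set \<Omega> \<kappa>"
    then obtain b where "c \<prec> b" "b \<prec> S" using cof_set_lim cS unfolding o.lim_def by blast
    then show False using S(2) o.lt_not_le by (simp add: under_def)
  qed
  ultimately show ?thesis using dom S(2) by (auto simp: L_not_cof hat_below_iff)
qed

text \<open>Domain, goodness and membership of restrictions are local, so they can be checked on
  cofinally many initial pieces. Boundedness is not local and requires a bound uniform in the
  pieces, which is the content of \<open>glue_bd\<close>.\<close>

lemma glue_hat:
  assumes s: "\<And>x. x \<prec> c \<Longrightarrow> \<exists>c'. x \<prec> c' \<and> c' \<preceq> c \<and> s |` U c' \<in> L \<tau> c'"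
  shows "dom (s |` U c) = U c" "good (s |` U c)" "\<And>x. x \<prec> c \<Longrightarrow> (s |` U c) |` U x \<in> L \<tau> x"
proof -
  have "x \<in> dom s" if x: "x \<prec> c" for x
  proof -
    obtain c' where "x \<prec> c'" "s |` U c' \<in> L \<tau> c'" using s[OF x] by blast
    then show ?thesis using L_dom[of "s |` U c'"] by auto
  qed
  then show dom: "dom (s |` U c) = U c" by auto
  show "good (s |` U c)"
    unfolding good_def
  proof
    fix x assume "x \<in> dom (s |` U c)"
    then have x: "x \<prec> c" using dom by simp
    then obtain c' where c': "x \<prec> c'" "c' \<preceq> c" "s |` U c' \<in> L \<tau> c'" using s by blast
    have "x \<in> dom (s |` U c')" using L_dom[OF c'(3)] c'(1) by simp
    then obtain p where "bd ((s |` U c') |` U x) p" "p \<sqsubset> the ((s |` U c') x)"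
      using L_good[OF c'(3)] unfolding good_def by blast
    then show "\<exists>p. bd ((s |` U c) |` U x) p \<and> p \<sqsubset> the ((s |` U c) x)"
      unfolding restrict_U[OF o.lt_imp_le[OF x]] restrict_U[OF o.lt_imp_le[OF c'(1)]]
      using x c'(1) by auto
  qed
  show "(s |` U c) |` U x \<in> L \<tau> x" if x: "x \<prec> c" for x
  proof -
    obtain c' where c': "x \<prec> c'" "s |` U c' \<in> L \<tau> c'" using s[OF x] by blast
    show ?thesis using L_restrict[OF c'(2,1)]
      unfolding restrict_U[OF o.lt_imp_le[OF x]] restrict_U[OF o.lt_imp_le[OF c'(1)]] .
  qed
qed

lemma glue_bd:
  assumes "\<And>x. x \<prec> c \<Longrightarrow> \<exists>c'. x \<prec> c' \<and> bd (s |` U c') p" "q0 \<sqsubseteq> p"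
  shows "bd (s |` U c) p"
  unfolding bd_def
proof (intro conjI ballI)
  fix v assume "v \<in> ran (s |` U c)"
  then obtain x where x: "x \<prec> c" "s x = Some v" by (auto simp: ran_def restrict_map_def split: if_splits)
  obtain c' where c': "x \<prec> c'" "bd (s |` U c') p" using assms(1)[OF x(1)] by blast
  have "v \<in> ran (s |` U c')" using x c'(1) by (auto simp: ran_def restrict_map_def)
  then show "v \<sqsubseteq> p" using c'(2) by (simp add: bd_def)
qed (rule assms(2))

section \<open>Recursion along the club \<open>C d\<close>\<close>

context
  fixes d
  assumes d: "o.lim d"
begin

lemma C_sub: "C d \<subseteq> U d"
  using C[of d] d unfolding o.lim_def o.club_seg_iff by blast

lemma C_lt: "c \<in> C d \<Longrightarrow> c \<prec> d"
  using C_sub by blast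

lemma C_On: "c \<in> C d \<Longrightarrow> c \<in> On"
  using C_lt o.lt_fieldL by blast

lemma C_strict: "b \<prec> d \<Longrightarrow> \<exists>c\<in>C d. b \<prec> c"
  using o.club_seg_strict[of d "C d" b] C[of d] d unfolding o.lim_def by blast

lemma nxt: 
  assumes "c \<prec> d"
  shows "nxt d c \<in> C d" "c \<prec> nxt d c" "\<And>b. b \<in> C d \<Longrightarrow> c \<prec> b \<Longrightarrow> nxt d c \<preceq> b"
proof -
  let ?A = "{b \<in> C d. c \<prec> b}"
  have "?A \<subseteq> On" "?A \<noteq> {}" using C_On C_strict[OF assms] by blast+
  then obtain m where m: "m \<in> ?A" "\<And>a. a \<in> ?A \<Longrightarrow> m \<preceq> a" using o.ex_least[of ?A] by auto
  let ?P = "\<lambda>b. b \<in> C d \<and> c \<prec> b \<and> (\<forall>b'\<in>C d. c \<prec> b' \<longrightarrow> b \<preceq> b')"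
  have "?P m" using m by simp
  then have "?P (nxt d c)" unfolding nxt_def by (rule someI)
  then show "nxt d c \<in> C d" "c \<prec> nxt d c" "\<And>b. b \<in> C d \<Longrightarrow> c \<prec> b \<Longrightarrow> nxt d c \<preceq> b" by simp_all
qed

lemma prv_props:
  assumes "c \<in> C d" "c \<prec> x" "\<And>c'. c' \<in> C d \<Longrightarrow> c' \<prec> x \<Longrightarrow> c' \<preceq> c"
  shows "prv d x = c"
proof -
  let ?P = "\<lambda>c. c \<in> C d \<and> c \<prec> x \<and> (\<forall>c'\<in>C d. c' \<prec> x \<longrightarrow> c' \<preceq> c)"
  have c: "?P c" using assms by simp
  then have "?P (prv d x)" unfolding prv_def by (rule someI)
  then show ?thesis using c o.le_antisym by simp
qed

lemma prv_between:
  assumes c: "c \<in> C d" "c \<prec> x" and x: "x \<prec> nxt d c"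
  shows "prv d x = c" "x \<notin> C d"
proof -
  note n = nxt[OF C_lt[OF c(1)]]
  have *: "c' \<preceq> c" if "c' \<in> C d" "c' \<preceq> x" for c'
  proof (rule ccontr)
    assume "\<not> c' \<preceq> c"
    then have "c \<prec> c'" using o.linear[OF C_On[OF that(1)] C_On[OF c(1)]] by simp
    then have "nxt d c \<preceq> x" using n(3)[OF that(1)] o.le_trans[OF _ that(2)] by simp
    then show False using o.lt_not_le[OF x] by simp
  qed
  show "prv d x = c" using c by (rule prv_props) (use * o.lt_imp_le in simp)
  show "x \<notin> C d"
  proof
    assume "x \<in> C d"
    then have "x \<preceq> c" using * o.le_refl[OF C_On] by simp
    then show False using o.lt_not_le[OF c(2)] by simp
  qed
qed

lemma C_greatest:
  assumes "c0 \<in> C d" "c0 \<preceq> x" "x \<prec> d"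
  obtains c where "c \<in> C d" "c0 \<preceq> c" "c \<preceq> x" "x \<prec> nxt d c"
proof -
  have cl: "club (seg \<Omega> d) (C d)" using C[of d] d unfolding o.lim_def by simp
  obtain c where c: "c \<in> C d" "c \<preceq> x" "\<And>c'. c' \<in> C d \<Longrightarrow> c' \<preceq> x \<Longrightarrow> c' \<preceq> c"
    using o.club_greatest_le[OF cl assms] by metis
  note n = nxt[OF C_lt[OF c(1)]]
  have "x \<prec> nxt d c"
  proof (rule ccontr)
    assume "\<not> x \<prec> nxt d c"
    then have "nxt d c \<preceq> x" using o.not_lt[OF o.lt_fieldL[OF assms(3)] C_On[OF n(1)]] by simp
    then show False using c(3)[OF n(1)] o.lt_not_le[OF n(2)] by simp
  qed
  then show ?thesis using that c assms by simp
qed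

lemma build_eq:
  "build v d M c0 x0 e x = (if x \<prec> c0 then x0 x else if x \<in> C d then Some (e x)
     else step v M (prv d x) (nxt d (prv d x))
       (cut (build v d M c0 x0 e) (\<Omega> - Id) x |` under \<Omega> (prv d x)) x)"
  unfolding build_def by (subst o.wfrec_lt_cut) (rule refl)

text \<open>All points strictly inside the gap have the same predecessor \<open>c\<close> in
  \<open>C d\<close>, and the part up to \<open>c\<close> is already visible to the recursion at
  each of them. Hence they read off one common step node.\<close>

lemma build_step:
  assumes c: "c0 \<preceq> c" "c \<in> C d"
    and y: "step v M c (nxt d c) (build v d M c0 x0 e |` under \<Omega> c) = y"
      "build v d M c0 x0 e |` under \<Omega> c \<subseteq>\<^sub>m y" "dom y = U (nxt d c)"
      "under \<Omega> c \<subseteq> dom (build v d M c0 x0 e)"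
  shows "build v d M c0 x0 e |` U (nxt d c) = y"
proof
  let ?s = "build v d M c0 x0 e"
  fix x
  note n = nxt[OF C_lt[OF c(2)]]
  show "(?s |` U (nxt d c)) x = y x"
  proof (cases "x \<prec> nxt d c")
    case False
    then have "x \<notin> dom y" using y(3) by simp
    then show ?thesis using False by (simp add: restrict_map_def domIff)
  next
    case True
    show ?thesis
    proof (cases "x \<preceq> c")
      case True
      then have "x \<in> dom (?s |` under \<Omega> c)" using y(4) by (auto simp: under_def)
      then have "(?s |` under \<Omega> c) x = y x" using y(2) by (simp add: map_le_def)
      then show ?thesis using True \<open>x \<prec> nxt d c\<close> by (simp add: under_def)
    next
      case False
      then have cx: "c \<prec> x" using o.linear[OF o.lt_fieldL[OF True] C_On[OF c(2)]] by simp
      note p = prv_between[OF c(2) cx True]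
      have "\<not> x \<prec> c0" using o.le_lt_trans[OF c(1) cx] o.lt_asym by blast
      moreover have "cut ?s (\<Omega> - Id) x |` under \<Omega> c = ?s |` under \<Omega> c"
        using o.cut_lt o.le_lt_trans[OF _ cx] by (auto simp: restrict_map_def under_def fun_eq_iff)
      ultimately have "?s x = y x"
        using p y(1) by (subst build_eq) simp
      then show ?thesis using True by simp
    qed
  qed
qed

lemma ex_spread_C: "p \<sqsubset> q \<Longrightarrow> \<exists>e. spread d p q e"
proof -
  assume pq: "p \<sqsubset> q"
  have CO: "C d \<subseteq> On" using C_On by blast
  have "Restr \<Omega> (C d) \<le>o \<kappa>" using C[of d] d unfolding o.lim_def by simp
  from ex_spread[OF this pq] show ?thesis
    unfolding spread_def Field_Restr[OF CO]
    by (elim exE, intro exI) (auto simp: underS_Restr Ball_def imp_conjL)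
qed

text \<open>Induction along \<open>C d\<close>, with separate treatment of its successor and limit
  points. The bound holds for every \<open>\<rho>\<close> above \<open>p\<close> and above the
  earlier \<open>sc (e y)\<close>, because different ones are inserted: at \<open>c\<close> the
  rational below \<open>e c\<close> provided by \<open>spread\<close>, and at the end
  \<open>q\<close>.\<close>

lemma build_in_L:
  fixes \<tau> c0 x0 e
  defines "s \<equiv> build (\<tau> d) d (below \<tau> d) c0 x0 e"
  assumes E: "\<And>b. b \<prec> d \<Longrightarrow> extends_to \<tau> b"
    and c0: "c0 \<in> C d" and x0: "x0 \<in> L \<tau> c0" "bd x0 p" and sp: "spread d p q e"
    and c: "c \<in> C d" "c0 \<preceq> c"
  shows "s |` U c \<in> L \<tau> c \<and> (\<forall>\<rho>. p \<sqsubseteq> \<rho> \<longrightarrow> (\<forall>y\<in>C d. y \<prec> c \<longrightarrow> sc (e y) \<sqsubseteq> \<rho>) \<longrightarrow> bd (s |` U c) \<rho>)"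
  using c
proof (induction c rule: o.lt_induct)
  case (less c)
  have s_e: "s x = Some (e x)" if "x \<in> C d" "c0 \<preceq> x" for x
    unfolding s_def using that o.lt_not_le by (subst build_eq) auto
  obtain \<rho>c where \<rho>c: "p \<sqsubseteq> \<rho>c" "\<rho>c \<sqsubset> e c" "\<forall>y\<in>C d. y \<prec> c \<longrightarrow> sc (e y) \<sqsubseteq> \<rho>c"
    using sp less.prems(1) unfolding spread_def by blast
  have cd: "c \<prec> d" using C_lt[OF less.prems(1)] .
  consider "c = c0" | c' where "c0 \<prec> c" "c' \<in> C d" "c0 \<preceq> c'" "c = nxt d c'"
    | "c0 \<prec> c" "\<And>x. x \<prec> c \<Longrightarrow> \<exists>c'\<in>C d. c0 \<preceq> c' \<and> x \<prec> c' \<and> c' \<prec> c"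
  proof (cases "c = c0")
    case False
    then have c0c: "c0 \<prec> c" using less.prems(2) by (simp add: o.lt_iff)
    show ?thesis
    proof (cases "\<exists>c'\<in>C d. c0 \<preceq> c' \<and> c = nxt d c'")
      case False
      have "\<exists>c'\<in>C d. c0 \<preceq> c' \<and> x \<prec> c' \<and> c' \<prec> c" if x: "x \<prec> c" for x
      proof -
        obtain z where z: "z = x \<or> z = c0" "x \<preceq> z" "c0 \<preceq> z"
          using o.le_maxE[OF o.lt_fieldL[OF x] C_On[OF c0]] by metis
        have zc: "z \<prec> c" using z(1) x c0c by blast
        obtain c1 where c1: "c1 \<in> C d" "c0 \<preceq> c1" "c1 \<preceq> z" "z \<prec> nxt d c1"
          using C_greatest[OF c0 z(3) o.lt_trans[OF zc cd]] by metis
        note n = nxt[OF C_lt[OF c1(1)]]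
        have "nxt d c1 \<preceq> c" using n(3)[OF less.prems(1)] o.le_lt_trans[OF c1(3) zc] by simp
        moreover have "nxt d c1 \<noteq> c" using False c1 by blast
        ultimately have "nxt d c1 \<prec> c" by (simp add: o.lt_iff)
        moreover have "x \<prec> nxt d c1" using o.le_lt_trans[OF z(2) c1(4)] .
        moreover have "c0 \<preceq> nxt d c1" using o.le_trans[OF c1(2) o.lt_imp_le[OF n(2)]] .
        ultimately show ?thesis using n(1) by blast
      qed
      with that c0c show ?thesis by blast
    qed (use that c0c in blast)
  qed
  then show ?case
  proof cases
    case 1
    have "s x = x0 x" if "x \<prec> c0" for x unfolding s_def using that by (subst build_eq) simp
    then have "s |` U c0 = x0 |` U c0" by (auto simp: restrict_map_def)
    then have "s |` U c0 = x0" using restrict_dom[OF L_dom[OF x0(1)]] by simp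
    then show ?thesis using x0 bd_mono 1 by auto
  next
    case (2 c')
    note n = nxt[OF C_lt[OF 2(2)]]
    have c'c: "c' \<prec> c" using n 2 by simp
    have IH: "s |` U c' \<in> L \<tau> c'"
      "\<And>\<rho>. p \<sqsubseteq> \<rho> \<Longrightarrow> (\<forall>y\<in>C d. y \<prec> c' \<longrightarrow> sc (e y) \<sqsubseteq> \<rho>) \<Longrightarrow> bd (s |` U c') \<rho>"
      using less.IH[OF c'c 2(2,3)] by blast+
    obtain \<rho> where \<rho>: "p \<sqsubseteq> \<rho>" "\<rho> \<sqsubset> e c'" "\<forall>y\<in>C d. y \<prec> c' \<longrightarrow> sc (e y) \<sqsubseteq> \<rho>"
      using sp 2(2) unfolding spread_def by blast
    obtain S where S: "S \<in> On" "U S = under \<Omega> c'" using ex_suc[OF C_On[OF 2(2)]] by metis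
    have u: "s |` under \<Omega> c' \<in> L \<tau> S"
      using under_suc_in_L[OF C_On[OF 2(2)] IH(1) s_e[OF 2(2,3)] IH(2)[OF \<rho>(1,3)] \<rho>(2) S] .
    let ?y = "step (\<tau> d) (below \<tau> d) c' c (s |` under \<Omega> c')"
    have last: "the ((s |` under \<Omega> c') c') = e c'"
      using s_e[OF 2(2,3)] o.le_refl[OF C_On[OF 2(2)]] by (simp add: under_def)
    have "?y \<in> ext (L \<tau> c) c' (s |` under \<Omega> c')"
      using step_ext[of "below \<tau> d" c c' "s |` under \<Omega> c'" "\<tau> d"] ext_nonempty[OF E[OF cd] c'c S u]
      unfolding lev_below[OF cd] by simp
    then have y: "?y \<in> L \<tau> c" "s |` under \<Omega> c' \<subseteq>\<^sub>m ?y" "bd ?y (sc (e c'))"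
      unfolding ext_def last by simp_all
    have "under \<Omega> c' \<subseteq> dom s" using L_dom[OF u] S(2) by auto
    then have "s |` U c = ?y"
      using build_step[OF 2(3,2), of "\<tau> d" "below \<tau> d" x0 e ?y] y(2) L_dom[OF y(1)]
      unfolding 2(4) s_def by simp
    then show ?thesis using y bd_mono c'c 2(2) by auto
  next
    case 3
    have restr: "\<exists>c'\<in>C d. x \<prec> c' \<and> c' \<prec> c \<and> c0 \<preceq> c' \<and> s |` U c' \<in> L \<tau> c' \<and>
        (\<forall>\<rho>. p \<sqsubseteq> \<rho> \<longrightarrow> (\<forall>y\<in>C d. y \<prec> c' \<longrightarrow> sc (e y) \<sqsubseteq> \<rho>) \<longrightarrow> bd (s |` U c') \<rho>)" if x: "x \<prec> c" for x
      using 3(2)[OF x] less.IH by meson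
    note glue = glue_hat[of c s \<tau>]
    have pieces: "\<exists>c'. x \<prec> c' \<and> c' \<preceq> c \<and> s |` U c' \<in> L \<tau> c'" if x: "x \<prec> c" for x
      using restr[OF x] o.lt_imp_le by blast
    have bdd: "bd (s |` U c) \<rho>" if \<rho>: "p \<sqsubseteq> \<rho>" "\<forall>y\<in>C d. y \<prec> c \<longrightarrow> sc (e y) \<sqsubseteq> \<rho>" for \<rho>
    proof (rule glue_bd)
      show "q0 \<sqsubseteq> \<rho>" using x0(2) \<rho>(1) q.le_trans unfolding bd_def by blast
      fix x assume x: "x \<prec> c"
      obtain c' where c': "x \<prec> c'" "c' \<prec> c"
        "\<forall>\<rho>. p \<sqsubseteq> \<rho> \<longrightarrow> (\<forall>y\<in>C d. y \<prec> c' \<longrightarrow> sc (e y) \<sqsubseteq> \<rho>) \<longrightarrow> bd (s |` U c') \<rho>"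
        using restr[OF x] by blast
      have "bd (s |` U c') \<rho>" using c' \<rho> o.lt_trans[OF _ c'(2)] by simp
      then show "\<exists>c'. x \<prec> c' \<and> bd (s |` U c') \<rho>" using c'(1) by blast
    qed
    \<comment> \<open>A limit point \<open>c\<close> of \<open>C d\<close> below \<open>d\<close>
      never has cofinality \<kappa>, since \<open>C d\<close> has order type at most \<kappa>. Its
      level therefore takes all bounded branches, and membership reduces to gluing.\<close>
    have "c \<notin> cof_set \<Omega> \<kappa>"
    proof
      assume cof: "c \<in> cof_set \<Omega> \<kappa>"
      have "|C d \<inter> U c| <o \<kappa>"
        using C[of d] d C_On less.prems(1) unfolding o.lim_def by (intro card_init) auto
      then show False using cof_setD[OF cof, of "C d \<inter> U c"] 3(2) o.lt_imp_le by blast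
    qed
    then have "s |` U c \<in> L \<tau> c"
      unfolding L_not_cof[OF \<open>c \<notin> cof_set \<Omega> \<kappa>\<close>] hat_below_iff
      using glue[OF pieces] bdd[OF \<rho>c(1,3)] by blast
    then show ?thesis using bdd by simp
  qed
qed

end

section \<open>Extending nodes to every higher level\<close>

lemma lim_extension:
  assumes d: "o.lim d" and E: "\<And>b. b \<prec> d \<Longrightarrow> extends_to \<tau> b"
    and a: "a \<prec> d" and x: "x \<in> L \<tau> a" "bd x p" and pq: "p \<sqsubset> q"
  shows "\<exists>y\<in>L \<tau> d. x \<subseteq>\<^sub>m y \<and> bd y q"
proof -
  have dOn: "d \<in> On" using d by (simp add: o.lim_def)
  \<comment> \<open>Up to the first point \<open>c0\<close> of \<open>C d\<close> used, the node may
    grow to \<open>p1\<close>; the interval from \<open>p1\<close> to \<open>q\<close> is kept for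
    all later steps.\<close>
  obtain p1 where p1: "p \<sqsubset> p1" "p1 \<sqsubset> q" using Q_dense[OF pq] by blast
  obtain c0 where c0: "c0 \<in> C d" "a \<prec> c0" using C_strict[OF d a] by blast
  obtain x0 where x0: "x0 \<in> L \<tau> c0" "x \<subseteq>\<^sub>m x0" "bd x0 p1"
    using E[OF C_lt[OF d c0(1)]] x p1(1) o.lt_imp_le[OF c0(2)] unfolding extends_to_def by blast
  define e where "e = (SOME e. spread d p1 q e)"
  have sp: "spread d p1 q e" unfolding e_def using ex_spread_C[OF d p1(2)] by (rule someI_ex)
  define s where "s = build (\<tau> d) d (below \<tau> d) c0 x0 e"
  have s: "s |` U c \<in> L \<tau> c \<and> bd (s |` U c) q" if "c \<in> C d" "c0 \<preceq> c" for c
  proof -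
    have "\<forall>y\<in>C d. y \<prec> c \<longrightarrow> sc (e y) \<sqsubseteq> q" using sp q.lt_imp_le unfolding spread_def by blast
    then show ?thesis
      using build_in_L[OF d E c0(1) x0(1,3) sp that] q.lt_imp_le[OF p1(2)] unfolding s_def by blast
  qed
  have "\<exists>c'. x \<prec> c' \<and> c' \<preceq> d \<and> s |` U c' \<in> L \<tau> c' \<and> bd (s |` U c') q" if x: "x \<prec> d" for x
  proof -
    obtain z where z: "z = x \<or> z = c0" "x \<preceq> z" "c0 \<preceq> z"
      using o.le_maxE[OF o.lt_fieldL[OF x] C_On[OF d c0(1)]] by metis
    have "z \<prec> d" using z(1) x C_lt[OF d c0(1)] by blast
    then obtain c where "c \<in> C d" "z \<prec> c" using C_strict[OF d] by blast
    then show ?thesis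
      using s[of c] z o.le_lt_trans o.lt_imp_le C_lt[OF d] o.le_trans by meson
  qed
  then have pieces: "\<exists>c'. x \<prec> c' \<and> c' \<preceq> d \<and> s |` U c' \<in> L \<tau> c'"
    and bds: "\<exists>c'. x \<prec> c' \<and> bd (s |` U c') q" if "x \<prec> d" for x using that by blast+
  have bq: "bd (s |` U d) q"
  proof (rule glue_bd)
    show "q0 \<sqsubseteq> q" using bd_mono[OF x(2) q.lt_imp_le[OF pq]] by (simp add: bd_def)
  qed (rule bds)
  have hat: "s |` U d \<in> hat d (below \<tau> d)"
    unfolding hat_below_iff using glue_hat[of d s \<tau>, OF pieces] bq by blast
  have "x0 \<in> below \<tau> d" using x0(1) C_lt[OF d c0(1)] unfolding below_def by blast
  then have "s |` U d \<in> L \<tau> d"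
    using hat c0(1) q_fieldL[OF p1(2)] q_fieldR[OF p1(2)]
    unfolding L_eq[of \<tau> d] level_fun_def s_def e_def by auto
  moreover have "x \<subseteq>\<^sub>m s |` U d"
  proof -
    have "s |` U c0 = x0 |` U c0"
      unfolding s_def by (rule ext) (simp add: restrict_map_def build_eq[OF d])
    then have "s |` U c0 = x0" using restrict_dom[OF L_dom[OF x0(1)]] by simp
    then have "x0 \<subseteq>\<^sub>m s |` U d"
      using o.lt_trans[OF _ C_lt[OF d c0(1)]]
      by (auto simp: map_le_def restrict_map_def split: if_splits)
    then show ?thesis using x0(2) map_le_trans by blast
  qed
  ultimately show ?thesis using bq by blast
qed

lemma L_suc:
  assumes x: "x \<in> L \<tau> c" "bd x p" "p \<sqsubset> v" and S: "S \<in> On" "U S = under \<Omega> c" and c: "c \<in> On"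
  shows "x(c \<mapsto> v) \<in> L \<tau> S" "bd (x(c \<mapsto> v)) v" "x \<subseteq>\<^sub>m x(c \<mapsto> v)"
proof -
  let ?y = "x(c \<mapsto> v)"
  have cx: "c \<notin> dom x" using L_dom[OF x(1)] o.lt_irrefl by simp
  have r: "?y |` U c = x"
  proof
    fix y
    have "y \<notin> dom x" if "\<not> y \<prec> c" using that L_dom[OF x(1)] by simp
    then show "(?y |` U c) y = x y"
      using o.lt_irrefl[of c] by (auto simp: restrict_map_def domIff)
  qed
  have dom: "dom ?y = under \<Omega> c" using L_dom[OF x(1)] under_iff[OF c] by simp
  have "?y |` under \<Omega> c \<in> L \<tau> S"
    by (rule under_suc_in_L[OF c _ _ _ x(3) S]) (simp_all only: r x fun_upd_same)
  then show y: "?y \<in> L \<tau> S" using restrict_dom[OF dom] by simp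
  show "bd ?y v" using good_bd_last[OF L_good[OF y] dom c] by simp
  show "x \<subseteq>\<^sub>m ?y" using cx by (auto simp: map_le_def)
qed

lemma extends_to: "extends_to \<tau> d"
proof (induction d rule: o.lt_induct)
  case (less d)
  show ?case
    unfolding extends_to_def
  proof (intro allI impI)
    fix a x p q
    assume ad: "a \<preceq> d" and x: "x \<in> L \<tau> a" "bd x p" and pq: "p \<sqsubset> q"
    show "\<exists>y\<in>L \<tau> d. x \<subseteq>\<^sub>m y \<and> bd y q"
    proof (cases "a = d")
      case True
      then show ?thesis using x bd_mono[OF x(2) q.lt_imp_le[OF pq]] map_le_refl by blast
    next
      case False
      then have a: "a \<prec> d" using ad by (simp add: o.lt_iff)
      show ?thesis
      proof (cases "o.lim d")
        case True
        show ?thesis using lim_extension[OF True less.IH a x pq] .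
      next
        case False
        then obtain b where b: "b \<prec> d" "\<And>c. b \<prec> c \<Longrightarrow> \<not> c \<prec> d"
          using a o.lt_fieldR[OF a] unfolding o.lim_def by blast
        have Ub: "U d = under \<Omega> b"
          using b o.linear[OF _ o.lt_fieldL[OF b(1)]] o.lt_fieldL o.le_lt_trans[OF _ b(1)]
          by (auto simp: under_def)
        have "a \<preceq> b" using a Ub by (simp add: under_def)
        obtain p1 where p1: "p \<sqsubset> p1" "p1 \<sqsubset> q" using Q_dense[OF pq] by blast
        obtain y where y: "y \<in> L \<tau> b" "x \<subseteq>\<^sub>m y" "bd y p1"
          using less.IH[OF b(1)] x p1(1) \<open>a \<preceq> b\<close> unfolding extends_to_def by blast
        \<comment> \<open>At a successor, \<open>p1\<close> bounds the part below \<open>b\<close>,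
          while \<open>p2\<close> becomes the new value at \<open>b\<close>.\<close>
        obtain p2 where p2: "p1 \<sqsubset> p2" "p2 \<sqsubset> q" using Q_dense[OF p1(2)] by blast
        note z = L_suc[OF y(1,3) p2(1) o.lt_fieldR[OF b(1)] Ub o.lt_fieldL[OF b(1)]]
        show ?thesis
          using z(1) map_le_trans[OF y(2) z(3)] bd_mono[OF z(2) q.lt_imp_le[OF p2(2)]] by blast
      qed
    qed
  qed
qed

lemma ex_extension:
  assumes "a \<preceq> b" "x \<in> L \<tau> a" "bd x p" "p \<sqsubset> q"
  obtains y where "y \<in> L \<tau> b" "x \<subseteq>\<^sub>m y" "bd y q"
  using extends_to[of \<tau> b] assms unfolding extends_to_def by blast

lemma bd_gt: "bd s p \<Longrightarrow> \<exists>q. p \<sqsubset> q"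
  using lt_sc bd_Q by blast

lemma empty_in_L: "U a = {} \<Longrightarrow> a \<in> On \<Longrightarrow> Map.empty \<in> L \<tau> a"
proof -
  assume a: "U a = {}" "a \<in> On"
  have "a \<notin> cof_set \<Omega> \<kappa>" using cof_set_lim[of a] a unfolding o.lim_def by blast
  moreover have "q0 \<sqsubseteq> q0" using q0 q.le_refl by (simp add: Field_Q)
  ultimately show ?thesis using a by (auto simp: L_not_cof hat_below_iff good_def bd_def)
qed

lemma L_nonempty: "d \<in> On \<Longrightarrow> L \<tau> d \<noteq> {}"
proof -
  assume d: "d \<in> On"
  obtain z where z: "z \<in> On" "\<And>a. a \<in> On \<Longrightarrow> z \<preceq> a" using o.ex_least[of On] d by auto
  have "U z = {}" using z(2) o.lt_not_le o.lt_fieldL by blast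
  then have e: "Map.empty \<in> L \<tau> z" using empty_in_L z(1) by blast
  then obtain p q where "bd Map.empty p" "p \<sqsubset> q" using L_bd bd_gt by metis
  with e show ?thesis using ex_extension[OF z(2)[OF d]] by blast
qed

text \<open>The parameters of \<open>build\<close> disappear from the conclusion: past
  \<open>c0\<close> each gap is filled by \<open>step\<close> applied to the restriction of the
  branch itself. Branches of different trees can thus be compared gap by gap.\<close>

lemma branch_step:
  assumes d: "d \<in> cof_set \<Omega> \<kappa>" and s: "s \<in> L \<tau> d"
  shows "\<exists>c0\<in>C d. \<forall>c\<in>C d. c0 \<preceq> c \<longrightarrow>
    s |` U (nxt d c) = step (\<tau> d) (below \<tau> d) c (nxt d c) (s |` under \<Omega> c)"
proof -
  note lim = cof_set_lim[OF d]
  obtain c0 x0 e where c0: "c0 \<in> C d" and s_eq: "s = build (\<tau> d) d (below \<tau> d) c0 x0 e |` U d"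
    using s d unfolding L_eq[of \<tau> d] level_fun_def by auto
  let ?b = "build (\<tau> d) d (below \<tau> d) c0 x0 e"
  have "s |` U (nxt d c) = step (\<tau> d) (below \<tau> d) c (nxt d c) (s |` under \<Omega> c)"
    if c: "c \<in> C d" "c0 \<preceq> c" for c
  proof -
    have cd: "c \<prec> d" using C_lt[OF lim c(1)] .
    note n = nxt[OF lim cd]
    have nd: "nxt d c \<prec> d" using C_lt[OF lim n(1)] .
    have su: "s |` under \<Omega> c = ?b |` under \<Omega> c" unfolding s_eq by (rule restrict_under_U[OF cd])
    have sn: "s |` U (nxt d c) = ?b |` U (nxt d c)" unfolding s_eq by (rule restrict_U[OF o.lt_imp_le[OF nd]])
    obtain S where S: "S \<in> On" "U S = under \<Omega> c" using ex_suc[OF C_On[OF lim c(1)]] by metis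
    have "S \<preceq> d" using under_le_U[OF cd S(2,1)] .
    then have u: "s |` under \<Omega> c \<in> L \<tau> S" using L_restrict_le[OF s] S(2) by metis
    have "step (\<tau> d) (below \<tau> d) c (nxt d c) (s |` under \<Omega> c) \<in> ext (L \<tau> (nxt d c)) c (s |` under \<Omega> c)"
      using step_ext[of "below \<tau> d" "nxt d c" c] ext_nonempty[OF extends_to n(2) S u]
      unfolding lev_below[OF nd] by blast
    then have y: "s |` under \<Omega> c \<subseteq>\<^sub>m step (\<tau> d) (below \<tau> d) c (nxt d c) (s |` under \<Omega> c)"
      "dom (step (\<tau> d) (below \<tau> d) c (nxt d c) (s |` under \<Omega> c)) = U (nxt d c)"
      using L_dom unfolding ext_def by blast+
    have "under \<Omega> c \<subseteq> dom ?b" using L_dom[OF u] S(2) unfolding su by auto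
    then show ?thesis
      using build_step[OF lim c(2,1) refl] y unfolding su sn by metis
  qed
  then show ?thesis using c0 by blast
qed

text \<open>At cofinality \<kappa> the parameters of \<open>build\<close> are counted. Elsewhere
  \<open>C d\<close> has size below \<kappa> and the traces of a node on \<open>C d\<close>
  determine it, so \<open>card_PiE_lt\<close> applies.\<close>

lemma card_L:
  assumes "d \<in> On"
  shows "|L \<tau> d| \<le>o \<kappa>"
  using assms
proof (induction d rule: o.lt_induct)
  case (less d)
  have M: "|below \<tau> d| \<le>o \<kappa>"
    unfolding below_def by (rule UN_le[OF card_U]) (rule less.IH, auto intro: o.lt_fieldL)
  have Cd: "C d \<subseteq> U d" "\<And>b. b \<prec> d \<Longrightarrow> \<exists>c\<in>C d. b \<preceq> c" "Restr \<Omega> (C d) \<le>o \<kappa>"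
    using C[OF less.prems] unfolding o.club_seg_iff by auto
  show ?case
  proof (cases "d \<in> cof_set \<Omega> \<kappa>")
    case True
    let ?f = "\<lambda>(c0, x0, p, q). build (\<tau> d) d (below \<tau> d) c0 x0 (SOME e. spread d p q e) |` U d"
    have "L \<tau> d \<subseteq> ?f ` (C d \<times> below \<tau> d \<times> Q \<times> Q)"
    proof
      fix s assume "s \<in> L \<tau> d"
      then obtain c0 x0 p q where *: "c0 \<in> C d" "x0 \<in> below \<tau> d" "p \<in> Q" "q \<in> Q"
        "s = build (\<tau> d) d (below \<tau> d) c0 x0 (SOME e. spread d p q e) |` U d"
        unfolding L_eq[of \<tau> d] level_fun_def using True by auto
      then have "s = ?f (c0, x0, p, q)" by simp
      then show "s \<in> ?f ` (C d \<times> below \<tau> d \<times> Q \<times> Q)" using *(1-4) by blast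
    qed
    moreover have "|?f ` (C d \<times> below \<tau> d \<times> Q \<times> Q)| \<le>o \<kappa>"
      by (intro image_le Times_le M card_Q subset_le[OF Cd(1) card_U])
    ultimately show ?thesis by (rule subset_le)
  next
    case False
    have small: "|C d| <o \<kappa>" by (rule card_not_cof[OF less.prems False Cd])
    \<comment> \<open>The value at \<open>c\<close> is recorded besides the restriction: if
      \<open>d\<close> is a successor, \<open>C d\<close> has a greatest element, whose value no
      restriction shows.\<close>
    let ?g = "\<lambda>s. \<lambda>c\<in>C d. (s |` U c, the (s c))"
    have "inj_on ?g (L \<tau> d)"
    proof (rule inj_onI)
      fix s t assume s: "s \<in> L \<tau> d" and t: "t \<in> L \<tau> d" and eq: "?g s = ?g t"
      show "s = t"
      proof
        fix x
        show "s x = t x"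
        proof (cases "x \<prec> d")
          case True
          obtain c where c: "c \<in> C d" "x \<preceq> c" using Cd(2)[OF True] by blast
          have "?g s c = ?g t c" using eq by simp
          then have e: "s |` U c = t |` U c" "the (s c) = the (t c)" using c by simp_all
          have "c \<in> dom s" "c \<in> dom t" using L_dom[OF s] L_dom[OF t] c Cd(1) by auto
          then have "s c = t c" using e(2) by auto
          moreover have "s x = t x" if "x \<prec> c" using fun_cong[OF e(1), of x] that by simp
          ultimately show ?thesis using c(2) by (auto simp: o.le_iff)
        next
          case False
          then have "x \<notin> dom s" "x \<notin> dom t" using L_dom[OF s] L_dom[OF t] by auto
          then show ?thesis by (simp add: domIff)
        qed
      qed
    qed
    moreover have "?g ` L \<tau> d \<subseteq> C d \<rightarrow>\<^sub>E (below \<tau> d \<times> Q)"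
    proof -
      have "s |` U c \<in> below \<tau> d \<and> the (s c) \<in> Q" if s: "s \<in> L \<tau> d" and c: "c \<in> C d" for s c
      proof
        have cd: "c \<prec> d" using c Cd(1) by blast
        then show "s |` U c \<in> below \<tau> d" using L_restrict[OF s] unfolding below_def by blast
        have "c \<in> dom s" using cd L_dom[OF s] by simp
        then show "the (s c) \<in> Q" using L_good[OF s] q_fieldR unfolding good_def by blast
      qed
      then show ?thesis by auto
    qed
    moreover have "|C d \<rightarrow>\<^sub>E (below \<tau> d \<times> Q)| \<le>o \<kappa>"
      by (rule card_PiE_lt[OF small Times_le[OF M card_Q]])
    ultimately show ?thesis by (rule inj_le)
  qed
qed

lemma card_below: "|below \<tau> d| \<le>o \<kappa>"
  unfolding below_def by (rule UN_le[OF card_U]) (rule card_L, auto intro: o.lt_fieldL)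

definition nodes :: "('a set \<Rightarrow> 'a option) \<Rightarrow> 'a node set" where
  "nodes \<tau> = (\<Union>d\<in>On. L \<tau> d)"

lemma L_len: "d \<in> On \<Longrightarrow> s \<in> L \<tau> d \<Longrightarrow> len s = d"
  using len_eq L_dom by blast

lemma nodesE:
  assumes "s \<in> nodes \<tau>"
  shows "len s \<in> On" "s \<in> L \<tau> (len s)"
  using assms L_len unfolding nodes_def by auto

lemma nodesI: "d \<in> On \<Longrightarrow> s \<in> L \<tau> d \<Longrightarrow> s \<in> nodes \<tau>"
  unfolding nodes_def by blast

lemma nodes_sub: "nodes \<tau> \<subseteq> all_nodes"
proof
  fix s assume s: "s \<in> nodes \<tau>"
  note n = nodesE[OF s]
  have "the (s x) \<in> Q" if "x \<in> dom s" for x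
    using L_good[OF n(2)] that q_fieldR unfolding good_def by blast
  then have "ran s \<subseteq> Q" by (force simp: ran_def)
  then show "s \<in> all_nodes" using n L_dom[OF n(2)] unfolding all_nodes_def by blast
qed

lemma nodes_below_iff: "s \<in> nodes \<tau> \<and> len s \<prec> e \<longleftrightarrow> s \<in> below \<tau> e"
  using nodesE[of s \<tau>] L_len o.lt_fieldL nodesI unfolding below_def by blast

text \<open>If no member of the chain has the supremum \<open>d\<close> of the lengths as its
  length, fewer than \<kappa> lengths are cofinal in \<open>d\<close>. So \<open>d\<close> does not
  have cofinality \<kappa>, its level takes all bounded branches, and \<open>Q_upper\<close>
  supplies a bound for the union.\<close>

lemma chain_bound:
  assumes K: "K \<subseteq> nodes \<tau>" "|K| <o \<kappa>"
    and chain: "\<And>s t. s \<in> K \<Longrightarrow> t \<in> K \<Longrightarrow> s \<subseteq>\<^sub>m t \<or> t \<subseteq>\<^sub>m s"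
  shows "\<exists>u\<in>nodes \<tau>. \<forall>s\<in>K. s \<subseteq>\<^sub>m u"
proof -
  let ?B = "{d \<in> On. \<forall>s\<in>K. len s \<preceq> d}"
  have len: "len s \<in> On" "s \<in> L \<tau> (len s)" if "s \<in> K" for s using nodesE K(1) that by blast+
  obtain b where "b \<in> On" "\<And>s. s \<in> K \<Longrightarrow> len s \<prec> b"
    using On_bound_image[OF ordLess_imp_ordLeq[OF K(2)], of len] len by metis
  then have "?B \<noteq> {}" using o.lt_imp_le by blast
  then obtain d where d: "d \<in> ?B" and least: "\<And>m. m \<in> ?B \<Longrightarrow> d \<preceq> m" using o.ex_least[of ?B] by auto
  define s where "s x = (if \<exists>t\<in>K. x \<in> dom t then (SOME t. t \<in> K \<and> x \<in> dom t) x else None)" for x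
  have st: "s x = t x" if "t \<in> K" "x \<in> dom t" for t x
  proof -
    have ex: "\<exists>t. t \<in> K \<and> x \<in> dom t" using that by blast
    define t' where "t' = (SOME t. t \<in> K \<and> x \<in> dom t)"
    have t': "t' \<in> K" "x \<in> dom t'" using someI_ex[OF ex] unfolding t'_def by simp_all
    have "t' x = t x" using chain[OF t'(1) that(1)] t'(2) that(2) unfolding map_le_def by metis
    moreover have "s x = t' x" using that unfolding s_def t'_def by auto
    ultimately show ?thesis by simp
  qed
  have tU: "s |` U (len t) = t" if t: "t \<in> K" for t
  proof
    fix x
    have "t x = None" if "x \<notin> U (len t)" using that L_dom[OF len(2)[OF t]] by (metis domIff)
    then show "(s |` U (len t)) x = t x"
      using st[OF t] L_dom[OF len(2)[OF t]] by (cases "x \<prec> len t") simp_all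
  qed
  show ?thesis
  proof (cases "\<exists>t\<in>K. len t = d")
    case True
    then obtain t where t: "t \<in> K" "len t = d" by blast
    have "u \<subseteq>\<^sub>m t" if u: "u \<in> K" for u
    proof -
      have "U (len u) \<subseteq> U (len t)" using d u t by (intro o.underS_mono) blast
      then show ?thesis using chain[OF u t(1)] L_dom[OF len(2)[OF u]] L_dom[OF len(2)[OF t(1)]]
        unfolding map_le_def by (metis subset_iff)
    qed
    then show ?thesis using t K(1) by blast
  next
    case False
    have lt: "len t \<prec> d" if "t \<in> K" for t using False d that by (auto simp: o.lt_iff)
    have cof: "\<exists>t\<in>K. x \<prec> len t" if x: "x \<prec> d" for x
    proof (rule ccontr)
      assume no: "\<not> ?thesis"
      have "len t \<preceq> x" if "t \<in> K" for t
        using no that o.not_lt[OF o.lt_fieldL[OF x] len(1)[OF that]] by blast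
      then have "x \<in> ?B" using o.lt_fieldL[OF x] by blast
      then show False using least o.lt_not_le[OF x] by blast
    qed
    have nc: "d \<notin> cof_set \<Omega> \<kappa>"
    proof
      assume c: "d \<in> cof_set \<Omega> \<kappa>"
      have "\<exists>c\<in>len ` K. x \<preceq> c" if "x \<prec> d" for x using cof[OF that] o.lt_imp_le by blast
      then show False using cof_setD[OF c, of "len ` K"] lt image_lt[OF K(2)] by blast
    qed
    have pieces: "\<exists>c'. x \<prec> c' \<and> c' \<preceq> d \<and> s |` U c' \<in> L \<tau> c'" if x: "x \<prec> d" for x
    proof -
      obtain t where t: "t \<in> K" "x \<prec> len t" using cof[OF x] by blast
      then show ?thesis using o.lt_imp_le[OF lt[OF t(1)]] tU[OF t(1)] len(2)[OF t(1)] by auto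
    qed
    have "\<exists>p. bd t p" if "t \<in> K" for t using L_bd[OF len(2)[OF that]] .
    then obtain P where P: "\<And>t. t \<in> K \<Longrightarrow> bd t (P t)" by metis
    have "insert q0 (P ` K) \<subseteq> Q" using q0 P bd_Q by blast
    moreover have "|insert q0 (P ` K)| <o \<kappa>"
      using Un_lt[OF finite_lt[of "{q0}"] image_lt[OF K(2)]] by simp
    ultimately obtain q where q: "\<forall>p\<in>insert q0 (P ` K). p \<sqsubset> q" using Q_upper by blast
    have "bd (s |` U d) q"
    proof (rule glue_bd)
      fix x assume x: "x \<prec> d"
      obtain t where t: "t \<in> K" "x \<prec> len t" using cof[OF x] by blast
      then show "\<exists>c'. x \<prec> c' \<and> bd (s |` U c') q"
        using tU[OF t(1)] bd_mono[OF P[OF t(1)] q.lt_imp_le, of q] q by auto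
    qed (use q q.lt_imp_le in blast)
    then have "s |` U d \<in> L \<tau> d"
      unfolding L_not_cof[OF nc] hat_below_iff using glue_hat[of d s \<tau>, OF pieces] by blast
    moreover have "t \<subseteq>\<^sub>m s |` U d" if t: "t \<in> K" for t
    proof -
      have "U (len t) \<subseteq> U d" using o.underS_mono[OF o.lt_imp_le[OF lt[OF t]]] .
      then show ?thesis using st[OF t] L_dom[OF len(2)[OF t]] by (auto simp: map_le_def restrict_map_def subset_iff)
    qed
    ultimately show ?thesis using d nodesI by blast
  qed
qed

end

section \<open>Trees with rank and restriction functions\<close>

text \<open>Here \<open>rs y c\<close> is the node of rank \<open>c\<close> on the branch up to
  \<open>y\<close>. Heights and levels are computed once in this setting, which covers the trees and
  also their downward closed subsets, since these inherit \<open>h\<close> and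
  \<open>rs\<close>.\<close>

locale ranked_tree = kappa \<kappa> for \<kappa> :: "'a rel" +
  fixes T :: "'t rel" and h :: "'t \<Rightarrow> 'a set" and rs :: "'t \<Rightarrow> 'a set \<Rightarrow> 't"
  assumes h_On: "x \<in> Field T \<Longrightarrow> h x \<in> Field (cardSuc \<kappa>)"
    and T_iff: "(x, y) \<in> T \<longleftrightarrow> x \<in> Field T \<and> y \<in> Field T \<and> (h x, h y) \<in> cardSuc \<kappa> \<and> rs y (h x) = x"
    and rs_self: "y \<in> Field T \<Longrightarrow> rs y (h y) = y"
    and rs_in: "y \<in> Field T \<Longrightarrow> (c, h y) \<in> cardSuc \<kappa> \<Longrightarrow> rs y c \<in> Field T \<and> h (rs y c) = c"
    and rs_rs: "y \<in> Field T \<Longrightarrow> (c, h y) \<in> cardSuc \<kappa> \<Longrightarrow> (c', c) \<in> cardSuc \<kappa> \<Longrightarrow> rs (rs y c) c' = rs y c'"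
begin

lemma refl_T: "x \<in> Field T \<Longrightarrow> (x, x) \<in> T"
  using T_iff rs_self o.le_refl[OF h_On] by simp

lemma trans_T: "(x, y) \<in> T \<Longrightarrow> (y, z) \<in> T \<Longrightarrow> (x, z) \<in> T"
  using T_iff o.le_trans rs_rs by metis

lemma antisym_T: "(x, y) \<in> T \<Longrightarrow> (y, x) \<in> T \<Longrightarrow> x = y"
  using T_iff o.le_antisym rs_self by metis

lemma Partial_order_T: "Partial_order T"
  unfolding order_on_defs refl_on_def trans_def antisym_def
  by (intro conjI allI impI ballI subrelI SigmaI)
    (auto intro: refl_T trans_T antisym_T FieldI1 FieldI2)

lemma rs_le: "y \<in> Field T \<Longrightarrow> c \<preceq> h y \<Longrightarrow> (rs y c, y) \<in> T"
  using rs_in T_iff by metis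

lemma underS_iff: "x \<in> underS T y \<longleftrightarrow> y \<in> Field T \<and> h x \<prec> h y \<and> x = rs y (h x)"
proof
  assume "x \<in> underS T y"
  then have xy: "(x, y) \<in> T" "x \<noteq> y" by (auto simp: underS_def)
  then have *: "x \<in> Field T" "y \<in> Field T" "h x \<preceq> h y" "rs y (h x) = x" using T_iff by blast+
  have "h x \<noteq> h y" using * rs_self xy(2) by metis
  with * show "y \<in> Field T \<and> h x \<prec> h y \<and> x = rs y (h x)" by (simp add: o.lt_iff)
next
  assume a: "y \<in> Field T \<and> h x \<prec> h y \<and> x = rs y (h x)"
  then have "(rs y (h x), y) \<in> T" using rs_le o.lt_imp_le by blast
  moreover have "x \<noteq> y" using a o.lt_irrefl by blast
  ultimately show "x \<in> underS T y" using a by (simp add: underS_def)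
qed

lemma underS_T: "y \<in> Field T \<Longrightarrow> underS T y = rs y ` U (h y)"
proof -
  assume y: "y \<in> Field T"
  have "rs y c \<in> underS T y" if "c \<prec> h y" for c
    using that y rs_in[OF y o.lt_imp_le[OF that]] by (simp add: underS_iff)
  then show ?thesis using underS_iff by blast
qed

lemma inj_rs: "y \<in> Field T \<Longrightarrow> inj_on (rs y) (U (h y))"
  by (rule inj_onI) (metis rs_in o.lt_imp_le)

lemma seg_T: "y \<in> Field T \<Longrightarrow> seg T y = dir_image (seg \<Omega> (h y)) (rs y)"
proof -
  assume y: "y \<in> Field T"
  have "(a, b) \<in> seg T y \<longleftrightarrow> (a, b) \<in> dir_image (seg \<Omega> (h y)) (rs y)" for a b
  proof
    assume ab: "(a, b) \<in> seg T y"
    then have a: "h a \<prec> h y" "a = rs y (h a)" and b: "h b \<prec> h y" "b = rs y (h b)"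
      and le: "h a \<preceq> h b" using T_iff underS_iff unfolding seg_def by blast+
    have "(h a, h b) \<in> seg \<Omega> (h y)" using le b by (simp add: o.seg_iff)
    then show "(a, b) \<in> dir_image (seg \<Omega> (h y)) (rs y)" using a(2) b(2) unfolding dir_image_def by blast
  next
    assume "(a, b) \<in> dir_image (seg \<Omega> (h y)) (rs y)"
    then obtain c e where ce: "a = rs y c" "b = rs y e" "c \<preceq> e" "e \<prec> h y"
      unfolding dir_image_def by (auto simp: o.seg_iff)
    have c: "c \<prec> h y" using o.le_lt_trans ce by blast
    note A = rs_in[OF y o.lt_imp_le[OF c]] and B = rs_in[OF y o.lt_imp_le[OF ce(4)]]
    have "(a, b) \<in> T" unfolding T_iff ce(1,2) using A B rs_rs[OF y o.lt_imp_le[OF ce(4)] ce(3)] ce(3) by simp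
    then show "(a, b) \<in> seg T y" using A B c ce y unfolding seg_def by (auto simp: underS_iff)
  qed
  then show ?thesis by auto
qed

lemma seg_ordIso: "y \<in> Field T \<Longrightarrow> seg T y =o seg \<Omega> (h y)"
  unfolding seg_T using dir_image_ordIso[of "seg \<Omega> (h y)" "rs y"] o.Well_order_seg inj_rs
  by (metis o.Field_seg ordIso_symmetric)

lemma seg_lt: "a \<prec> b \<Longrightarrow> seg \<Omega> a <o seg \<Omega> b"
proof -
  assume a: "a \<prec> b"
  have "Restr (seg \<Omega> b) (underS (seg \<Omega> b) a) <o seg \<Omega> b"
    by (rule underS_Restr_ordLess[OF o.Well_order_seg]) (use a in \<open>auto simp: o.Field_seg\<close>)
  moreover have "Restr (seg \<Omega> b) (underS (seg \<Omega> b) a) = seg \<Omega> a"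
  proof -
    have "Restr (Restr \<Omega> (U b)) (U a) = Restr \<Omega> (U a)"
      by (rule Restr_subset[OF o.underS_mono[OF o.lt_imp_le[OF a]]])
    then show ?thesis unfolding o.underS_seg[OF a] by (simp only: seg_def)
  qed
  ultimately show ?thesis by simp
qed

lemma seg_inj: "a \<in> On \<Longrightarrow> b \<in> On \<Longrightarrow> seg \<Omega> a =o seg \<Omega> b \<Longrightarrow> a = b"
  using o.linear o.lt_iff seg_lt not_ordLess_ordIso ordIso_symmetric by metis

lemma ht_eq: "y \<in> Field T \<Longrightarrow> ht \<Omega> T y = h y"
  unfolding ht_def
proof (rule the_equality)
  assume y: "y \<in> Field T"
  show "h y \<in> On \<and> seg T y =o seg \<Omega> (h y)" using h_On[OF y] seg_ordIso[OF y] by simp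
  fix a assume a: "a \<in> On \<and> seg T y =o seg \<Omega> a"
  then have "seg \<Omega> a =o seg \<Omega> (h y)"
    using ordIso_transitive[OF ordIso_symmetric seg_ordIso[OF y]] by blast
  then show "a = h y" using seg_inj a h_On[OF y] by blast
qed

lemma level_eq: "level \<Omega> T a = {y \<in> Field T. h y = a}"
  unfolding level_def using ht_eq by auto

lemma tree_restr_eq: "tree_restr \<Omega> T A = Restr T {y \<in> Field T. h y \<in> A}"
proof -
  have "{y \<in> Field T. ht \<Omega> T y \<in> A} = {y \<in> Field T. h y \<in> A}" using ht_eq by auto
  then show ?thesis unfolding tree_restr_def by simp
qed

lemma Field_Restr_T: "A \<subseteq> Field T \<Longrightarrow> Field (Restr T A) = A"
  using Partial_order_T by (intro Refl_Field_Restr2) (simp_all add: order_on_defs)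

lemma tree_T: "tree T"
  unfolding tree_def using Partial_order_T seg_ordIso by (auto simp: ordIso_def)

lemma card_treeI:
  assumes "\<And>a. a \<in> On \<Longrightarrow> \<exists>y\<in>Field T. h y = a" "\<And>a. a \<in> On \<Longrightarrow> |{y \<in> Field T. h y = a}| \<le>o \<kappa>"
  shows "card_tree \<Omega> T"
proof -
  have "seg T y <o \<Omega>" if y: "y \<in> Field T" for y
  proof -
    have "seg \<Omega> (h y) <o \<Omega>"
      unfolding seg_def using h_On[OF y] by (intro underS_Restr_ordLess[OF o.wo]) auto
    then show ?thesis using ordIso_ordLess_trans[OF seg_ordIso[OF y]] by blast
  qed
  then show ?thesis unfolding card_tree_def level_eq lt_\<Omega>_iff using tree_T assms by auto
qed

lemma ranked_Restr:
  assumes X: "downward_closed T X"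
  shows "ranked_tree \<kappa> (Restr T X) h rs"
proof
  have XF: "X \<subseteq> Field T" and down: "\<And>x y. x \<in> X \<Longrightarrow> y \<in> underS T x \<Longrightarrow> y \<in> X"
    using X unfolding downward_closed_def by blast+
  have F: "Field (Restr T X) = X" by (rule Field_Restr_T[OF XF])
  have rsX: "rs y c \<in> X" if "y \<in> X" "c \<preceq> h y" for y c
  proof (cases "c = h y")
    case True
    then show ?thesis using rs_self that XF by auto
  next
    case False
    then have "c \<prec> h y" using that(2) by (simp add: o.lt_iff)
    then have "rs y c \<in> underS T y" using underS_T that(1) XF by blast
    then show ?thesis using down that(1) by blast
  qed
  show "x \<in> Field (Restr T X) \<Longrightarrow> h x \<in> On" for x unfolding F using h_On XF by blast
  show "(x, y) \<in> Restr T X \<longleftrightarrow> x \<in> Field (Restr T X) \<and> y \<in> Field (Restr T X) \<and> h x \<preceq> h y \<and> rs y (h x) = x" for x y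
    unfolding F using T_iff[of x y] XF by blast
  show "y \<in> Field (Restr T X) \<Longrightarrow> rs y (h y) = y" for y unfolding F using rs_self XF by blast
  show "y \<in> Field (Restr T X) \<Longrightarrow> c \<preceq> h y \<Longrightarrow> rs y c \<in> Field (Restr T X) \<and> h (rs y c) = c" for y c
    unfolding F using rs_in[of y c] rsX XF by blast
  show "y \<in> Field (Restr T X) \<Longrightarrow> c \<preceq> h y \<Longrightarrow> c' \<preceq> c \<Longrightarrow> rs (rs y c) c' = rs y c'" for y c c'
    unfolding F using rs_rs XF by blast
qed

end

text \<open>An isomorphism of restrictions to a set \<open>A\<close> of levels preserves levels, since the height of a
  node is determined by which levels in \<open>A\<close> lie below it.\<close>

lemma iso_preserves_rank:
  assumes T: "ranked_tree \<kappa> T h rs" and U: "ranked_tree \<kappa> W k qs"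
    and bij: "bij_betw f {x \<in> Field T. h x \<in> A} {x \<in> Field W. k x \<in> A}"
    and iso: "\<forall>x\<in>{x \<in> Field T. h x \<in> A}. \<forall>y\<in>{x \<in> Field T. h x \<in> A}. (x, y) \<in> T \<longleftrightarrow> (f x, f y) \<in> W"
    and x: "x \<in> Field T" "h x \<in> A"
  shows "k (f x) = h x"
proof -
  interpret T: ranked_tree \<kappa> T h rs by (rule T)
  interpret W: ranked_tree \<kappa> W k qs by (rule U)
  show ?thesis using x
  proof (induction "h x" arbitrary: x rule: T.o.lt_induct)
    case less
    have fx: "f x \<in> Field W" "k (f x) \<in> A" using bij less.prems unfolding bij_betw_def by blast+
    have below: "T.olt c (k (f x))" if c: "T.olt c (h x)" "c \<in> A" for c
    proof -
      have r: "rs x c \<in> Field T" "h (rs x c) = c"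
        using T.rs_in[OF less.prems(1) T.o.lt_imp_le[OF c(1)]] by simp_all
      then have IH: "k (f (rs x c)) = c" using less.hyps[of "rs x c"] c by simp
      have "(rs x c, x) \<in> T" using T.rs_le[OF less.prems(1) T.o.lt_imp_le[OF c(1)]] .
      then have W: "(f (rs x c), f x) \<in> W" using iso r c(2) less.prems by simp
      have "rs x c \<noteq> x" using r(2) c(1) T.o.lt_irrefl by metis
      then have ne: "f (rs x c) \<noteq> f x"
        using inj_onD[OF bij_betw_imp_inj_on[OF bij], of "rs x c" x] r c(2) less.prems by auto
      have "f (rs x c) \<in> underS W (f x)" using W ne by (simp add: underS_def)
      then show ?thesis using W.underS_iff IH by simp
    qed
    \<comment> \<open>Since \<open>k (f x)\<close> is itself in \<open>A\<close>, applying
      \<open>below\<close> to it would make it smaller than itself.\<close>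
    have "\<not> T.olt (k (f x)) (h x)" using below[OF _ fx(2)] T.o.lt_irrefl by blast
    \<comment> \<open>Otherwise the node of rank \<open>h x\<close> below \<open>f x\<close> is the
      image of some \<open>x'\<close> strictly below \<open>x\<close>; the induction hypothesis then
      gives that node the rank of \<open>x'\<close>, which is too small.\<close>
    moreover have "\<not> T.olt (h x) (k (f x))"
    proof
      assume hk: "T.olt (h x) (k (f x))"
      let ?w = "qs (f x) (h x)"
      have w: "?w \<in> Field W" "k ?w = h x" using W.rs_in[OF fx(1) T.o.lt_imp_le[OF hk]] by simp_all
      then have "?w \<in> f ` {x \<in> Field T. h x \<in> A}" using bij less.prems unfolding bij_betw_def by simp
      then obtain x' where x': "x' \<in> Field T" "h x' \<in> A" "f x' = ?w" by auto
      have "(?w, f x) \<in> W" using W.rs_le[OF fx(1) T.o.lt_imp_le[OF hk]] .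
      then have "(x', x) \<in> T" using iso x' less.prems by simp
      moreover have "x' \<noteq> x" using x'(3) w(2) hk T.o.lt_irrefl by metis
      ultimately have "x' \<in> underS T x" by (simp add: underS_def)
      then have "T.olt (h x') (h x)" using T.underS_iff by blast
      moreover from this have "k (f x') = h x'" using less.hyps x' by blast
      ultimately show False using x'(3) w(2) T.o.lt_irrefl by metis
    qed
    ultimately show ?case
      using T.o.linear[OF T.h_On[OF less.prems(1)] W.h_On[OF fx(1)]] T.o.lt_iff by blast
  qed
qed

text \<open>Both nodes have rank \<open>c\<close> and lie on the branch up to \<open>f x\<close>,
  where the rank determines the node.\<close>

lemma iso_commutes_restriction:
  assumes T: "ranked_tree \<kappa> T h rs" and U: "ranked_tree \<kappa> W k qs"
    and bij: "bij_betw f {x \<in> Field T. h x \<in> A} {x \<in> Field W. k x \<in> A}"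
    and iso: "\<forall>x\<in>{x \<in> Field T. h x \<in> A}. \<forall>y\<in>{x \<in> Field T. h x \<in> A}. (x, y) \<in> T \<longleftrightarrow> (f x, f y) \<in> W"
    and x: "x \<in> Field T" "h x \<in> A" and c: "c \<in> A" "(c, h x) \<in> cardSuc \<kappa>"
  shows "f (rs x c) = qs (f x) c"
proof -
  interpret T: ranked_tree \<kappa> T h rs by (rule T)
  interpret W: ranked_tree \<kappa> W k qs by (rule U)
  have r: "rs x c \<in> Field T" "h (rs x c) = c" using T.rs_in[OF x(1) c(2)] by simp_all
  have "k (f (rs x c)) = c" using iso_preserves_rank[OF T U bij iso r(1)] r(2) c(1) by simp
  moreover have "(f (rs x c), f x) \<in> W" using iso T.rs_le[OF x(1) c(2)] r x c(1) by simp
  ultimately show ?thesis using W.T_iff by metis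
qed

section \<open>Properties of the trees\<close>

text \<open>The theorem asks for trees on the type of ordinals below \<kappa>^+. Nodes are
  functions, so they are carried over by one injection \<open>\<phi>\<close> common to all trees,
  which lets nodes of different trees be compared.\<close>

locale tree_coding = tree_construction \<kappa> C G q0
  for \<kappa> :: "'a rel" and C G q0 +
  fixes \<phi> :: "'a node \<Rightarrow> 'a set"
  assumes \<phi>: "inj_on \<phi> (kappa_exp.all_nodes \<kappa>)"
begin

definition Tr :: "('a set \<Rightarrow> 'a option) \<Rightarrow> 'a set rel" where
  "Tr \<tau> = {(\<phi> s, \<phi> t) | s t. s \<in> nodes \<tau> \<and> t \<in> nodes \<tau> \<and> s \<subseteq>\<^sub>m t}"

definition node :: "'a set \<Rightarrow> 'a node" where
  "node = inv_into all_nodes \<phi>"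

definition rk :: "'a set \<Rightarrow> 'a set" where
  "rk y = len (node y)"

definition cutat :: "'a set \<Rightarrow> 'a set \<Rightarrow> 'a set" where
  "cutat y c = \<phi> (node y |` U c)"

lemma node_\<phi>: "s \<in> nodes \<tau> \<Longrightarrow> node (\<phi> s) = s"
  unfolding node_def using nodes_sub by (intro inv_into_f_f[OF \<phi>]) blast

lemma \<phi>_eq: "s \<in> nodes \<tau> \<Longrightarrow> t \<in> nodes \<tau>' \<Longrightarrow> \<phi> s = \<phi> t \<longleftrightarrow> s = t"
  using node_\<phi> by metis

lemma Field_Tr: "Field (Tr \<tau>) = \<phi> ` nodes \<tau>"
proof -
  have "(\<phi> s, \<phi> s) \<in> Tr \<tau>" if "s \<in> nodes \<tau>" for s using that map_le_refl unfolding Tr_def by blast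
  then have "\<phi> ` nodes \<tau> \<subseteq> Field (Tr \<tau>)" by (auto intro: FieldI1)
  moreover have "Field (Tr \<tau>) \<subseteq> \<phi> ` nodes \<tau>" unfolding Tr_def by (auto simp: Field_def)
  ultimately show ?thesis by (rule equalityI[rotated])
qed

lemma Tr_iff: "s \<in> nodes \<tau> \<Longrightarrow> t \<in> nodes \<tau> \<Longrightarrow> (\<phi> s, \<phi> t) \<in> Tr \<tau> \<longleftrightarrow> s \<subseteq>\<^sub>m t"
  unfolding Tr_def using \<phi>_eq by auto

lemma cut_node:
  assumes t: "t \<in> nodes \<tau>" and c: "c \<preceq> len t"
  shows "t |` U c \<in> nodes \<tau>" "len (t |` U c) = c"
proof -
  have "t |` U c \<in> L \<tau> c" using L_restrict_le[OF nodesE(2)[OF t] c] .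
  then show "t |` U c \<in> nodes \<tau>" "len (t |` U c) = c"
    using nodesI L_len o.le_fieldL[OF c] by blast+
qed

lemma map_le_iff:
  assumes s: "s \<in> nodes \<tau>" and t: "t \<in> nodes \<tau>"
  shows "s \<subseteq>\<^sub>m t \<longleftrightarrow> len s \<preceq> len t \<and> t |` U (len s) = s"
proof
  assume st: "s \<subseteq>\<^sub>m t"
  have ds: "dom s = U (len s)" "dom t = U (len t)" using L_dom nodesE(2) s t by blast+
  then have "U (len s) \<subseteq> U (len t)" using map_le_implies_dom_le[OF st] by simp
  then have "\<not> len t \<prec> len s" using o.lt_irrefl by blast
  then have "len s \<preceq> len t" using o.not_lt nodesE(1) s t by metis
  moreover have "t |` U (len s) = s" using map_le_restrict[OF st] ds(1) by simp
  ultimately show "len s \<preceq> len t \<and> t |` U (len s) = s" by simp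
next
  assume "len s \<preceq> len t \<and> t |` U (len s) = s"
  then show "s \<subseteq>\<^sub>m t" using restrict_map_le by metis
qed

lemma ranked_Tr: "ranked_tree \<kappa> (Tr \<tau>) rk cutat"
proof
  have F: "\<exists>s. s \<in> nodes \<tau> \<and> y = \<phi> s" if "y \<in> Field (Tr \<tau>)" for y using that Field_Tr by blast
  show "y \<in> Field (Tr \<tau>) \<Longrightarrow> rk y \<in> On" for y
    using F[of y] node_\<phi> nodesE(1) unfolding rk_def by metis
  show "(x, y) \<in> Tr \<tau> \<longleftrightarrow> x \<in> Field (Tr \<tau>) \<and> y \<in> Field (Tr \<tau>) \<and> rk x \<preceq> rk y \<and> cutat y (rk x) = x" for x y
  proof
    assume xy: "(x, y) \<in> Tr \<tau>"
    then obtain s t where st: "x = \<phi> s" "y = \<phi> t" "s \<in> nodes \<tau>" "t \<in> nodes \<tau>" "s \<subseteq>\<^sub>m t"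
      unfolding Tr_def by blast
    then show "x \<in> Field (Tr \<tau>) \<and> y \<in> Field (Tr \<tau>) \<and> rk x \<preceq> rk y \<and> cutat y (rk x) = x"
      using map_le_iff[OF st(3,4)] node_\<phi> xy unfolding rk_def cutat_def by (auto simp: Field_def)
  next
    assume a: "x \<in> Field (Tr \<tau>) \<and> y \<in> Field (Tr \<tau>) \<and> rk x \<preceq> rk y \<and> cutat y (rk x) = x"
    then obtain s t where st: "x = \<phi> s" "y = \<phi> t" "s \<in> nodes \<tau>" "t \<in> nodes \<tau>" using F by blast
    have le: "len s \<preceq> len t" and eq: "\<phi> (t |` U (len s)) = \<phi> s"
      using a st node_\<phi> unfolding rk_def cutat_def by auto
    have "t |` U (len s) = s" using eq \<phi>_eq[OF cut_node(1)[OF st(4) le] st(3)] by blast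
    then show "(x, y) \<in> Tr \<tau>" using st Tr_iff map_le_iff[OF st(3,4)] le by blast
  qed
  fix y assume "y \<in> Field (Tr \<tau>)"
  then obtain t where t: "y = \<phi> t" "t \<in> nodes \<tau>" using F by blast
  have nt: "node y = t" using t node_\<phi> by blast
  show "cutat y (rk y) = y"
    unfolding cutat_def rk_def nt using restrict_dom[OF L_dom[OF nodesE(2)[OF t(2)]]] t(1) by simp
  fix c assume "c \<preceq> rk y"
  then have c: "c \<preceq> len t" unfolding rk_def nt .
  have nc: "node (cutat y c) = t |` U c"
    unfolding cutat_def nt using node_\<phi>[OF cut_node(1)[OF t(2) c]] .
  show "cutat y c \<in> Field (Tr \<tau>) \<and> rk (cutat y c) = c"
  proof
    show "rk (cutat y c) = c" unfolding rk_def nc by (rule cut_node(2)[OF t(2) c])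
    show "cutat y c \<in> Field (Tr \<tau>)"
      unfolding Field_Tr cutat_def nt using cut_node(1)[OF t(2) c] by blast
  qed
  fix c' assume "c' \<preceq> c"
  then show "cutat (cutat y c) c' = cutat y c'"
    unfolding cutat_def[of "cutat y c"] nc unfolding cutat_def nt by (simp only: restrict_U)
qed

sublocale ranked: ranked_tree \<kappa> "Tr \<tau>" rk cutat for \<tau>
  by (rule ranked_Tr)

lemma rk_\<phi>: "s \<in> nodes \<tau> \<Longrightarrow> rk (\<phi> s) = len s"
  unfolding rk_def using node_\<phi> by simp

lemma cutat_\<phi>: "s \<in> nodes \<tau> \<Longrightarrow> cutat (\<phi> s) c = \<phi> (s |` U c)"
  unfolding cutat_def using node_\<phi> by simp

lemma level_Tr: "a \<in> On \<Longrightarrow> {y \<in> Field (Tr \<tau>). rk y = a} = \<phi> ` L \<tau> a"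
proof
  assume a: "a \<in> On"
  show "{y \<in> Field (Tr \<tau>). rk y = a} \<subseteq> \<phi> ` L \<tau> a"
  proof
    fix y assume "y \<in> {y \<in> Field (Tr \<tau>). rk y = a}"
    then obtain s where s: "s \<in> nodes \<tau>" "y = \<phi> s" "rk y = a" unfolding Field_Tr by blast
    then have "s \<in> L \<tau> a" using nodesE(2)[OF s(1)] rk_\<phi>[OF s(1)] by simp
    with s(2) show "y \<in> \<phi> ` L \<tau> a" by (rule image_eqI)
  qed
  show "\<phi> ` L \<tau> a \<subseteq> {y \<in> Field (Tr \<tau>). rk y = a}"
  proof (rule image_subsetI)
    fix s assume s: "s \<in> L \<tau> a"
    have "rk (\<phi> s) = a" using rk_\<phi>[OF nodesI[OF a s]] L_len[OF a s] by (rule trans)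
    then show "\<phi> s \<in> {y \<in> Field (Tr \<tau>). rk y = a}"
      using nodesI[OF a s] unfolding Field_Tr by blast
  qed
qed

lemma underS_Tr:
  assumes s: "s \<in> nodes \<tau>" and t: "t \<in> nodes \<tau>"
  shows "\<phi> s \<in> underS (Tr \<tau>) (\<phi> t) \<longleftrightarrow> s \<subseteq>\<^sub>m t \<and> s \<noteq> t"
  unfolding underS_def using Tr_iff[OF s t] \<phi>_eq[OF s t] by auto

lemma card_tree_Tr: "card_tree \<Omega> (Tr \<tau>)"
proof (rule ranked.card_treeI)
  fix a assume a: "a \<in> On"
  show "\<exists>y\<in>Field (Tr \<tau>). rk y = a" using L_nonempty[OF a, of \<tau>] level_Tr[OF a, of \<tau>] by blast
  show "|{y \<in> Field (Tr \<tau>). rk y = a}| \<le>o \<kappa>" unfolding level_Tr[OF a] by (rule image_le[OF card_L[OF a]])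
qed

lemma complete_Tr: "complete_tree \<kappa> (Tr \<tau>)"
  unfolding complete_tree_def
proof (intro ballI impI)
  fix c assume c: "c \<in> Chains (Tr \<tau>)" and small: "Restr (Tr \<tau>) c <o \<kappa>"
  have ch: "(x, y) \<in> Tr \<tau> \<or> (y, x) \<in> Tr \<tau>" if "x \<in> c" "y \<in> c" for x y
    using c that unfolding Chains_def by blast
  have cF: "c \<subseteq> Field (Tr \<tau>)" using ch by (auto simp: Field_def)
  have "Well_order (Restr (Tr \<tau>) c)" using small unfolding ordLess_def by blast
  then have "|c| <o \<kappa>" using small ordLess_\<kappa> ranked.Field_Restr_T[OF cF] by metis
  then have K: "|node ` c| <o \<kappa>" by (rule image_lt)
  have n: "node x \<in> nodes \<tau> \<and> \<phi> (node x) = x" if "x \<in> c" for x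
    using that cF node_\<phi> unfolding Field_Tr by fastforce
  have "s \<subseteq>\<^sub>m t \<or> t \<subseteq>\<^sub>m s" if st: "s \<in> node ` c" "t \<in> node ` c" for s t
  proof -
    obtain x y where "x \<in> c" "y \<in> c" "s = node x" "t = node y" using st by blast
    then show ?thesis using ch[of x y] n[of x] n[of y] Tr_iff[of s \<tau> t] Tr_iff[of t \<tau> s] by simp
  qed
  moreover have "node ` c \<subseteq> nodes \<tau>" using n by (rule image_subsetI[OF conjunct1])
  ultimately have "\<exists>u\<in>nodes \<tau>. \<forall>s\<in>node ` c. s \<subseteq>\<^sub>m u" using K by (intro chain_bound)
  then obtain u where u: "u \<in> nodes \<tau>" "\<forall>s\<in>node ` c. s \<subseteq>\<^sub>m u" by (elim bexE)
  have "(x, \<phi> u) \<in> Tr \<tau>" if "x \<in> c" for x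
    using n[OF that] u that Tr_iff[of "node x" \<tau> u] by simp
  then show "\<exists>u\<in>Field (Tr \<tau>). \<forall>x\<in>c. (x, u) \<in> Tr \<tau>" using u(1) Field_Tr by blast
qed

lemma normal_Tr: "normal_tree \<Omega> (Tr \<tau>)"
  unfolding normal_tree_def
proof (intro conjI ballI impI)
  fix x c assume "x \<in> Field (Tr \<tau>)" and c: "c \<in> On" "ht \<Omega> (Tr \<tau>) x \<prec> c"
  then obtain s where s: "s \<in> nodes \<tau>" "x = \<phi> s" unfolding Field_Tr by blast
  have sc: "len s \<prec> c" using c(2) ranked.ht_eq rk_\<phi>[OF s(1)] s Field_Tr by force
  obtain p q where p: "bd s p" "p \<sqsubset> q" using L_bd[OF nodesE(2)[OF s(1)]] bd_gt by blast
  obtain t where t: "t \<in> L \<tau> c" "s \<subseteq>\<^sub>m t"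
    using ex_extension[OF o.lt_imp_le[OF sc] nodesE(2)[OF s(1)] p] by metis
  have tn: "t \<in> nodes \<tau>" "len t = c" using nodesI[OF c(1) t(1)] L_len[OF c(1) t(1)] .
  then have "s \<noteq> t" using sc o.lt_irrefl by blast
  then have "\<phi> s \<in> underS (Tr \<tau>) (\<phi> t)" using underS_Tr[OF s(1) tn(1)] t(2) by blast
  moreover have "\<phi> t \<in> level \<Omega> (Tr \<tau>) c"
    unfolding ranked.level_eq level_Tr[OF c(1)] using t(1) by blast
  ultimately show "\<exists>y\<in>level \<Omega> (Tr \<tau>) c. x \<in> underS (Tr \<tau>) y" using s(2) by blast
next
  fix x y assume "x \<in> Field (Tr \<tau>)" "y \<in> Field (Tr \<tau>)"
    and a: "x \<noteq> y \<and> ht \<Omega> (Tr \<tau>) x = ht \<Omega> (Tr \<tau>) y \<and> limit_ordinal \<Omega> (ht \<Omega> (Tr \<tau>) x)"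
  then obtain s t where s: "s \<in> nodes \<tau>" "x = \<phi> s" and t: "t \<in> nodes \<tau>" "y = \<phi> t"
    unfolding Field_Tr by blast
  have "ht \<Omega> (Tr \<tau>) x = len s" "ht \<Omega> (Tr \<tau>) y = len t"
    using ranked.ht_eq rk_\<phi> s t Field_Tr by force+
  then have l: "len s = len t" "limit_ordinal \<Omega> (len s)" using a by metis+
  show "underS (Tr \<tau>) x \<noteq> underS (Tr \<tau>) y"
  proof
    assume eq: "underS (Tr \<tau>) x = underS (Tr \<tau>) y"
    have "s z = t z" for z
    proof (cases "z \<prec> len s")
      case True
      then obtain c where c: "z \<prec> c" "c \<prec> len s" using l(2) unfolding limit_ordinal_def by blast
      have cle: "c \<preceq> len s" using o.lt_imp_le[OF c(2)] .
      have "cutat x c \<in> underS (Tr \<tau>) x" "cutat y c \<in> underS (Tr \<tau>) y"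
        using ranked.underS_T[of x \<tau>] ranked.underS_T[of y \<tau>] c(2) l(1) s t rk_\<phi> Field_Tr by force+
      then have "cutat x c \<in> underS (Tr \<tau>) y" using eq by simp
      then have "cutat x c = cutat y (rk (cutat x c))" unfolding ranked.underS_iff by simp
      also have "rk (cutat x c) = c"
        unfolding s(2) cutat_\<phi>[OF s(1)] using cut_node[OF s(1) cle] rk_\<phi> by simp
      finally have "\<phi> (s |` U c) = \<phi> (t |` U c)" unfolding s(2) t(2) cutat_\<phi>[OF s(1)] cutat_\<phi>[OF t(1)] .
      then have "s |` U c = t |` U c"
        using \<phi>_eq[OF cut_node(1)[OF s(1) cle] cut_node(1)[OF t(1), of c]] cle l(1) by metis
      from fun_cong[OF this, of z] show ?thesis using c(1) by simp
    next
      case False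
      then have "z \<notin> dom s" "z \<notin> dom t" using L_dom[OF nodesE(2)] s(1) t(1) l(1) by auto
      then show ?thesis by (simp add: domIff)
    qed
    then have "s = t" by (rule ext)
    then show False using a s t by simp
  qed
next
  fix x assume "x \<in> Field (Tr \<tau>)"
  then obtain s where s: "s \<in> nodes \<tau>" "x = \<phi> s" unfolding Field_Tr by blast
  note n = nodesE[OF s(1)]
  obtain p where p: "bd s p" using L_bd[OF n(2)] by blast
  obtain v where v: "p \<sqsubset> v" using bd_gt[OF p] by blast
  \<comment> \<open>The distinct rationals \<open>v\<close> and \<open>sc v\<close>, both above the
    bound \<open>p\<close>, give two incomparable immediate successors of \<open>s\<close>.\<close>
  have w: "p \<sqsubset> sc v" "v \<noteq> sc v"
    using lt_sc[OF q_fieldR[OF v]] q.lt_trans[OF v] q.lt_irrefl by metis+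
  obtain S where S: "S \<in> On" "U S = under \<Omega> (len s)" using ex_suc[OF n(1)] by metis
  note y = L_suc[OF n(2) p v S n(1)] and z = L_suc[OF n(2) p w(1) S n(1)]
  let ?y = "s(len s \<mapsto> v)" and ?z = "s(len s \<mapsto> sc v)"
  have yn: "?y \<in> nodes \<tau>" "?z \<in> nodes \<tau>" using nodesI[OF S(1)] y(1) z(1) by blast+
  have "len s \<notin> dom s" using L_dom[OF n(2)] o.lt_irrefl by simp
  then have ne: "s \<noteq> ?y" "s \<noteq> ?z" by (metis domI fun_upd_same)+
  have "?y (len s) \<noteq> ?z (len s)" using w(2) by simp
  then have "\<not> ?y \<subseteq>\<^sub>m ?z" "\<not> ?z \<subseteq>\<^sub>m ?y" unfolding map_le_def by (metis domI fun_upd_same)+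
  then have "(\<phi> ?y, \<phi> ?z) \<notin> Tr \<tau>" "(\<phi> ?z, \<phi> ?y) \<notin> Tr \<tau>"
    using Tr_iff[OF yn] Tr_iff[OF yn(2,1)] by simp_all
  moreover have "\<phi> s \<in> underS (Tr \<tau>) (\<phi> ?y)" "\<phi> s \<in> underS (Tr \<tau>) (\<phi> ?z)"
    unfolding underS_Tr[OF s(1) yn(1)] underS_Tr[OF s(1) yn(2)] using y(3) z(3) ne by (simp_all only: simp_thms not_False_eq_True)
  ultimately show "\<exists>y z. x \<in> underS (Tr \<tau>) y \<and> x \<in> underS (Tr \<tau>) z \<and> (y, z) \<notin> Tr \<tau> \<and> (z, y) \<notin> Tr \<tau>"
    unfolding s(2) by (intro exI[of _ "\<phi> ?y"] exI[of _ "\<phi> ?z"] conjI)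
qed

text \<open>A cofinal branch would put together a strictly increasing map from \<kappa>^+ into
  \<open>Q\<close>, a set of size at most \<kappa>.\<close>

lemma aronszajn_Tr: "aronszajn \<Omega> (Tr \<tau>)"
  unfolding aronszajn_def
proof (intro conjI notI card_tree_Tr)
  assume "\<exists>b. branch (Tr \<tau>) b \<and> (\<forall>a\<in>On. b \<inter> level \<Omega> (Tr \<tau>) a \<noteq> {})"
  then obtain b where b: "b \<in> Chains (Tr \<tau>)" "\<forall>a\<in>On. b \<inter> level \<Omega> (Tr \<tau>) a \<noteq> {}"
    unfolding branch_def by blast
  have "\<exists>t. t \<in> L \<tau> a \<and> \<phi> t \<in> b" if "a \<in> On" for a
  proof -
    have "b \<inter> \<phi> ` L \<tau> a \<noteq> {}" using b(2) that unfolding ranked.level_eq by (metis level_Tr[OF that])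
    then obtain y where "y \<in> b" "y \<in> \<phi> ` L \<tau> a" by (metis IntD1 IntD2 ex_in_conv)
    then show ?thesis by (elim imageE) blast
  qed
  then obtain t where t: "\<And>a. a \<in> On \<Longrightarrow> t a \<in> L \<tau> a \<and> \<phi> (t a) \<in> b" by metis
  have mono: "t a \<subseteq>\<^sub>m t c" if ac: "a \<in> On" "c \<in> On" "a \<preceq> c" for a c
  proof -
    have n: "t a \<in> nodes \<tau>" "t c \<in> nodes \<tau>" "len (t a) = a" "len (t c) = c"
      using nodesI L_len t ac by blast+
    have "(\<phi> (t a), \<phi> (t c)) \<in> Tr \<tau> \<or> (\<phi> (t c), \<phi> (t a)) \<in> Tr \<tau>"
      using b(1) t ac unfolding Chains_def by blast
    then have "t a \<subseteq>\<^sub>m t c \<or> t c \<subseteq>\<^sub>m t a" using Tr_iff n by blast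
    moreover have "t a = t c" if "t c \<subseteq>\<^sub>m t a"
    proof -
      have "a = c" using map_le_iff[OF n(2,1)] that n ac(3) o.le_antisym by simp
      then show ?thesis by simp
    qed
    ultimately show ?thesis using map_le_refl by metis
  qed
  have "\<exists>S. S \<in> On \<and> U S = under \<Omega> a" if "a \<in> On" for a using ex_suc[OF that] by metis
  then obtain S where S: "\<And>a. a \<in> On \<Longrightarrow> S a \<in> On \<and> U (S a) = under \<Omega> a" by metis
  \<comment> \<open>A node of level \<open>a\<close> has no value at \<open>a\<close> yet; the
    branch takes that value at the successor level \<open>S a\<close>.\<close>
  define g where "g a = the (t (S a) a)" for a
  have lt: "g a \<sqsubset> g c" if ac: "a \<prec> c" for a c
  proof -
    have f: "a \<in> On" "c \<in> On" using o.lt_fieldL[OF ac] o.lt_fieldR[OF ac] .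
    have dc: "dom (t (S c)) = under \<Omega> c" "dom (t (S a)) = under \<Omega> a"
      using L_dom t S f by metis+
    have aS: "a \<in> dom (t (S a))" and cS: "c \<in> dom (t (S c))"
      unfolding dc using o.le_refl f by (simp_all add: under_def)
    have "S a \<preceq> c" using under_le_U[OF ac] S f by blast
    moreover have "c \<prec> S c" using S f under_iff by blast
    ultimately have "S a \<preceq> S c" using o.le_trans o.lt_imp_le by blast
    then have "t (S a) \<subseteq>\<^sub>m t (S c)" using mono S f by blast
    then have eq: "t (S a) a = t (S c) a" using aS unfolding map_le_def by blast
    then have a': "g a \<in> ran (t (S c) |` U c)"
    proof -
      have "t (S a) a = Some (g a)" using aS unfolding g_def by (simp add: domIff)
      then have "(t (S c) |` U c) a = Some (g a)" using eq ac by simp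
      then show ?thesis by (rule ranI)
    qed
    have "good (t (S c))" using L_good t S f by blast
    then obtain p where "bd (t (S c) |` U c) p" "p \<sqsubset> the (t (S c) c)"
      using cS unfolding good_def by blast
    then show ?thesis using a' q.le_lt_trans unfolding bd_def g_def by blast
  qed
  have "inj_on g On"
  proof (rule inj_onI, rule ccontr)
    fix a c assume "a \<in> On" "c \<in> On" "g a = g c" "a \<noteq> c"
    moreover from this have "a \<prec> c \<or> c \<prec> a" using o.linear o.lt_iff by blast
    ultimately show False using lt[of a c] lt[of c a] q.lt_irrefl by auto
  qed
  moreover have "g ` On \<subseteq> Q"
  proof
    fix v assume "v \<in> g ` On"
    then obtain a where a: "a \<in> On" "v = g a" by blast
    obtain c where "a \<prec> c" using On_limit[OF a(1)] by blast
    then show "v \<in> Q" using lt q_fieldL a(2) by blast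
  qed
  ultimately have "|On| \<le>o \<kappa>" using card_Q by (rule inj_le)
  then show False
    using not_le_\<kappa> ordIso_imp_ordLeq[OF ordIso_symmetric[OF card_of_Field_ordIso[OF card_\<Omega>]]] by blast
qed

text \<open>A node is sent to the cut formed by its values and \<open>q0\<close>. A bound of the
  node keeps the cut proper, and the rational required by \<open>good\<close> at position
  \<open>len s\<close> belongs to the cut of \<open>t\<close> but not to that of
  \<open>s\<close>.\<close>

lemma embeddable_Tr: "embeddable_tree (Tr \<tau>) (R_order \<kappa>)"
proof -
  define e where "e s = {q. \<exists>v\<in>insert q0 (ran s). q \<sqsubset> v}" for s :: "'a node"
  have cut: "e s \<in> dedekind_cuts (Q_order \<kappa>)" if s: "s \<in> nodes \<tau>" for s
  proof -
    obtain p where p: "bd s p" using L_bd[OF nodesE(2)[OF s]] by blast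
    have "\<not> p \<sqsubset> v" if "v \<in> insert q0 (ran s)" for v
      using p that q.lt_not_le unfolding bd_def by blast
    then have "p \<notin> e s" unfolding e_def by blast
    then have 1: "e s \<noteq> Q" using bd_Q[OF p] by blast
    have 2: "e s \<noteq> {}" using Q_no_least[OF q0] unfolding e_def by blast
    have 3: "e s \<subseteq> Q" using q_fieldL unfolding e_def by blast
    have 4: "underS (Q_order \<kappa>) a \<subseteq> e s" if "a \<in> e s" for a using that q.lt_trans unfolding e_def by blast
    have 5: "\<exists>b\<in>e s. a \<sqsubset> b" if "a \<in> e s" for a using that Q_dense unfolding e_def by blast
    show ?thesis unfolding dedekind_cuts_def Field_Q using 1 2 3 4 5 by simp
  qed
  have lt: "e s \<subset> e t" if s: "s \<in> nodes \<tau>" and t: "t \<in> nodes \<tau>" and st: "s \<subseteq>\<^sub>m t" "s \<noteq> t" for s t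
  proof -
    have l: "len s \<preceq> len t" "t |` U (len s) = s" using map_le_iff[OF s t] st(1) by simp_all
    have "len s \<noteq> len t" using l(2) st(2) restrict_dom[OF L_dom[OF nodesE(2)[OF t]]] by metis
    then have "len s \<prec> len t" using l(1) by (simp add: o.lt_iff)
    then have d: "len s \<in> dom t" using L_dom[OF nodesE(2)[OF t]] by simp
    then obtain p where p: "bd s p" "p \<sqsubset> the (t (len s))"
      using L_good[OF nodesE(2)[OF t]] l(2) unfolding good_def by metis
    have "the (t (len s)) \<in> ran t" using d by (auto simp: ran_def)
    then have "p \<in> e t" using p(2) unfolding e_def by blast
    moreover have "p \<notin> e s" using p(1) q.lt_not_le unfolding e_def bd_def by blast
    moreover have "ran s \<subseteq> ran t"    proof
      fix v assume "v \<in> ran s"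
      then obtain x where x: "s x = Some v" by (auto simp: ran_def)
      then have "t x = Some v" using st(1) by (auto simp: map_le_def dom_def)
      then show "v \<in> ran t" by (rule ranI)
    qed
    then have "e s \<subseteq> e t" unfolding e_def by blast
    ultimately show ?thesis by blast
  qed
  have R: "(A, B) \<in> R_order \<kappa> \<longleftrightarrow> A \<in> dedekind_cuts (Q_order \<kappa>) \<and> B \<in> dedekind_cuts (Q_order \<kappa>) \<and> A \<subseteq> B" for A B
    unfolding R_order_def dedekind_completion_def by simp
  show ?thesis
    unfolding embeddable_tree_def
  proof (intro exI[of _ "\<lambda>y. e (node y)"] conjI allI impI)
    show "(\<lambda>y. e (node y)) ` Field (Tr \<tau>) \<subseteq> Field (R_order \<kappa>)"
    proof
      fix A assume "A \<in> (\<lambda>y. e (node y)) ` Field (Tr \<tau>)"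
      then obtain s where s: "s \<in> nodes \<tau>" "A = e s" unfolding Field_Tr using node_\<phi> by auto
      have "(A, A) \<in> R_order \<kappa>" unfolding R s(2) using cut[OF s(1)] by simp
      then show "A \<in> Field (R_order \<kappa>)" by (rule FieldI1)
    qed
    fix x y assume xy: "x \<in> underS (Tr \<tau>) y"
    then have "x \<in> Field (Tr \<tau>)" "y \<in> Field (Tr \<tau>)" by (auto simp: underS_def Field_def)
    then obtain s t where st: "s \<in> nodes \<tau>" "t \<in> nodes \<tau>" "x = \<phi> s" "y = \<phi> t" unfolding Field_Tr by blast
    have "e s \<subset> e t" using lt[OF st(1,2)] underS_Tr[OF st(1,2)] xy st(3,4) by simp
    then show "e (node x) \<in> underS (R_order \<kappa>) (e (node y))"
      unfolding st(3,4) node_\<phi>[OF st(1)] node_\<phi>[OF st(2)] underS_def using R cut st(1,2) by auto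
  qed
qed

end

section \<open>Far trees\<close>

text \<open>Ranking a pair by its first component suffices, since the pairs of a coded isomorphism
  have equal lengths.\<close>

definition guess_rank :: "('n \<Rightarrow> 'o) \<Rightarrow> 'n \<times> 'n + 'n \<Rightarrow> 'o" where
  "guess_rank l z = (case z of Inl (y, _) \<Rightarrow> l y | Inr t \<Rightarrow> l t)"

locale far_coding = tree_coding +
  assumes guess: "\<And>Z F. Z \<subseteq> all_nodes \<times> all_nodes <+> all_nodes \<Longrightarrow>
      (\<forall>e\<in>On. |{z \<in> Z. guess_rank len z \<prec> e}| \<le>o \<kappa>) \<Longrightarrow> (\<forall>a\<in>On. F a \<in> On) \<Longrightarrow>
      \<exists>i\<in>Field \<kappa>. \<forall>a\<in>On. \<exists>b. a \<prec> b \<and> closed_under F b \<and> b \<notin> cof_set \<Omega> \<kappa> \<and>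
        G b i = {z \<in> Z. guess_rank len z \<prec> b}"
    and box: "\<And>X S. unbounded_in \<Omega> X \<Longrightarrow> S \<in> NS_plus_restr \<Omega> (cof_set \<Omega> \<kappa>) \<Longrightarrow>
      stationary \<Omega> {d \<in> S. unbounded_in (seg \<Omega> d) ((C d \<inter> X) - lim_points \<Omega> (C d))}"
begin

text \<open>Two incompatible extensions of the same node at a level where the isomorphism is already known
  cannot both be captured, as they would have the same image.\<close>

lemma ex_not_captured:
  assumes b: "b \<notin> cof_set \<Omega> \<kappa>" and c: "c \<prec> b"
    and W: "Z = Inl ` {(y, z). y \<in> nodes \<tau> \<and> z \<in> nodes \<tau>' \<and> R y z \<and> len y \<prec> b} \<union> Inr ` below \<tau>' b"
    and R_len: "\<And>y z. y \<in> nodes \<tau> \<Longrightarrow> z \<in> nodes \<tau>' \<Longrightarrow> R y z \<Longrightarrow> len z = len y"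
    and R_restr: "\<And>y z e. y \<in> nodes \<tau> \<Longrightarrow> z \<in> nodes \<tau>' \<Longrightarrow> R y z \<Longrightarrow> e \<in> A \<Longrightarrow> e \<preceq> len y \<Longrightarrow>
        R (y |` U e) (z |` U e)"
    and R_inj: "\<And>y y' z z'. y \<in> nodes \<tau> \<Longrightarrow> y' \<in> nodes \<tau> \<Longrightarrow> z \<in> nodes \<tau>' \<Longrightarrow> z' \<in> nodes \<tau>' \<Longrightarrow>
        R y z \<Longrightarrow> R y' z' \<Longrightarrow> y = y' \<longleftrightarrow> z = z'"
    and A: "\<And>x. x \<prec> b \<Longrightarrow> \<exists>e\<in>A. x \<prec> e \<and> e \<prec> b"
    and S: "S \<in> On" "U S = under \<Omega> c" and u: "u \<in> L \<tau> S"
  shows "\<exists>y. y \<in> ext (L \<tau> b) c u \<and> \<not> captured Z c b y"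
proof (rule ccontr)
  assume "\<not> ?thesis"
  then have cap: "captured Z c b y" if "y \<in> ext (L \<tau> b) c u" for y using that by blast
  let ?v = "the (u c)"
  have bOn: "b \<in> On" using o.lt_fieldR[OF c] .
  have uv: "bd u ?v" "?v \<in> Q"
    using good_bd_last[OF L_good[OF u] _ o.lt_fieldL[OF c]] L_dom[OF u] S(2) by simp_all
  \<comment> \<open>The two extensions are to agree below \<open>c1\<close> and to differ at
    \<open>c1\<close>; restriction to \<open>U c2\<close> then shows the difference. Both levels lie
    in \<open>A\<close>, where the isomorphism can be applied.\<close>
  obtain c1 where c1: "c1 \<in> A" "c \<prec> c1" "c1 \<prec> b" using A[OF c] by blast
  obtain c2 where c2: "c2 \<in> A" "c1 \<prec> c2" "c2 \<prec> b" using A[OF c1(3)] by blast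
  have c1On: "c1 \<in> On" using o.lt_fieldL[OF c1(3)] .
  \<comment> \<open>\<open>v1\<close> bounds the common part below \<open>c1\<close>, and
    \<open>v2\<close>, \<open>v3\<close> are the competing values at \<open>c1\<close>. All stay
    below \<open>sc ?v\<close>, so both results qualify for \<open>ext\<close>.\<close>
  obtain v1 where v1: "?v \<sqsubset> v1" "v1 \<sqsubset> sc ?v" using Q_dense[OF lt_sc[OF uv(2)]] by blast
  obtain v2 where v2: "v1 \<sqsubset> v2" "v2 \<sqsubset> sc ?v" using Q_dense[OF v1(2)] by blast
  obtain v3 where v3: "v2 \<sqsubset> v3" "v3 \<sqsubset> sc ?v" using Q_dense[OF v2(2)] by blast
  have v13: "v1 \<sqsubset> v3" using q.lt_trans[OF v2(1) v3(1)] .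
  obtain x where x: "x \<in> L \<tau> c1" "u \<subseteq>\<^sub>m x" "bd x v1"
    using ex_extension[OF under_le_U[OF c1(2) S(2,1)] u uv(1) v1(1)] by metis
  obtain S1 where S1: "S1 \<in> On" "U S1 = under \<Omega> c1" using ex_suc[OF c1On] by metis
  have S1b: "S1 \<preceq> b" using under_le_U[OF c1(3) S1(2,1)] .
  have side: "\<exists>y z. y \<in> L \<tau> b \<and> x \<subseteq>\<^sub>m y \<and> y c1 = Some v \<and> dom z = U b \<and>
      z = can (L \<tau>' b) c (z |` under \<Omega> c) \<and> x = y |` U c1 \<and>
      R (y |` U c1) (z |` U c1) \<and> R (y |` U c2) (z |` U c2) \<and> z |` U c1 \<in> nodes \<tau>' \<and> z |` U c2 \<in> nodes \<tau>'"
    if v: "v1 \<sqsubset> v" "v \<sqsubset> sc ?v" for v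
  proof -
    note w = L_suc[OF x(1,3) v(1) S1 c1On]
    obtain y where y: "y \<in> L \<tau> b" "x(c1 \<mapsto> v) \<subseteq>\<^sub>m y" "bd y (sc ?v)"
      using ex_extension[OF S1b w(1,2) v(2)] by metis
    have xy: "x \<subseteq>\<^sub>m y" using map_le_trans[OF w(3) y(2)] .
    have yc1: "y c1 = Some v" using y(2) unfolding map_le_def by (metis domI fun_upd_same)
    have "y \<in> ext (L \<tau> b) c u" unfolding ext_def using y(1,3) map_le_trans[OF x(2) xy] by simp
    from cap[OF this] obtain z where z: "dom z = U b" "z = can (hat b {t. Inr t \<in> Z}) c (z |` under \<Omega> c)"
      "\<forall>x. x \<prec> b \<longrightarrow> (\<exists>e. x \<prec> e \<and> e \<prec> b \<and> Inl (y |` U e, z |` U e) \<in> Z)"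
      unfolding captured_def by blast
    \<comment> \<open>As \<open>b\<close> does not have cofinality \<kappa>, the \<open>hat\<close>
      of the guessed lower part is the true level \<open>b\<close> of the second tree, and the guess
      evaluates canonical extensions there correctly.\<close>
    have "{t. Inr t \<in> Z} = below \<tau>' b" unfolding W by auto
    then have z2: "z = can (L \<tau>' b) c (z |` under \<Omega> c)" using z(2) L_not_cof[OF b, of \<tau>'] by simp
    obtain e where e: "c2 \<prec> e" "e \<prec> b" "Inl (y |` U e, z |` U e) \<in> Z" using z(3) c2(3) by blast
    have n: "y |` U e \<in> nodes \<tau>" "z |` U e \<in> nodes \<tau>'" "R (y |` U e) (z |` U e)"
      using e(3) unfolding W by auto
    have len: "len (y |` U e) = e"
      using L_len[OF o.lt_fieldL[OF e(2)] L_restrict[OF y(1) e(2)]] .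
    then have lenz: "len (z |` U e) = e" using R_len[OF n] by simp
    have RR: "R (y |` U e') (z |` U e') \<and> z |` U e' \<in> nodes \<tau>'" if "e' \<in> A" "e' \<prec> e" for e'
    proof -
      have le: "e' \<preceq> e" using o.lt_imp_le[OF that(2)] .
      have "R ((y |` U e) |` U e') ((z |` U e) |` U e')" using R_restr[OF n that(1)] le len by simp
      moreover have "(z |` U e) |` U e' \<in> nodes \<tau>'" using cut_node(1)[OF n(2)] le lenz by simp
      ultimately show ?thesis unfolding restrict_U[OF le] by simp
    qed
    have "y |` dom x = x" using map_le_restrict[OF xy] .
    then have "x = y |` U c1" using L_dom[OF x(1)] by simp
    then show ?thesis
      using y(1) xy yc1 z(1) z2 RR[OF c1(1) o.lt_trans[OF c2(2) e(1)]] RR[OF c2(1) e(1)] by blast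
  qed
  obtain y z where y: "y \<in> L \<tau> b" "y c1 = Some v2" "z = can (L \<tau>' b) c (z |` under \<Omega> c)"
    "x = y |` U c1" "R (y |` U c1) (z |` U c1)" "R (y |` U c2) (z |` U c2)"
    "z |` U c1 \<in> nodes \<tau>'" "z |` U c2 \<in> nodes \<tau>'"
    using side[OF v2] by blast
  obtain y' z' where y': "y' \<in> L \<tau> b" "y' c1 = Some v3" "z' = can (L \<tau>' b) c (z' |` under \<Omega> c)"
    "x = y' |` U c1" "R (y' |` U c1) (z' |` U c1)" "R (y' |` U c2) (z' |` U c2)"
    "z' |` U c1 \<in> nodes \<tau>'" "z' |` U c2 \<in> nodes \<tau>'"
    using side[OF v13 v3(2)] by blast
  have yn: "y |` U e \<in> nodes \<tau>" "y' |` U e \<in> nodes \<tau>" if "e \<prec> b" for e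
    using nodesI[OF o.lt_fieldL[OF that] L_restrict[OF y(1) that]]
      nodesI[OF o.lt_fieldL[OF that] L_restrict[OF y'(1) that]] .
  \<comment> \<open>The two branches coincide below \<open>c1\<close>, so their images do as well,
    in particular on \<open>under \<Omega> c\<close>. Being canonical over the same node, the images
    are then equal, and injectivity at \<open>c2\<close> contradicts the different values at
    \<open>c1\<close>.\<close>
  have "z |` U c1 = z' |` U c1"
    using R_inj[OF yn[OF c1(3)] y(7) y'(7) y(5) y'(5)] y(4) y'(4) by simp
  then have "(z |` U c1) |` under \<Omega> c = (z' |` U c1) |` under \<Omega> c" by simp
  then have "z |` under \<Omega> c = z' |` under \<Omega> c" unfolding restrict_under_U[OF c1(2)] .
  then have "z = z'" using y(3) y'(3) by metis
  then have "y |` U c2 = y' |` U c2" using R_inj[OF yn[OF c2(3)] y(8) y'(8) y(6) y'(6)] by simp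
  from fun_cong[OF this, of c1] have "y c1 = y' c1" using c2(2) by simp
  then show False using y(2) y'(2) v3(1) q.lt_irrefl by simp
qed

text \<open>All indices \<open>i\<close> have to be covered, because the index that guesses
  correctly is known only after an isomorphism has been given. The roles of the two trees are
  asymmetric: the first diverts, the second stays canonical.\<close>

lemma far_if:
  assumes S: "\<And>i. i \<in> Field \<kappa> \<Longrightarrow> \<exists>S. S \<in> NS_plus_restr \<Omega> (cof_set \<Omega> \<kappa>) \<and>
      (\<forall>d\<in>S. \<tau> d = Some i \<and> \<tau>' d = None)"
  shows "far \<Omega> (Tr \<tau>) (Tr \<tau>')"
proof
  assume "near \<Omega> (Tr \<tau>) (Tr \<tau>')"
  then obtain X Y A where X: "downward_closed (Tr \<tau>) X" and Y: "downward_closed (Tr \<tau>') Y"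
    and tX: "card_tree \<Omega> (Restr (Tr \<tau>) X)"
    and A: "club \<Omega> A"
    and iso: "order_isomorphic (tree_restr \<Omega> (Restr (Tr \<tau>) X) A) (tree_restr \<Omega> (Restr (Tr \<tau>') Y) A)"
    unfolding near_def club_isomorphic_def by blast
  note rX = ranked.ranked_Restr[OF X] and rY = ranked.ranked_Restr[OF Y]
  interpret X: ranked_tree \<kappa> "Restr (Tr \<tau>) X" rk cutat by (rule rX)
  interpret Y: ranked_tree \<kappa> "Restr (Tr \<tau>') Y" rk cutat by (rule rY)
  have XF: "X \<subseteq> Field (Tr \<tau>)" and YF: "Y \<subseteq> Field (Tr \<tau>')"
    using X Y unfolding downward_closed_def by blast+
  have FX: "Field (Restr (Tr \<tau>) X) = X" and FY: "Field (Restr (Tr \<tau>') Y) = Y"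
    using ranked.Field_Restr_T XF YF by blast+
  let ?X = "{x \<in> Field (Restr (Tr \<tau>) X). rk x \<in> A}" and ?Y = "{x \<in> Field (Restr (Tr \<tau>') Y). rk x \<in> A}"
  have F1: "Field (Restr (Restr (Tr \<tau>) X) ?X) = ?X" by (rule X.Field_Restr_T) blast
  have F2: "Field (Restr (Restr (Tr \<tau>') Y) ?Y) = ?Y" by (rule Y.Field_Restr_T) blast
  obtain f where bij: "bij_betw f ?X ?Y"
    and f: "\<forall>x\<in>?X. \<forall>y\<in>?X. (x, y) \<in> Restr (Restr (Tr \<tau>) X) ?X \<longleftrightarrow> (f x, f y) \<in> Restr (Restr (Tr \<tau>') Y) ?Y"
    using iso unfolding order_isomorphic_def X.tree_restr_eq Y.tree_restr_eq F1 F2 by blast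
  have f: "\<forall>x\<in>?X. \<forall>y\<in>?X. (x, y) \<in> Restr (Tr \<tau>) X \<longleftrightarrow> (f x, f y) \<in> Restr (Tr \<tau>') Y"
  proof (intro ballI)
    fix x y assume xy: "x \<in> ?X" "y \<in> ?X"
    then have "f x \<in> ?Y" "f y \<in> ?Y" using bij unfolding bij_betw_def by blast+
    then show "(x, y) \<in> Restr (Tr \<tau>) X \<longleftrightarrow> (f x, f y) \<in> Restr (Tr \<tau>') Y"
      using bspec[OF bspec[OF f xy(1)] xy(2)] xy by (simp only: Int_iff mem_Sigma_iff simp_thms)
  qed
  note pres = iso_preserves_rank[OF rX rY bij f] and comm = iso_commutes_restriction[OF rX rY bij f]
  have fY: "f x \<in> Y" if "x \<in> X" "rk x \<in> A" for x
    using bij that unfolding bij_betw_def FX FY by blast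
  define R where "R s t \<longleftrightarrow> \<phi> s \<in> X \<and> rk (\<phi> s) \<in> A \<and> f (\<phi> s) = \<phi> t" for s t
  have R_len: "len t = len s" if "s \<in> nodes \<tau>" "t \<in> nodes \<tau>'" "R s t" for s t
    using pres[of "\<phi> s"] that rk_\<phi>[OF that(1)] rk_\<phi>[OF that(2)] unfolding R_def FX by simp
  have R_restr: "R (s |` U e) (t |` U e)"
    if "s \<in> nodes \<tau>" "t \<in> nodes \<tau>'" "R s t" "e \<in> A" "e \<preceq> len s" for s t e
  proof -
    have "cutat (\<phi> s) e \<in> X \<and> rk (cutat (\<phi> s) e) = e"
      using X.rs_in[of "\<phi> s" e] that rk_\<phi>[OF that(1)] unfolding R_def FX by simp
    moreover have "f (cutat (\<phi> s) e) = cutat (\<phi> t) e"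
      using comm[of "\<phi> s" e] that rk_\<phi>[OF that(1)] unfolding R_def FX by simp
    ultimately show ?thesis
      using that(4) unfolding R_def cutat_\<phi>[OF that(1)] cutat_\<phi>[OF that(2)] by simp
  qed
  have R_inj: "s = s' \<longleftrightarrow> t = t'"
    if "s \<in> nodes \<tau>" "s' \<in> nodes \<tau>" "t \<in> nodes \<tau>'" "t' \<in> nodes \<tau>'" "R s t" "R s' t'" for s s' t t'
  proof -
    have "\<phi> s \<in> ?X" "\<phi> s' \<in> ?X" using that(5,6) unfolding R_def FX by simp_all
    then have "\<phi> s = \<phi> s' \<longleftrightarrow> f (\<phi> s) = f (\<phi> s')"
      using inj_on_eq_iff[OF bij_betw_imp_inj_on[OF bij]] by blast
    then show ?thesis
      using that(5,6) \<phi>_eq[OF that(1,2)] \<phi>_eq[OF that(3,4)] unfolding R_def by simp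
  qed
  \<comment> \<open>The object to be guessed contains the second tree besides the isomorphism, since
    deciding whether an image is canonical requires the next level of that tree.\<close>
  define Z where "Z = Inl ` {(s, t). s \<in> nodes \<tau> \<and> t \<in> nodes \<tau>' \<and> R s t} \<union> Inr ` nodes \<tau>'"
  have Z_below: "{z \<in> Z. guess_rank len z \<prec> e}
      = Inl ` {(s, t). s \<in> nodes \<tau> \<and> t \<in> nodes \<tau>' \<and> R s t \<and> len s \<prec> e} \<union> Inr ` below \<tau>' e" for e
    unfolding Z_def guess_rank_def by (auto simp: nodes_below_iff[symmetric])
  have "Z \<subseteq> all_nodes \<times> all_nodes <+> all_nodes" unfolding Z_def using nodes_sub by auto
  moreover have "\<forall>e\<in>On. |{z \<in> Z. guess_rank len z \<prec> e}| \<le>o \<kappa>"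
  proof
    fix e
    have "{(s, t). s \<in> nodes \<tau> \<and> t \<in> nodes \<tau>' \<and> R s t \<and> len s \<prec> e} \<subseteq> below \<tau> e \<times> below \<tau>' e"
      using R_len by (auto simp: nodes_below_iff[symmetric])
    then have "|{(s, t). s \<in> nodes \<tau> \<and> t \<in> nodes \<tau>' \<and> R s t \<and> len s \<prec> e}| \<le>o \<kappa>"
      by (rule subset_le) (rule Times_le[OF card_below card_below])
    then show "|{z \<in> Z. guess_rank len z \<prec> e}| \<le>o \<kappa>"
      unfolding Z_below by (intro Un_Cinfinite_bound[OF image_le image_le[OF card_below] cinf])
  qed
  moreover obtain F where F: "\<forall>a\<in>On. F a \<in> On" "\<And>a. a \<in> On \<Longrightarrow> F a \<in> A \<and> a \<prec> F a"
    "\<And>d. closed_under F d \<Longrightarrow> d \<in> A"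
    by (rule clubE[OF A]) (rule that; assumption)
  ultimately obtain i where i: "i \<in> Field \<kappa>" "\<forall>a\<in>On. \<exists>b. a \<prec> b \<and> closed_under F b \<and> b \<notin> cof_set \<Omega> \<kappa> \<and>
      G b i = {z \<in> Z. guess_rank len z \<prec> b}"
    using guess[of Z F] by blast
  \<comment> \<open>Closure under \<open>F\<close> makes \<open>A\<close> cofinal in
    \<open>b\<close>, so the isomorphism is available at levels arbitrarily close to
    \<open>b\<close>.\<close>
  let ?B = "{b. closed_under F b \<and> b \<notin> cof_set \<Omega> \<kappa> \<and> G b i = {z \<in> Z. guess_rank len z \<prec> b}}"
  have unb: "unbounded_in \<Omega> ?B"
    unfolding unbounded_in_def
  proof (intro conjI ballI)
    show "?B \<subseteq> On" unfolding closed_under_def by blast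
    fix a assume "a \<in> On"
    then obtain b where "a \<prec> b" "b \<in> ?B" using i(2) by blast
    then show "\<exists>b\<in>?B. a \<preceq> b" using o.lt_imp_le by blast
  qed
  obtain S where S: "S \<in> NS_plus_restr \<Omega> (cof_set \<Omega> \<kappa>)" "\<forall>d\<in>S. \<tau> d = Some i \<and> \<tau>' d = None"
    using assms[OF i(1)] by blast
  \<comment> \<open>Asking that \<open>d\<close> be closed under \<open>F\<close> places it in the
    club \<open>A\<close>, so a node of level \<open>d\<close> has an image at level
    \<open>d\<close>.\<close>
  obtain d where d: "d \<in> S" "unbounded_in (seg \<Omega> d) ((C d \<inter> ?B) - lim_points \<Omega> (C d))" "closed_under F d"
    using stationaryD[OF box[OF unb S(1)] F(1)] by blast
  have dc: "d \<in> cof_set \<Omega> \<kappa>" using S(1) d(1) unfolding NS_plus_restr_def by blast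
  note lim = cof_set_lim[OF dc]
  have dOn: "d \<in> On" and dA: "d \<in> A" using d(3) F(3) unfolding closed_under_def by blast+
  have \<tau>d: "\<tau> d = Some i" "\<tau>' d = None" using S(2) d(1) by blast+
  have "level \<Omega> (Restr (Tr \<tau>) X) d \<noteq> {}" using tX dOn unfolding card_tree_def by blast
  then obtain x where x: "x \<in> X" "rk x = d" unfolding X.level_eq FX by blast
  then obtain s where s: "s \<in> nodes \<tau>" "x = \<phi> s" using XF unfolding Field_Tr by blast
  have "f x \<in> Y" using fY x dA by blast
  then obtain t where t: "t \<in> nodes \<tau>'" "f x = \<phi> t" using YF unfolding Field_Tr by blast
  have st: "R s t" unfolding R_def using x s(2) t(2) dA by simp
  have lens: "len s = d" using x(2) s rk_\<phi> by simp
  then have lent: "len t = d" using R_len[OF s(1) t(1) st] by simp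
  have sL: "s \<in> L \<tau> d" and tL: "t \<in> L \<tau>' d" using nodesE(2) s(1) t(1) lens lent by metis+
  obtain c0 where c0: "c0 \<in> C d" "\<forall>c\<in>C d. c0 \<preceq> c \<longrightarrow>
      s |` U (nxt d c) = step (\<tau> d) (below \<tau> d) c (nxt d c) (s |` under \<Omega> c)"
    using branch_step[OF dc sL] by blast
  obtain c1 where c1: "c1 \<in> C d" "\<forall>c\<in>C d. c1 \<preceq> c \<longrightarrow>
      t |` U (nxt d c) = step (\<tau>' d) (below \<tau>' d) c (nxt d c) (t |` under \<Omega> c)"
    using branch_step[OF dc tL] by blast
  obtain m where m: "m = c0 \<or> m = c1" "c0 \<preceq> m" "c1 \<preceq> m"
    using o.le_maxE[OF C_On[OF lim c0(1)] C_On[OF lim c1(1)]] by metis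
  have mC: "m \<in> C d" using m(1) c0(1) c1(1) by blast
  obtain m' where m': "m' \<in> C d" "m \<prec> m'" using C_strict[OF lim C_lt[OF lim mC]] by blast
  \<comment> \<open>Not being a limit point, \<open>b\<close> ends a gap of \<open>C d\<close>. It
    lies beyond \<open>m\<close>, hence beyond the points where the two branches begin to follow
    their steps; the left end of that gap is found below as the greatest point of \<open>C d\<close>
    up to \<open>a'\<close>.\<close>
  obtain b where b: "b \<in> C d" "b \<in> ?B" "b \<notin> lim_points \<Omega> (C d)" "m' \<preceq> b"
    using d(2) C_lt[OF lim m'(1)] unfolding o.unbounded_in_seg by blast
  have mb: "m \<prec> b" using o.lt_le_trans[OF m'(2) b(4)] .
  obtain a where a: "a \<prec> b" "\<And>c. c \<in> C d \<Longrightarrow> a \<prec> c \<Longrightarrow> \<not> c \<prec> b"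
    using b(3) mb unfolding o.lim_points_iff by blast
  obtain a' where a': "a' = a \<or> a' = m" "a \<preceq> a'" "m \<preceq> a'"
    using o.le_maxE[OF o.lt_fieldL[OF a(1)] o.lt_fieldL[OF mb]] by metis
  have a'b: "a' \<prec> b" using a'(1) a(1) mb by blast
  have bd': "b \<prec> d" using C_lt[OF lim b(1)] .
  obtain c where c: "c \<in> C d" "m \<preceq> c" "c \<preceq> a'" "a' \<prec> nxt d c"
    using C_greatest[OF lim mC a'(3) o.lt_trans[OF a'b bd']] by metis
  note n = nxt[OF lim C_lt[OF lim c(1)]]
  have cb: "c \<prec> b" using o.le_lt_trans[OF c(3) a'b] .
  have nb: "nxt d c = b"
  proof -
    have "nxt d c \<preceq> b" using n(3)[OF b(1) cb] .
    moreover have "\<not> nxt d c \<prec> b" using a(2)[OF n(1)] o.le_lt_trans[OF a'(2) c(4)] by blast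
    ultimately show ?thesis by (simp add: o.lt_iff)
  qed
  have sb: "s |` U b = step (Some i) (below \<tau> d) c b (s |` under \<Omega> c)"
    using c0(2) c(1) o.le_trans[OF m(2) c(2)] unfolding \<tau>d nb[symmetric] by blast
  have tb: "t |` U b = can (L \<tau>' b) c (t |` under \<Omega> c)"
    using c1(2) c(1) o.le_trans[OF m(3) c(2)] lev_below[OF bd', of \<tau>'] unfolding \<tau>d nb[symmetric]
    by (simp add: step_def)
  have bF: "closed_under F b" and bc: "b \<notin> cof_set \<Omega> \<kappa>"
    and Gb: "G b i = Inl ` {(s, t). s \<in> nodes \<tau> \<and> t \<in> nodes \<tau>' \<and> R s t \<and> len s \<prec> b} \<union> Inr ` below \<tau>' b"
    using b(2) Z_below by auto
  have Acof: "\<exists>e\<in>A. x \<prec> e \<and> e \<prec> b" if "x \<prec> b" for x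
    using F(2)[OF o.lt_fieldL[OF that]] bF that unfolding closed_under_def by blast
  obtain S' where S': "S' \<in> On" "U S' = under \<Omega> c" using ex_suc[OF C_On[OF lim c(1)]] by metis
  have "S' \<preceq> d" using under_le_U[OF C_lt[OF lim c(1)] S'(2,1)] .
  then have u: "s |` under \<Omega> c \<in> L \<tau> S'" using L_restrict_le[OF sL] S'(2) by metis
  obtain y where "y \<in> ext (L \<tau> b) c (s |` under \<Omega> c)" "\<not> captured (G b i) c b y"
    using ex_not_captured[OF bc cb Gb R_len R_restr R_inj Acof S' u] by blast
  then have "\<not> captured (G b i) c b (s |` U b)"
    unfolding sb using step_not_captured[of y "below \<tau> d" b c] lev_below[OF bd', of \<tau>] by simp
  \<comment> \<open>The image branch \<open>t\<close> is the witness: it is canonical over the gap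
    because \<open>\<tau>' d\<close> is \<open>None\<close>, and the guess contains the pairs of
    restrictions at levels of \<open>A\<close> cofinal in \<open>b\<close>.\<close>
  moreover have "captured (G b i) c b (s |` U b)"
    unfolding captured_def
  proof (intro exI[of _ "t |` U b"] conjI allI impI)
    show "dom (t |` U b) = U b" using L_dom[OF L_restrict[OF tL bd']] .
    have "{t. Inr t \<in> G b i} = below \<tau>' b" unfolding Gb by auto
    then show "t |` U b = can (hat b {t. Inr t \<in> G b i}) c (t |` U b |` under \<Omega> c)"
      using tb L_not_cof[OF bc, of \<tau>'] unfolding restrict_under_U[OF cb] by simp
    fix x assume "x \<prec> b"
    then obtain e where e: "e \<in> A" "x \<prec> e" "e \<prec> b" using Acof by blast
    have ed: "e \<preceq> d" using o.lt_imp_le[OF o.lt_trans[OF e(3) bd']] .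
    have "R (s |` U e) (t |` U e)" using R_restr[OF s(1) t(1) st e(1)] ed lens by simp
    moreover have "s |` U e \<in> nodes \<tau>" "len (s |` U e) = e" "t |` U e \<in> nodes \<tau>'"
      using cut_node[OF s(1)] cut_node[OF t(1)] ed lens lent by simp_all
    ultimately have "Inl (s |` U e, t |` U e) \<in> G b i" unfolding Gb using e(3) by simp
    then have "Inl (s |` U b |` U e, t |` U b |` U e) \<in> G b i"
      unfolding restrict_U[OF o.lt_imp_le[OF e(3)]] .
    then show "\<exists>e. x \<prec> e \<and> e \<prec> b \<and> Inl (s |` U b |` U e, t |` U b |` U e) \<in> G b i"
      using e(2,3) by blast
  qed
  ultimately show False by blast
qed

text \<open>As no tree is far from itself, farness for distinct codes also shows that the coding is
  injective, which gives the size of the family.\<close>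

lemma near_refl: "near \<Omega> (Tr \<tau>) (Tr \<tau>)"
proof -
  let ?F = "Field (Tr \<tau>)"
  have R: "Restr (Tr \<tau>) ?F = Tr \<tau>" by (rule Restr_Field)
  have "downward_closed (Tr \<tau>) ?F" unfolding downward_closed_def by (auto simp: underS_def Field_def)
  moreover have "club \<Omega> On" unfolding club_def unbounded_in_def lim_points_def using o.le_refl by blast
  moreover have "order_isomorphic T T" for T :: "'a set rel"
    unfolding order_isomorphic_def by (intro exI[of _ id]) simp
  ultimately show ?thesis unfolding near_def club_isomorphic_def using R card_tree_Tr by metis
qed

end

theorem theorem3p1:
  fixes \<kappa> :: "'a rel"
  assumes "Card_order \<kappa>" and "regularCard \<kappa>" and "natLeq <o \<kappa>"
    and "weak_power \<kappa> =o \<kappa>"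
    and "ctwo ^c \<kappa> =o cardSuc \<kappa>"
    and "boxtimes_star \<kappa> (NS_plus_restr (cardSuc \<kappa>) (cof_set (cardSuc \<kappa>) \<kappa>))"
  shows "\<exists>\<T> :: 'a set rel set.
     |\<T>| =o ctwo ^c (cardSuc \<kappa>) \<and>
     (\<forall>T\<in>\<T>. aronszajn (cardSuc \<kappa>) T \<and> normal_tree (cardSuc \<kappa>) T \<and>
        complete_tree \<kappa> T \<and> embeddable_tree T (R_order \<kappa>)) \<and>
     (\<forall>T\<in>\<T>. \<forall>U\<in>\<T>. T \<noteq> U \<longrightarrow> far (cardSuc \<kappa>) T U)"
proof -
  interpret kappa_exp \<kappa> using assms by unfold_locales
  obtain C where C: "\<forall>d\<in>On. club (seg \<Omega> d) (C d) \<and> Restr \<Omega> (C d) \<le>o \<kappa>"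
    and box: "\<forall>X S. unbounded_in \<Omega> X \<and> S \<in> NS_plus_restr \<Omega> (cof_set \<Omega> \<kappa>) \<longrightarrow>
      stationary \<Omega> {d \<in> S. unbounded_in (seg \<Omega> d) ((C d \<inter> X) - lim_points \<Omega> (C d))}"
    using assms(6) unfolding boxtimes_star_def by (elim exE conjE)
  obtain q0 where q0: "q0 \<in> Q" using Q_nonempty by blast
  obtain \<phi> where \<phi>: "inj_on \<phi> all_nodes" "\<phi> ` all_nodes \<subseteq> On"
    using inj_into[OF card_all_nodes card_\<Omega>] by blast
  let ?U = "all_nodes \<times> all_nodes <+> all_nodes"
  have U: "|?U| \<le>o \<Omega>"
    using card_of_Plus_ordLeq_infinite_Field[OF inf_\<Omega>
        Times_le_\<Omega>[OF card_all_nodes card_all_nodes] card_all_nodes card_\<Omega>] .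
  obtain G where G: "\<forall>Z F. Z \<subseteq> ?U \<longrightarrow> (\<forall>e\<in>On. |{z \<in> Z. guess_rank len z \<prec> e}| \<le>o \<kappa>) \<longrightarrow>
    (\<forall>a\<in>On. F a \<in> On) \<longrightarrow> (\<exists>i\<in>Field \<kappa>. \<forall>a\<in>On. \<exists>b. a \<prec> b \<and> closed_under F b \<and>
      b \<notin> cof_set \<Omega> \<kappa> \<and> G b i = {z \<in> Z. guess_rank len z \<prec> b})"
    using ex_guess[OF U, of "guess_rank len"] by (elim exE)
  interpret far_coding \<kappa> C G q0 \<phi>
    using C q0 \<phi>(1) G box by unfold_locales simp_all
  obtain S :: "'a set \<Rightarrow> bool \<Rightarrow> 'a \<Rightarrow> 'a set set" where
    S: "\<forall>i\<in>On. \<forall>v. \<forall>x\<in>Field \<kappa>. stationary \<Omega> (S i v x) \<and> S i v x \<subseteq> cof_set \<Omega> \<kappa>" and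
    disj: "\<forall>i\<in>On. \<forall>j\<in>On. \<forall>v w. \<forall>x\<in>Field \<kappa>. \<forall>y\<in>Field \<kappa>. \<forall>d. d \<in> S i v x \<longrightarrow> d \<in> S j w y \<longrightarrow>
       i = j \<and> v = w \<and> x = y"
    using ex_stationary_family[OF stationary_cof_set] by (elim exE conjE)
  \<comment> \<open>A point \<open>d\<close> diverts guess \<open>x\<close> for the set
    \<open>A\<close> if it lies in the stationary set whose label \<open>(i, v, x)\<close> states
    the membership of \<open>i\<close> in \<open>A\<close> correctly. At every other point all steps
    are canonical.\<close>
  define P where "P A d x \<longleftrightarrow> x \<in> Field \<kappa> \<and> (\<exists>i\<in>On. d \<in> S i (i \<in> A) x)" for A d x
  define \<tau> where "\<tau> A d = (if \<exists>x. P A d x then Some (SOME x. P A d x) else None)" for A d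
  \<comment> \<open>With the truth value in the label, the set for \<open>i \<in> A\<close> is
    active for \<open>A\<close> and inactive for \<open>B\<close> whichever of the two contains
    \<open>i\<close>. The asymmetric \<open>far_if\<close> thus applies in both cases.\<close>
  have far: "far \<Omega> (Tr (\<tau> A)) (Tr (\<tau> B))" if i: "i \<in> On" "(i \<in> A) \<noteq> (i \<in> B)" for A B i
  proof (rule far_if)
    fix x assume x: "x \<in> Field \<kappa>"
    have "\<tau> A d = Some x \<and> \<tau> B d = None" if d: "d \<in> S i (i \<in> A) x" for d
    proof
      have "P A d y \<longleftrightarrow> y = x" for y
        unfolding P_def using disj i(1) x d by blast
      then have "P A d = (\<lambda>y. y = x)" by (rule ext)
      then show "\<tau> A d = Some x" unfolding \<tau>_def by simp
      have "\<not> P B d y" for y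
        unfolding P_def using disj i x d by blast
      then show "\<tau> B d = None" unfolding \<tau>_def by simp
    qed
    moreover have "S i (i \<in> A) x \<in> NS_plus_restr \<Omega> (cof_set \<Omega> \<kappa>)"
      using S i(1) x unfolding NS_plus_restr_def by simp
    ultimately show "\<exists>S. S \<in> NS_plus_restr \<Omega> (cof_set \<Omega> \<kappa>) \<and> (\<forall>d\<in>S. \<tau> A d = Some x \<and> \<tau> B d = None)"
      by blast
  qed
  let ?T = "\<lambda>A. Tr (\<tau> A)"
  have dist: "far \<Omega> (?T A) (?T B)" if AB: "A \<subseteq> On" "B \<subseteq> On" "A \<noteq> B" for A B
  proof -
    obtain i where "i \<in> On" "(i \<in> A) \<noteq> (i \<in> B)" using AB by blast
    then show ?thesis by (rule far)
  qed
  have "inj_on ?T (Pow On)"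
  proof (rule inj_onI, rule ccontr)
    fix A B assume "A \<in> Pow On" "B \<in> Pow On" "?T A = ?T B" "A \<noteq> B"
    then show False using dist[of A B] near_refl[of "\<tau> A"] by simp
  qed
  then have "bij_betw ?T (Pow On) (?T ` Pow On)" by (rule inj_on_imp_bij_betw)
  then have "|?T ` Pow On| =o |Pow On|"
    using card_of_ordIso ordIso_symmetric by blast
  also have "|Pow On| =o |Func On (UNIV :: bool set)|" by (rule card_of_Pow_Func)
  also have "|Func On (UNIV :: bool set)| = ctwo ^c \<Omega>" unfolding cexp_def ctwo_def Field_card_of ..
  finally have card: "|?T ` Pow On| =o ctwo ^c \<Omega>" .
  show ?thesis
  proof (intro exI[of _ "?T ` Pow On"] conjI ballI impI card)
    fix T W assume "T \<in> ?T ` Pow On" "W \<in> ?T ` Pow On" "T \<noteq> W"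
    then show "far \<Omega> T W" using dist by blast
  qed (auto intro: aronszajn_Tr normal_Tr complete_Tr embeddable_Tr)
qed

end
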